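(* Let $f$ be a function and suppose, with $D_n^L=D_{1,n}^L+D_{2,n}^L$: 1. $\sup_{c\in I_n}\frac{|R_{1,n}^L(c,f)|+|R_{2,n}^L(c)|}{D_n^L(c,f)}\to0$ and $\sup_{c\in I_n}\frac{|R_{3,n}(c,f)|+|R_{4,n}(c)|}{D_n^L(c,f)}\to0$ in $P_f$-probability; 2. $\sup_{c\in I_n}\bigl|\frac{N_n(c)}{s_n^2(c)}-1\bigr|\to0$ in probability; 3. $D_{2,n}^L$ is a good variance function (see context) with $D_{2,n}^L(c)\ge\log(nc)$ for $c\in I_n$; 4. there is a minimizer $c_n(f)$ of $c\mapsto D_n^L(c,f)+2\lambda/c$ over $c\in(0,\infty)$ that satisfies $c_n(f)\in I_n$ and $2c_n(f)\in I_n$; 5. $D_{2,n}^R(c)\asymp D_{2,n}^L(c)\asymp s_n^2(c)$ uniformly in $c\in I_n$; 6. $f$ satisfies the good bias condition relative to $D_{1,n}^L$. Then the hierarchical Bayes credible sets $$\hat C_{n,\eta,M}=\bigcup_{\hat c_{1,n}(\eta_1)<c<\hat c_{2,n}(\eta_1)}\bigl\{f:\|\vec f_n-\hat f_{n,c}\|<Mr_n(c,\eta_2)\bigr\}$$ satisfy $P_f(f\in\hat C_{n,\eta,M})\to1$ for sufficiently large $M$. In particular, this is true if the polynomial, the product or the Sobolev-type eigenvalue condition (see context) holds and assumptions 4 and 6 hold.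
   Context: Setting. $\mathcal X$ is a set and for each $n$, $x_{1,n},\dots,x_{n,n}\in\mathcal X$ are known design points. For $f:\mathcal X\to\mathbb R$ write $\vec f_n=(f(x_{1,n}),\dots,f(x_{n,n}))^T$. Under $P_f$ one observes $\vec Y_n=\vec f_n+\vec\varepsilon_n$ with $\vec\varepsilon_n\sim\mathcal N_n(0,I)$. $W^1$ is a mean-zero Gaussian process on $\mathcal X$; $U_n$ is the covariance matrix of $(W^1_{x_{1,n}},\dots,W^1_{x_{n,n}})$, with orthonormal eigenbasis $e_{1,n},\dots,e_{n,n}$ and eigenvalues $\lambda_{1,n},\dots,\lambda_{n,n}$; $f_{j,n}=\vec f_n^Te_{j,n}$, $Z_{j,n}=\vec\varepsilon_n^Te_{j,n}$ (i.i.d. standard normal); $\Sigma_{n,c}=I+cU_n$; $\hat f_{n,c}=(I-\Sigma_{n,c}^{-1})\vec Y_n$. $I_n=[\log n/n,n^{m-1}]$ for a fixed constant $m\ge1$ (the exponent in the eigenvalue condition when one is assumed). $r_n(c,\eta_2)$ is the number such that the centered Euclidean ball of radius $r_n(c,\eta_2)$ has probability $\eta_2\in(0,1)$ under $\mathcal N_n(0,I-\Sigma_{n,c}^{-1})$. Hierarchical Bayes: $c$ has prior density $\pi(c)\propto c^{-1-\kappa}e^{-\lambda/c}$ for $c\in I_n$ (zero elsewhere), with fixed $\kappa,\lambda>0$; given $c$, $f$ is distributed as $\sqrt c\,W^1$; given $f,c$, $\vec Y_n\sim\mathcal N_n(\vec f_n,I)$. $\hat c_{1,n}(\eta_1)<\hat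 c_{2,n}(\eta_1)$ are two quantiles, at fixed levels strictly between 0 and 1 (determined by $\eta_1\in(0,1)$), of the posterior distribution of $c$ given $\vec Y_n$ (density proportional to $(\det\Sigma_{n,c})^{-1/2}e^{-\frac12\vec Y_n^T\Sigma_{n,c}^{-1}\vec Y_n}\pi(c)$). $\eta=(\eta_1,\eta_2)$. Functions: $D_{1,n}^L(c,f)=\sum_{j=1}^n\frac{f_{j,n}^2}{1+c\lambda_{j,n}}$, $D_{2,n}^L(c)=\sum_{j=1}^n\bigl[\log(1+c\lambda_{j,n})-\frac{c\lambda_{j,n}}{1+c\lambda_{j,n}}\bigr]$, $D_{2,n}^R(c)=\sum_{j=1}^n\frac{(c\lambda_{j,n})^2}{(1+c\lambda_{j,n})^2}$, $R_{1,n}^L(c,f)=2\sum_{j=1}^n\frac{Z_{j,n}f_{j,n}}{1+c\lambda_{j,n}}$, $R_{2,n}^L(c)=-\sum_{j=1}^n\frac{(Z_{j,n}^2-1)c\lambda_{j,n}}{1+c\lambda_{j,n}}$, $R_{3,n}(c,f)=-2\sum_{j=1}^n\frac{c\lambda_{j,n}Z_{j,n}f_{j,n}}{(1+c\lambda_{j,n})^2}$, $R_{4,n}(c)=\sum_{j=1}^n\frac{(c\lambda_{j,n})^2(Z_{j,n}^2-1)}{(1+c\lambda_{j,n})^2}$, $s_n^2(c)=\sum_{j=1}^n\frac{c\lambda_{j,n}}{1+c\lambda_{j,n}}$, $N_n(c)=\sum_{j=1}^n\frac{c\lambda_{j,n}Z_{j,n}^2}{1+c\lambda_{j,n}}$.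 Good bias condition relative to $D_{1,n}^L$: there is $a>0$ (independent of $n$) with $D_{1,n}^L(Kc,f)\le K^{-a}D_{1,n}^L(c,f)$ for all $c\in I_n$ and all $K>1$. Good variance function: there are $b,B,B'>0$ (independent of $n$) with $Bk^bD_{2,n}^L(c)\le D_{2,n}^L(kc)\le B'k^bD_{2,n}^L(c)$ for all $c\in I_n$ and $k\in(0,1)$ with $kc\in I_n$. Eigenvalue conditions. Polynomial: $\underline\delta n/j^m\le\lambda_{j,n}\le\overline\delta n/j^m$ for all $n$, $1\le j\le n$, with constants $0<\underline\delta\le\overline\delta<\infty$, $m\ge1$. Product: there are $n^2$ design points, the eigenvalues are indexed by $(i,j)\in\{1,\dots,n\}^2$ and $\lambda_{i,j,n}\asymp n^2/(i^mj^m)$, uniformly in $i,j$ and $n$. Sobolev-type: same with $\lambda_{i,j,n}\asymp n^2/(i^2+j^2)^m$. In the last two cases $m\ge1$ and everywhere $n$ is replaced by $n^2$ (in particular $I_n$ by $I_{n^2}$) and single sums by double sums. $a_n\asymp b_n$ uniformly means that $a_n/b_n$ is bounded away from $0$ and $\infty$ by the same constants over the domain, for large $n$. *)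

theory Defs
  imports
    "HOL-Probability.Probability"
    "Jordan_Normal_Form.Determinant"
    "Jordan_Normal_Form.Gauss_Jordan_Elimination"
begin

text \<open>Univariate normal law with mean 0 and standard deviation \<open>\<sigma> \<ge> 0\<close>; the case \<open>\<sigma> = 0\<close> is
  the point mass at 0, because a Gaussian process may be degenerate.\<close>

definition normal_law :: "real \<Rightarrow> real measure" where
  "normal_law \<sigma> = (if \<sigma> = 0 then return borel 0 else density lborel (\<lambda>t. ennreal (normal_density 0 \<sigma> t)))"

definition centered_gaussian_process :: "'w measure \<Rightarrow> ('x \<Rightarrow> 'w \<Rightarrow> real) \<Rightarrow> bool" where
  "centered_gaussian_process \<Omega> W \<longleftrightarrow>
     prob_space \<Omega> \<and> (\<forall>t. W t \<in> borel_measurable \<Omega>) \<and>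
     (\<forall>T a. finite T \<longrightarrow> (\<exists>\<sigma>\<ge>0. distr \<Omega> borel (\<lambda>\<omega>. \<Sum>t\<in>T. a t * W t \<omega>) = normal_law \<sigma>))"

definition covariance :: "'w measure \<Rightarrow> ('w \<Rightarrow> real) \<Rightarrow> ('w \<Rightarrow> real) \<Rightarrow> real" where
  "covariance \<Omega> X Y =
     (LINT \<omega>|\<Omega>. (X \<omega> - (LINT \<omega>|\<Omega>. X \<omega>)) * (Y \<omega> - (LINT \<omega>|\<Omega>. Y \<omega>)))"

text \<open>Laws on \<open>N\<close>-dimensional space live on the product space over \<open>{..<N}\<close>; a point \<open>z\<close> of it is
  read as the vector \<open>vec N z\<close>.\<close>

definition std_normal_vec :: "nat \<Rightarrow> (nat \<Rightarrow> real) measure" where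
  "std_normal_vec N = PiM {..<N} (\<lambda>_. std_normal_distribution)"

text \<open>The centered normal law with (possibly singular) positive semidefinite covariance matrix \<open>S\<close>:
  the law of \<open>A Z\<close> with \<open>Z\<close> standard normal and \<open>A A\<^sup>T = S\<close>. It does not depend on the choice of \<open>A\<close>.\<close>

definition mat_root :: "nat \<Rightarrow> real mat \<Rightarrow> real mat" where
  "mat_root N S = (SOME A. A \<in> carrier_mat N N \<and> A * transpose_mat A = S)"

definition centered_normal_vec :: "nat \<Rightarrow> real mat \<Rightarrow> (nat \<Rightarrow> real) measure" where
  "centered_normal_vec N S =
     distr (std_normal_vec N) (PiM {..<N} (\<lambda>_. borel))
       (\<lambda>z. \<lambda>i\<in>{..<N}. vec_index (mat_root N S *\<^sub>v vec N z) i)"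

definition euclid_norm :: "real vec \<Rightarrow> real" where
  "euclid_norm v = sqrt (scalar_prod v v)"

text \<open>One member of the sequence of experiments: the number of design points, the design points
  \<open>pts 1, \<dots>, pts npts\<close>, and the eigenvectors and eigenvalues of the prior covariance matrix. The
  eigenpairs carry an index set of their own, so that they can be indexed by \<open>{1..n}\<close> or, with
  \<open>n\<^sup>2\<close> design points, by \<open>{1..n} \<times> {1..n}\<close>; sums over \<open>idx\<close> are then single or double sums.\<close>

record ('x, 'i) design =
  npts :: nat
  pts :: "nat \<Rightarrow> 'x"
  idx :: "'i set"
  eigvec :: "'i \<Rightarrow> real vec"
  eigval :: "'i \<Rightarrow> real"

definition fvec :: "('x, 'i) design \<Rightarrow> ('x \<Rightarrow> real) \<Rightarrow> real vec" where
  "fvec E f = vec (npts E) (\<lambda>i. f (pts E (Suc i)))"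

definition prior_cov :: "'w measure \<Rightarrow> ('x \<Rightarrow> 'w \<Rightarrow> real) \<Rightarrow> ('x, 'i) design \<Rightarrow> real mat" where
  "prior_cov \<Omega> W E =
     mat (npts E) (npts E) (\<lambda>(i, j). covariance \<Omega> (W (pts E (Suc i))) (W (pts E (Suc j))))"

definition orthonormal_eigenbasis ::
  "'w measure \<Rightarrow> ('x \<Rightarrow> 'w \<Rightarrow> real) \<Rightarrow> ('x, 'i) design \<Rightarrow> bool" where
  "orthonormal_eigenbasis \<Omega> W E \<longleftrightarrow>
     finite (idx E) \<and> card (idx E) = npts E \<and>
     (\<forall>j\<in>idx E. eigvec E j \<in> carrier_vec (npts E)) \<and>
     (\<forall>i\<in>idx E. \<forall>j\<in>idx E. scalar_prod (eigvec E i) (eigvec E j) = (if i = j then 1 else 0)) \<and>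
     (\<forall>j\<in>idx E. prior_cov \<Omega> W E *\<^sub>v eigvec E j = eigval E j \<cdot>\<^sub>v eigvec E j)"

definition single_index_design ::
  "'w measure \<Rightarrow> ('x \<Rightarrow> 'w \<Rightarrow> real) \<Rightarrow> (nat \<Rightarrow> ('x, nat) design) \<Rightarrow> bool" where
  "single_index_design \<Omega> W E \<longleftrightarrow>
     (\<forall>n. npts (E n) = n \<and> idx (E n) = {1..n} \<and> orthonormal_eigenbasis \<Omega> W (E n))"

definition double_index_design ::
  "'w measure \<Rightarrow> ('x \<Rightarrow> 'w \<Rightarrow> real) \<Rightarrow> (nat \<Rightarrow> ('x, nat \<times> nat) design) \<Rightarrow> bool" where
  "double_index_design \<Omega> W E \<longleftrightarrow>
     (\<forall>n. npts (E n) = n\<^sup>2 \<and> idx (E n) = {1..n} \<times> {1..n} \<and> orthonormal_eigenbasis \<Omega> W (E n))"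

definition fcoef :: "('x, 'i) design \<Rightarrow> ('x \<Rightarrow> real) \<Rightarrow> 'i \<Rightarrow> real" where
  "fcoef E f j = scalar_prod (fvec E f) (eigvec E j)"

text \<open>The sample space carries the noise: \<open>z\<close> is the error vector, with law \<open>std_normal_vec\<close>.\<close>

definition zcoef :: "('x, 'i) design \<Rightarrow> (nat \<Rightarrow> real) \<Rightarrow> 'i \<Rightarrow> real" where
  "zcoef E z j = scalar_prod (vec (npts E) z) (eigvec E j)"

definition observation :: "('x, 'i) design \<Rightarrow> ('x \<Rightarrow> real) \<Rightarrow> (nat \<Rightarrow> real) \<Rightarrow> real vec" where
  "observation E f z = fvec E f + vec (npts E) z"

definition c_range :: "real \<Rightarrow> ('x, 'i) design \<Rightarrow> real set" where
  "c_range m E = {ln (real (npts E)) / real (npts E) .. real (npts E) powr (m - 1)}"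

definition Sigma_mat :: "real mat \<Rightarrow> real \<Rightarrow> real mat" where
  "Sigma_mat U c = 1\<^sub>m (dim_row U) + c \<cdot>\<^sub>m U"

definition Sigma_inv :: "real mat \<Rightarrow> real \<Rightarrow> real mat" where
  "Sigma_inv U c = the (mat_inverse (Sigma_mat U c))"

definition post_mean :: "real mat \<Rightarrow> real \<Rightarrow> real vec \<Rightarrow> real vec" where
  "post_mean U c y = (1\<^sub>m (dim_row U) - Sigma_inv U c) *\<^sub>v y"

definition radius :: "real mat \<Rightarrow> real \<Rightarrow> real \<Rightarrow> real" where
  "radius U c \<eta> =
     (let N = dim_row U; P = centered_normal_vec N (1\<^sub>m N - Sigma_inv U c)
      in THE r. measure P {v \<in> space P. euclid_norm (vec N v) < r} = \<eta>)"

text \<open>Prior and posterior density of \<open>c\<close>, both up to normalisation.\<close>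

definition prior_weight :: "real \<Rightarrow> real \<Rightarrow> real set \<Rightarrow> real \<Rightarrow> real" where
  "prior_weight \<kappa> lam I c = (if c \<in> I then c powr (- 1 - \<kappa>) * exp (- lam / c) else 0)"

definition post_weight :: "real \<Rightarrow> real \<Rightarrow> real set \<Rightarrow> real mat \<Rightarrow> real vec \<Rightarrow> real \<Rightarrow> real" where
  "post_weight \<kappa> lam I U y c =
     Determinant.det (Sigma_mat U c) powr (- 1 / 2)
     * exp (- (1 / 2) * scalar_prod y (Sigma_inv U c *\<^sub>v y))
     * prior_weight \<kappa> lam I c"

definition posterior :: "real \<Rightarrow> real \<Rightarrow> real set \<Rightarrow> real mat \<Rightarrow> real vec \<Rightarrow> real measure" where
  "posterior \<kappa> lam I U y =
     density lborel
       (\<lambda>c. ennreal (post_weight \<kappa> lam I U y c / (LINT t|lborel. post_weight \<kappa> lam I U y t)))"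

definition quantile :: "real measure \<Rightarrow> real \<Rightarrow> real" where
  "quantile \<mu> q = Inf {t. q \<le> measure \<mu> {..t}}"

definition credible_set ::
  "real \<Rightarrow> real \<Rightarrow> real \<Rightarrow> (real \<Rightarrow> real) \<Rightarrow> (real \<Rightarrow> real) \<Rightarrow> real \<times> real \<Rightarrow> 'w measure \<Rightarrow> ('x \<Rightarrow> 'w \<Rightarrow> real)
     \<Rightarrow> ('x, 'i) design \<Rightarrow> real \<Rightarrow> real vec \<Rightarrow> ('x \<Rightarrow> real) set" where
  "credible_set m \<kappa> lam q1 q2 \<eta> \<Omega> W E M y =
     (let U = prior_cov \<Omega> W E;
          post = posterior \<kappa> lam (c_range m E) U y
      in \<Union>c\<in>{quantile post (q1 (fst \<eta>)) <..< quantile post (q2 (fst \<eta>))}.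
           {g. euclid_norm (fvec E g - post_mean U c y) < M * radius U c (snd \<eta>)})"

definition coverage ::
  "real \<Rightarrow> real \<Rightarrow> real \<Rightarrow> (real \<Rightarrow> real) \<Rightarrow> (real \<Rightarrow> real) \<Rightarrow> real \<times> real \<Rightarrow> 'w measure \<Rightarrow> ('x \<Rightarrow> 'w \<Rightarrow> real)
     \<Rightarrow> ('x, 'i) design \<Rightarrow> real \<Rightarrow> ('x \<Rightarrow> real) \<Rightarrow> real" where
  "coverage m \<kappa> lam q1 q2 \<eta> \<Omega> W E M f =
     measure (std_normal_vec (npts E))
       {z \<in> space (std_normal_vec (npts E)).
          f \<in> credible_set m \<kappa> lam q1 q2 \<eta> \<Omega> W E M (observation E f z)}"

definition D1L :: "('x, 'i) design \<Rightarrow> real \<Rightarrow> ('x \<Rightarrow> real) \<Rightarrow> real" where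
  "D1L E c f = (\<Sum>j\<in>idx E. (fcoef E f j)\<^sup>2 / (1 + c * eigval E j))"

definition D2L :: "('x, 'i) design \<Rightarrow> real \<Rightarrow> real" where
  "D2L E c = (\<Sum>j\<in>idx E. ln (1 + c * eigval E j) - c * eigval E j / (1 + c * eigval E j))"

definition DL :: "('x, 'i) design \<Rightarrow> real \<Rightarrow> ('x \<Rightarrow> real) \<Rightarrow> real" where
  "DL E c f = D1L E c f + D2L E c"

definition D2R :: "('x, 'i) design \<Rightarrow> real \<Rightarrow> real" where
  "D2R E c = (\<Sum>j\<in>idx E. (c * eigval E j)\<^sup>2 / (1 + c * eigval E j)\<^sup>2)"

definition R1L :: "('x, 'i) design \<Rightarrow> (nat \<Rightarrow> real) \<Rightarrow> real \<Rightarrow> ('x \<Rightarrow> real) \<Rightarrow> real" where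
  "R1L E z c f = 2 * (\<Sum>j\<in>idx E. zcoef E z j * fcoef E f j / (1 + c * eigval E j))"

definition R2L :: "('x, 'i) design \<Rightarrow> (nat \<Rightarrow> real) \<Rightarrow> real \<Rightarrow> real" where
  "R2L E z c = - (\<Sum>j\<in>idx E. ((zcoef E z j)\<^sup>2 - 1) * (c * eigval E j) / (1 + c * eigval E j))"

definition R3 :: "('x, 'i) design \<Rightarrow> (nat \<Rightarrow> real) \<Rightarrow> real \<Rightarrow> ('x \<Rightarrow> real) \<Rightarrow> real" where
  "R3 E z c f = - 2 * (\<Sum>j\<in>idx E. c * eigval E j * zcoef E z j * fcoef E f j / (1 + c * eigval E j)\<^sup>2)"

definition R4 :: "('x, 'i) design \<Rightarrow> (nat \<Rightarrow> real) \<Rightarrow> real \<Rightarrow> real" where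
  "R4 E z c = (\<Sum>j\<in>idx E. (c * eigval E j)\<^sup>2 * ((zcoef E z j)\<^sup>2 - 1) / (1 + c * eigval E j)\<^sup>2)"

definition s2 :: "('x, 'i) design \<Rightarrow> real \<Rightarrow> real" where
  "s2 E c = (\<Sum>j\<in>idx E. c * eigval E j / (1 + c * eigval E j))"

definition N_stat :: "('x, 'i) design \<Rightarrow> (nat \<Rightarrow> real) \<Rightarrow> real \<Rightarrow> real" where
  "N_stat E z c = (\<Sum>j\<in>idx E. c * eigval E j * (zcoef E z j)\<^sup>2 / (1 + c * eigval E j))"

text \<open>Suprema are taken in the extended reals, where they always exist.\<close>

definition sup_tendsto_0_in_prob ::
  "(nat \<Rightarrow> ('x, 'i) design) \<Rightarrow> (nat \<Rightarrow> real set) \<Rightarrow> (nat \<Rightarrow> (nat \<Rightarrow> real) \<Rightarrow> real \<Rightarrow> real) \<Rightarrow> bool" where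
  "sup_tendsto_0_in_prob E I X \<longleftrightarrow>
     (\<forall>\<epsilon>>0. (\<lambda>n. measure (std_normal_vec (npts (E n)))
        {z \<in> space (std_normal_vec (npts (E n))). (SUP c\<in>I n. ereal \<bar>X n z c\<bar>) > ereal \<epsilon>}) \<longlonglongrightarrow> 0)"

definition unif_asymp :: "(nat \<Rightarrow> 'a set) \<Rightarrow> (nat \<Rightarrow> 'a \<Rightarrow> real) \<Rightarrow> (nat \<Rightarrow> 'a \<Rightarrow> real) \<Rightarrow> bool" where
  "unif_asymp S a b \<longleftrightarrow>
     (\<exists>A>0. \<exists>B. \<forall>\<^sub>F n in sequentially. \<forall>t\<in>S n. A \<le> a n t / b n t \<and> a n t / b n t \<le> B)"

text \<open>The conditions below concern the limit \<open>n \<rightarrow> \<infinity>\<close> and are required for all large \<open>n\<close>, with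
  constants not depending on \<open>n\<close>.\<close>

definition good_bias :: "real \<Rightarrow> (nat \<Rightarrow> ('x, 'i) design) \<Rightarrow> ('x \<Rightarrow> real) \<Rightarrow> bool" where
  "good_bias m E f \<longleftrightarrow>
     (\<exists>a>0. \<forall>\<^sub>F n in sequentially. \<forall>c\<in>c_range m (E n). \<forall>K>1.
        D1L (E n) (K * c) f \<le> K powr (- a) * D1L (E n) c f)"

definition good_variance :: "real \<Rightarrow> (nat \<Rightarrow> ('x, 'i) design) \<Rightarrow> bool" where
  "good_variance m E \<longleftrightarrow>
     (\<exists>b>0. \<exists>B>0. \<exists>B'>0. \<forall>\<^sub>F n in sequentially. \<forall>c\<in>c_range m (E n). \<forall>k\<in>{0<..<1}.
        k * c \<in> c_range m (E n) \<longrightarrow>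
        B * k powr b * D2L (E n) c \<le> D2L (E n) (k * c) \<and>
        D2L (E n) (k * c) \<le> B' * k powr b * D2L (E n) c)"

definition interior_minimizer ::
  "real \<Rightarrow> real \<Rightarrow> (nat \<Rightarrow> ('x, 'i) design) \<Rightarrow> ('x \<Rightarrow> real) \<Rightarrow> bool" where
  "interior_minimizer m lam E f \<longleftrightarrow>
     (\<forall>\<^sub>F n in sequentially. \<exists>c. is_arg_min (\<lambda>c. DL (E n) c f + 2 * lam / c) (\<lambda>c. c > 0) c \<and>
        c \<in> c_range m (E n) \<and> 2 * c \<in> c_range m (E n))"

definition polynomial_eigenvalues :: "real \<Rightarrow> (nat \<Rightarrow> ('x, nat) design) \<Rightarrow> bool" where
  "polynomial_eigenvalues m E \<longleftrightarrow>
     (\<exists>d d'. 0 < d \<and> d \<le> d' \<and>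
        (\<forall>n. \<forall>j\<in>{1..n}. d * real n / real j powr m \<le> eigval (E n) j \<and>
                        eigval (E n) j \<le> d' * real n / real j powr m))"

definition product_eigenvalues :: "real \<Rightarrow> (nat \<Rightarrow> ('x, nat \<times> nat) design) \<Rightarrow> bool" where
  "product_eigenvalues m E \<longleftrightarrow>
     unif_asymp (\<lambda>n. {1..n} \<times> {1..n}) (\<lambda>n. eigval (E n))
       (\<lambda>n (i, j). (real n)\<^sup>2 / (real i powr m * real j powr m))"

definition sobolev_eigenvalues :: "real \<Rightarrow> (nat \<Rightarrow> ('x, nat \<times> nat) design) \<Rightarrow> bool" where
  "sobolev_eigenvalues m E \<longleftrightarrow>
     unif_asymp (\<lambda>n. {1..n} \<times> {1..n}) (\<lambda>n. eigval (E n))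
       (\<lambda>n (i, j). (real n)\<^sup>2 / ((real i)\<^sup>2 + (real j)\<^sup>2) powr m)"

end

(* Up to a factor that does not depend on c, minus twice the log posterior density of c is
   D_L(c, f) + R_1(c, f) + R_2(c) + 2 lambda / c + 2 (1 + kappa) log c. Where the remainders are
   uniformly negligible against D_L, the posterior gives vanishing mass to {c < k c_n} for a small
   constant k, c_n being the minimizer of D_L + 2 lambda / c. For every c >= k c_n the squared bias is
   bounded by a multiple of the variance s_n^2(c), because c_n balances the two, and so is the squared
   error of the posterior mean. Chebyshev's inequality gives r_n(c)^2 >= s_n^2(c) / 2, so that any c
   between the two quantiles covers f. Under the eigenvalue conditions the remainders are controlled
   by second moments on the cells of a geometric grid of c, whose failure probabilities are summable
   because D_2 grows like a power of c. *)

theory Submission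
  imports Defs
begin

subsection \<open>The function ln (1 + x) - x / (1 + x)\<close>

text \<open>Coverage is reduced to a deterministic statement at a fixed design and noise vector: it
  holds as soon as the remainders are at most half of \<open>DL\<close> on the whole range of c, and
  probability enters only through that event. A factor 1/2, rather than o(1), keeps the posterior
  exponent between \<open>DL\<close> / 4 and 3 \<open>DL\<close> / 4, which costs constants only.
  Two obstacles shape the rest. Under the eigenvalue conditions the remainders must be bounded over
  a continuum of c: on a grid cell a <= c <= 3 a / 2 the factor 1 + c lambda splits into 1 + a
  lambda and a resolvent factor, and a geometric series replaces the supremum by one quadratic form.
  Secondly, \<open>radius\<close>, \<open>mat_inverse\<close>, \<open>mat_root\<close> and
  \<open>quantile\<close> are a definite description, a partial operation, a choice and an infimum,
  so laws without atoms and with full support, invertibility, existence of roots and boundedness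
  come before any computation; and the coverage event, a union over uncountably many c, has to be
  shown measurable, because \<open>measure\<close> is 0 on nonmeasurable sets. The variance
  conditions act on the minimizer through halving alone: \<open>D2L\<close> at k0 c is at most half
  of \<open>D2L\<close> at c.\<close>

definition log_gap :: "real \<Rightarrow> real" where
  "log_gap x = ln (1 + x) - x / (1 + x)"

text \<open>The derivative is rational and the value at 0 is 0, so most inequalities below for
  \<open>log_gap\<close> follow by comparing derivatives on the half line.\<close>

lemma log_gap_deriv:
  assumes "x \<ge> 0" shows "(log_gap has_real_derivative x / (1 + x)\<^sup>2) (at x)"
proof -
  have "(log_gap has_real_derivative 1 / (1 + x) - (1 * (1 + x) - x * 1) / ((1 + x) * (1 + x))) (at x)"
    unfolding log_gap_def using assms by (auto intro!: derivative_eq_intros)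
  moreover have "1 / (1 + x) - (1 * (1 + x) - x * 1) / ((1 + x) * (1 + x)) = x / (1 + x)\<^sup>2"
    using assms by (simp add: power2_eq_square divide_simps)
  ultimately show ?thesis by simp
qed

lemma log_gap_0 [simp]: "log_gap 0 = 0"
  by (simp add: log_gap_def)

lemma log_gap_mono: "0 \<le> x \<Longrightarrow> x \<le> y \<Longrightarrow> log_gap x \<le> log_gap y"
  by (rule DERIV_nonneg_imp_nondecreasing) (auto intro!: exI log_gap_deriv)

lemma log_gap_nonneg: "0 \<le> x \<Longrightarrow> 0 \<le> log_gap x"
  using log_gap_mono[of 0 x] by simp

lemma log_gap_le_square:
  assumes "0 \<le> x" shows "log_gap x \<le> x\<^sup>2 / 2"
proof -
  have "(\<lambda>x. x\<^sup>2 / 2 - log_gap x) 0 \<le> (\<lambda>x. x\<^sup>2 / 2 - log_gap x) x"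
  proof (rule DERIV_nonneg_imp_nondecreasing[OF assms])
    fix t :: real assume t: "0 \<le> t"
    have "((\<lambda>x. x\<^sup>2 / 2 - log_gap x) has_real_derivative (t - t / (1 + t)\<^sup>2)) (at t)"
      by (rule derivative_eq_intros log_gap_deriv t refl | simp)+
    moreover have "t / (1 + t)\<^sup>2 \<le> t / 1"
      using t by (intro divide_left_mono) auto
    ultimately show "\<exists>y. ((\<lambda>x. x\<^sup>2 / 2 - log_gap x) has_real_derivative y) (at t) \<and> 0 \<le> y"
      by auto
  qed
  then show ?thesis by simp
qed

text \<open>The difference of the two sides has derivative 2 t^2 / (1 + t)^3. Since x / (1 + x) is a
  shrinkage weight, this bounds the variance of \<open>R2L\<close>, which is twice a sum of squared
  weights, by a multiple of \<open>D2L\<close>.\<close>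

lemma log_gap_ge_square:
  assumes "0 \<le> x" shows "(x / (1 + x))\<^sup>2 \<le> 2 * log_gap x"
proof -
  let ?g = "\<lambda>x. 2 * log_gap x - (x / (1 + x))\<^sup>2"
  have "?g 0 \<le> ?g x"
  proof (rule DERIV_nonneg_imp_nondecreasing[OF assms])
    fix t :: real assume t: "0 \<le> t"
    have "(?g has_real_derivative (2 * (t / (1 + t)\<^sup>2) - 2 * (t / (1 + t)) * (1 / (1 + t)\<^sup>2))) (at t)"
    proof (rule DERIV_diff[OF DERIV_cmult[OF log_gap_deriv[OF t]]])
      have "((\<lambda>x. x / (1 + x)) has_real_derivative (1 * (1 + t) - t * 1) / ((1 + t) * (1 + t))) (at t)"
        using t by (auto intro!: derivative_eq_intros)
      then have "((\<lambda>x. x / (1 + x)) has_real_derivative 1 / (1 + t)\<^sup>2) (at t)"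
        by (simp add: power2_eq_square)
      from DERIV_power[OF this, of 2]
      show "((\<lambda>x. (x / (1 + x))\<^sup>2) has_real_derivative 2 * (t / (1 + t)) * (1 / (1 + t)\<^sup>2)) (at t)"
        by (simp add: mult_ac)
    qed
    moreover have "2 * (t / (1 + t)\<^sup>2) - 2 * (t / (1 + t)) * (1 / (1 + t)\<^sup>2) = 2 * t\<^sup>2 / (1 + t) ^ 3"
    proof -
      have "2 * (t / (1 + t)\<^sup>2) = 2 * t * (1 + t) / (1 + t) ^ 3"
        using t by (simp add: power2_eq_square power3_eq_cube)
      moreover have "2 * (t / (1 + t)) * (1 / (1 + t)\<^sup>2) = 2 * t / (1 + t) ^ 3"
        by (simp add: power2_eq_square power3_eq_cube)
      moreover have "2 * t * (1 + t) - 2 * t = 2 * t\<^sup>2" by (simp add: algebra_simps power2_eq_square)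
      ultimately show ?thesis by (metis diff_divide_distrib)
    qed
    ultimately show "\<exists>y. (?g has_real_derivative y) (at t) \<and> 0 \<le> y"
      using t by (intro exI[of _ "2 * t\<^sup>2 / (1 + t) ^ 3"]) auto
  qed
  then show ?thesis by simp
qed

text \<open>Both derivatives carry the factor k^2 t; only the denominators (1 + k t)^2 and (1 + t)^2
  differ. Summed over the spectrum: after shrinking c by k, \<open>D2L\<close> keeps at least the
  fraction k^2, and doubling c at most quadruples it.\<close>

lemma log_gap_scale:
  assumes "0 \<le> x" "0 < k" "k \<le> 1" shows "k\<^sup>2 * log_gap x \<le> log_gap (k * x)"
proof -
  let ?g = "\<lambda>x. log_gap (k * x) - k\<^sup>2 * log_gap x"
  have "?g 0 \<le> ?g x"
  proof (rule DERIV_nonneg_imp_nondecreasing[OF assms(1)])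
    fix t :: real assume t: "0 \<le> t"
    have kt: "0 \<le> k * t" using t assms by simp
    have "((\<lambda>x. log_gap (k * x)) has_real_derivative (k * t / (1 + k * t)\<^sup>2 * k)) (at t)"
      by (intro DERIV_chain2[where f = log_gap and g = "\<lambda>x. k * x", OF log_gap_deriv[OF kt]])
        (auto intro!: derivative_eq_intros)
    then have "(?g has_real_derivative (k * t / (1 + k * t)\<^sup>2 * k - k\<^sup>2 * (t / (1 + t)\<^sup>2))) (at t)"
      by (rule DERIV_diff) (rule DERIV_cmult[OF log_gap_deriv[OF t]])
    moreover have "t / (1 + t)\<^sup>2 \<le> t / (1 + k * t)\<^sup>2"
      using t kt assms mult_right_mono[of k 1 t]
      by (intro divide_left_mono power_mono) (auto intro!: mult_pos_pos add_pos_nonneg zero_less_power)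
    then have "k\<^sup>2 * (t / (1 + t)\<^sup>2) \<le> k * t / (1 + k * t)\<^sup>2 * k"
      using mult_left_mono[of "t / (1 + t)\<^sup>2" "t / (1 + k * t)\<^sup>2" "k\<^sup>2"]
      by (simp add: power2_eq_square mult_ac)
    ultimately show "\<exists>y. (?g has_real_derivative y) (at t) \<and> 0 \<le> y"
      by (metis diff_ge_0_iff_ge)
  qed
  then show ?thesis by simp
qed

text \<open>For x >= 1 the logarithms differ by at most ln (1 / k), which x / (1 + x) >= 1 / 2
  absorbs; for x < 1 already \<open>log_gap x\<close> <= x / 2 <= x / (1 + x). A drop of
  \<open>D2L\<close> under scaling is thus paid for by \<open>s2\<close>; together with halving this
  bounds \<open>D2L\<close> by a multiple of \<open>s2\<close>.\<close>

lemma log_gap_diff: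
  assumes "0 \<le> x" "0 < k" "k \<le> 1"
  shows "log_gap x - log_gap (k * x) \<le> (1 + 2 * ln (1 / k)) * (x / (1 + x))"
proof (cases "x \<ge> 1")
  case True
  have kx: "0 \<le> k * x" "k * x \<le> x" using assms mult_right_mono[of k 1 x] by auto
  have "k * x / (1 + k * x) \<le> x / (1 + x)"
    using kx assms by (simp add: divide_simps algebra_simps add_pos_nonneg)
  moreover have "ln (1 + x) \<le> ln ((1 + k * x) / k)"
    using assms True kx by (intro ln_mono) (auto simp: field_simps add_nonneg_pos)
  moreover have "ln ((1 + k * x) / k) = ln (1 + k * x) + ln (1 / k)"
    using assms kx by (simp add: ln_div)
  ultimately have "log_gap x - log_gap (k * x) \<le> ln (1 / k)"
    by (simp add: log_gap_def)
  also have "ln (1 / k) \<le> (2 * ln (1 / k)) * (x / (1 + x))"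
    using mult_left_mono[of "1 / 2" "x / (1 + x)" "2 * ln (1 / k)"] True assms
    by (simp add: field_simps)
  also have "\<dots> \<le> (1 + 2 * ln (1 / k)) * (x / (1 + x))"
    using assms by (intro mult_right_mono) auto
  finally show ?thesis .
next
  case False
  have "log_gap x - log_gap (k * x) \<le> log_gap x"
    using log_gap_nonneg[of "k * x"] assms by simp
  also have "\<dots> \<le> x\<^sup>2 / 2" by (rule log_gap_le_square[OF assms(1)])
  also have "\<dots> \<le> x / 2" using False assms by (simp add: power2_eq_square mult_left_le)
  also have "\<dots> \<le> x / (1 + x)" using False assms by (intro divide_left_mono) auto
  also have "\<dots> \<le> (1 + 2 * ln (1 / k)) * (x / (1 + x))"
    using assms mult_right_mono[of 1 "1 + 2 * ln (1 / k)" "x / (1 + x)"] by simp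
  finally show ?thesis .
qed

text \<open>Every index of \<open>X\<close> has q images, all distinct by injectivity, each with a
  term at least as large as its own shrunken one. With q = 8 the shrunken sum over \<open>X\<close>
  is at most an eighth of the full one.\<close>

lemma sum_log_gap_reindex:
  fixes \<phi> :: "nat \<Rightarrow> 'i \<Rightarrow> 'i"
  assumes "finite J" "X \<subseteq> J" and nonneg: "\<And>j. j \<in> J \<Longrightarrow> 0 \<le> x j" and "0 \<le> k"
    and inj: "inj_on (\<lambda>(r, j). \<phi> r j) ({..<q} \<times> X)"
    and \<phi>: "\<And>r j. r < q \<Longrightarrow> j \<in> X \<Longrightarrow> \<phi> r j \<in> J \<and> k * x j \<le> x (\<phi> r j)"
  shows "real q * (\<Sum>j\<in>X. log_gap (k * x j)) \<le> (\<Sum>j\<in>J. log_gap (x j))"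
proof -
  have finX: "finite X" using assms finite_subset by blast
  have "real q * (\<Sum>j\<in>X. log_gap (k * x j)) = (\<Sum>r<q. \<Sum>j\<in>X. log_gap (k * x j))"
    by simp
  also have "\<dots> \<le> (\<Sum>r<q. \<Sum>j\<in>X. log_gap (x (\<phi> r j)))"
    using \<phi> nonneg \<open>0 \<le> k\<close> \<open>X \<subseteq> J\<close> by (intro sum_mono log_gap_mono) auto
  also have "\<dots> = (\<Sum>p\<in>{..<q} \<times> X. log_gap (x ((\<lambda>(r, j). \<phi> r j) p)))"
    by (simp add: sum.cartesian_product case_prod_beta')
  also have "\<dots> = (\<Sum>j\<in>(\<lambda>(r, j). \<phi> r j) ` ({..<q} \<times> X). log_gap (x j))"
    by (simp add: sum.reindex[OF inj] comp_def)
  also have "\<dots> \<le> (\<Sum>j\<in>J. log_gap (x j))"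
    using \<phi> nonneg by (intro sum_mono2 \<open>finite J\<close>) (auto intro: log_gap_nonneg)
  finally show ?thesis .
qed

text \<open>For arguments bounded by b, \<open>log_gap\<close> is quadratic up to constants: the
  upper bound (k x)^2 / 2 and the lower bound (x / (1 + x))^2 / 2 have ratio (k (1 + x))^2 <= 1 /
  4.\<close>

lemma sum_log_gap_small:
  assumes "finite J" "X \<subseteq> J" and nonneg: "\<And>j. j \<in> J \<Longrightarrow> 0 \<le> x j" and "0 \<le> k" "k * (1 + b) \<le> 1 / 2"
    and bound: "\<And>j. j \<in> X \<Longrightarrow> x j \<le> b"
  shows "(\<Sum>j\<in>X. log_gap (k * x j)) \<le> (\<Sum>j\<in>J. log_gap (x j)) / 4"
proof -
  have "(\<Sum>j\<in>X. log_gap (k * x j)) \<le> (\<Sum>j\<in>X. log_gap (x j) / 4)"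
  proof (rule sum_mono)
    fix j assume j: "j \<in> X"
    let ?x = "x j"
    have x: "0 \<le> ?x" "?x \<le> b" using j assms by auto
    have "log_gap (k * ?x) \<le> (k * ?x)\<^sup>2 / 2"
      using x assms by (intro log_gap_le_square) auto
    also have "(k * ?x)\<^sup>2 = ((k * (1 + ?x)) * (?x / (1 + ?x)))\<^sup>2" using x by simp
    also have "\<dots> \<le> ((1 / 2) * (?x / (1 + ?x)))\<^sup>2"
    proof (intro power_mono mult_right_mono)
      show "k * (1 + ?x) \<le> 1 / 2"
        using x assms mult_left_mono[of "1 + ?x" "1 + b" k] by linarith
    qed (use x assms in auto)
    also have "\<dots> = (?x / (1 + ?x))\<^sup>2 / 4" unfolding power_mult_distrib by (simp add: power2_eq_square)
    finally show "log_gap (k * ?x) \<le> log_gap ?x / 4" using log_gap_ge_square[OF x(1)] by simp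
  qed
  also have "\<dots> \<le> (\<Sum>j\<in>J. log_gap (x j) / 4)"
    using assms by (intro sum_mono2) (auto intro: log_gap_nonneg)
  finally show ?thesis by (simp add: sum_divide_distrib)
qed

text \<open>In y = x powr a the claim is that y powr (p / a) * exp (- y / 8) is bounded; A >= 1 only
  strengthens the decay. The bound absorbs the polynomial factor that the prior density contributes
  when c is far below the minimizer.\<close>

lemma powr_exp_bounded:
  assumes "0 < a" "0 \<le> p"
  obtains C :: real where "0 < C" "\<And>x A. 1 \<le> x \<Longrightarrow> 1 \<le> A \<Longrightarrow> x powr p * exp (- (x powr a * A / 8)) \<le> C"
proof -
  define C where "C = exp (p / a * ln (8 * (p / a) + 1))"
  have "x powr p * exp (- (x powr a * A / 8)) \<le> C" if x: "1 \<le> x" and A: "1 \<le> A" for x A :: real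
  proof -
    define y where "y = x powr a"
    define t where "t = p / a"
    \<comment> \<open>ln y <= y / u + ln u holds for every u > 0; the term 8 t makes t / u at most 1
      / 8, and the summand 1 keeps u positive when p = 0.\<close>
    define u where "u = 8 * t + 1"
    have t: "0 \<le> t" using assms by (simp add: t_def)
    have u: "1 \<le> u" using t by (simp add: u_def)
    have y: "1 \<le> y" using x assms by (simp add: y_def ge_one_powr_ge_zero)
    have "ln y = ln (y / u) + ln u" using y u by (simp add: ln_div)
    also have "\<dots> \<le> y / u + ln u" using ln_le_minus_one[of "y / u"] y u by simp
    finally have "t * ln y \<le> t * (y / u) + t * ln u"
      using mult_left_mono[OF _ t] by (fastforce simp: distrib_left)
    moreover have "t * (y / u) \<le> y / 8" using y u t by (simp add: u_def field_simps)
    moreover have "y / 8 \<le> y * A / 8" using y A by simp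
    ultimately have "t * ln y - y * A / 8 \<le> t * ln u" by linarith
    moreover have "t * ln y = p * ln x" using x assms by (simp add: t_def y_def ln_powr)
    ultimately have "exp (p * ln x - y * A / 8) \<le> C" by (simp add: C_def t_def u_def)
    then show ?thesis
      using x by (simp add: powr_def y_def exp_add[symmetric])
  qed
  then show ?thesis using that[of C] by (simp add: C_def)
qed

text \<open>Expanding \<open>1 / (1 + s y)\<close> into a geometric series and applying the Cauchy-Schwarz inequality
  with weights \<open>2 ^ k\<close> gives a bound that does not depend on \<open>s\<close>: a supremum over \<open>s\<close> of linear forms
  in \<open>\<xi>\<close> is controlled by one quadratic form, whose mean is easy to compute.\<close>

lemma square_sum_resolvent_le:
  fixes y v \<xi> :: "'i \<Rightarrow> real"
  assumes "finite J" and y: "\<And>j. j \<in> J \<Longrightarrow> 0 \<le> y j \<and> y j \<le> 1" and s: "0 \<le> s" "s \<le> 1 / 2"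
  shows "(\<Sum>j\<in>J. v j * \<xi> j / (1 + s * y j))\<^sup>2
      \<le> 2 * (\<Sum>i\<in>J. \<Sum>j\<in>J. (v i * \<xi> i) * (v j * \<xi> j) / (1 - y i * y j / 2))"
proof -
  define b where "b k = (\<Sum>j\<in>J. v j * \<xi> j * y j ^ k)" for k :: nat
  have 1: "(\<lambda>k. (- s) ^ k * b k) sums (\<Sum>j\<in>J. v j * \<xi> j / (1 + s * y j))"
  proof -
    have "(\<lambda>k. \<Sum>j\<in>J. v j * \<xi> j * (- s * y j) ^ k) sums (\<Sum>j\<in>J. v j * \<xi> j * (1 / (1 - (- s * y j))))"
    proof (intro sums_sum sums_mult geometric_sums)
      fix j assume "j \<in> J"
      then have "s * y j \<le> 1 / 2 * 1" using y s by (intro mult_mono) auto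
      then show "norm (- s * y j) < 1" using y s \<open>j \<in> J\<close> by (simp add: abs_mult)
    qed
    moreover have "(- s * y j) ^ k = (- s) ^ k * y j ^ k" for j k by (rule power_mult_distrib)
    ultimately show ?thesis by (simp add: b_def sum_distrib_left mult_ac del: mult_minus_left)
  qed
  have 2: "(\<lambda>k. (1 / 2) ^ k * (b k)\<^sup>2) sums (\<Sum>i\<in>J. \<Sum>j\<in>J. (v i * \<xi> i) * (v j * \<xi> j) / (1 - y i * y j / 2))"
  proof -
    have "(\<lambda>k. \<Sum>i\<in>J. \<Sum>j\<in>J. (v i * \<xi> i) * (v j * \<xi> j) * (y i * y j / 2) ^ k)
        sums (\<Sum>i\<in>J. \<Sum>j\<in>J. (v i * \<xi> i) * (v j * \<xi> j) * (1 / (1 - y i * y j / 2)))"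
    proof (intro sums_sum sums_mult geometric_sums)
      fix i j assume "i \<in> J" "j \<in> J"
      then have "y i * y j \<le> 1" "0 \<le> y i * y j" using y by (auto intro!: mult_le_one)
      then show "norm (y i * y j / 2) < 1" by simp
    qed
    then show ?thesis
      by (simp add: b_def power2_eq_square sum_product sum_distrib_left power_mult_distrib
          power_divide mult_ac)
  qed
  have "(\<Sum>k<n. (- s) ^ k * b k)\<^sup>2 \<le> 2 * (\<Sum>k<n. (1 / 2) ^ k * (b k)\<^sup>2)" for n
  proof -
    \<comment> \<open>The powers of sqrt 2 are the Cauchy-Schwarz weights. Since s <= 1 / 2, (2
      s^2)^k <= (1 / 2)^k, and the sum of these is the factor 2 of the bound.\<close>
    define r :: real where "r = sqrt 2"
    have r: "r\<^sup>2 = 2" "r > 0" by (auto simp: r_def)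
    have rk: "(r ^ k)\<^sup>2 = 2 ^ k" for k
      unfolding r(1)[symmetric] power_mult[symmetric] by (simp add: mult.commute)
    have "(\<Sum>k<n. (- s) ^ k * b k)\<^sup>2 = (\<Sum>k<n. (r ^ k * (- s) ^ k) * (b k / r ^ k))\<^sup>2"
      using r by (intro arg_cong[where f = "\<lambda>x. x\<^sup>2"] sum.cong) auto
    also have "\<dots> \<le> (\<Sum>k<n. (r ^ k * (- s) ^ k)\<^sup>2) * (\<Sum>k<n. (b k / r ^ k)\<^sup>2)"
      by (rule Cauchy_Schwarz_ineq_sum)
    also have "(\<Sum>k<n. (b k / r ^ k)\<^sup>2) = (\<Sum>k<n. (1 / 2) ^ k * (b k)\<^sup>2)"
      by (simp add: power_divide rk)
    also have "(\<Sum>k<n. (r ^ k * (- s) ^ k)\<^sup>2) * \<dots> \<le> 2 * \<dots>"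
    proof (rule mult_right_mono)
      have "(\<Sum>k<n. (r ^ k * (- s) ^ k)\<^sup>2) \<le> (\<Sum>k<n. (1 / 2) ^ k)"
      proof (rule sum_mono)
        fix k
        have "(r ^ k * (- s) ^ k)\<^sup>2 = (2 * s\<^sup>2) ^ k"
          unfolding power_mult_distrib rk by (simp add: power_mult[symmetric] mult.commute[of k 2])
        also have "s\<^sup>2 \<le> (1 / 2)\<^sup>2" using s by (intro power_mono) auto
        then have "(2 * s\<^sup>2) ^ k \<le> (1 / 2) ^ k" by (intro power_mono) (auto simp: power2_eq_square)
        finally show "(r ^ k * (- s) ^ k)\<^sup>2 \<le> (1 / 2) ^ k" .
      qed
      also have "\<dots> \<le> (\<Sum>k. (1 / 2) ^ k)"
        by (intro sum_le_suminf summable_geometric) auto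
      also have "\<dots> = 2" by (simp add: suminf_geometric)
      finally show "(\<Sum>k<n. (r ^ k * (- s) ^ k)\<^sup>2) \<le> 2" .
    qed (auto intro: sum_nonneg)
    finally show ?thesis .
  qed
  moreover have "(\<lambda>n. (\<Sum>k<n. (- s) ^ k * b k)\<^sup>2) \<longlonglongrightarrow> (\<Sum>j\<in>J. v j * \<xi> j / (1 + s * y j))\<^sup>2"
    using 1 by (intro tendsto_intros) (simp add: sums_def)
  moreover have "(\<lambda>n. 2 * (\<Sum>k<n. (1 / 2) ^ k * (b k)\<^sup>2)) \<longlonglongrightarrow>
      2 * (\<Sum>i\<in>J. \<Sum>j\<in>J. (v i * \<xi> i) * (v j * \<xi> j) / (1 - y i * y j / 2))"
    using 2 by (intro tendsto_intros) (simp add: sums_def)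
  ultimately show ?thesis by (metis (no_types, lifting) LIMSEQ_le)
qed


subsection \<open>Moments of standard normal vectors\<close>

lemma real_distribution_std_normal: "real_distribution std_normal_distribution"
  by (rule real_dist_normal_dist)

lemma prob_space_std_normal: "prob_space std_normal_distribution"
  using real_distribution_std_normal by (simp add: real_distribution_def)

lemma sets_std_normal_vec [measurable_cong]:
  "sets (std_normal_vec N) = sets (PiM {..<N} (\<lambda>_. borel))"
  unfolding std_normal_vec_def by (intro sets_PiM_cong) auto

lemma space_std_normal_vec: "space (std_normal_vec N) = PiE {..<N} (\<lambda>_. UNIV)"
  unfolding std_normal_vec_def by (simp add: space_PiM)

lemma prob_space_std_normal_vec: "prob_space (std_normal_vec N)"
  unfolding std_normal_vec_def by (intro prob_space_PiM prob_space_std_normal)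

lemma char_linear_form_std_normal_vec:
  "(LINT z|std_normal_vec N. iexp (\<Sum>k<N. u k * z k)) = complex_of_real (exp (- (\<Sum>k<N. (u k)\<^sup>2) / 2))"
proof -
  interpret product_sigma_finite "\<lambda>_::nat. std_normal_distribution"
    by (intro product_sigma_finite.intro prob_space_imp_sigma_finite prob_space_std_normal)
  interpret S: real_distribution std_normal_distribution by (rule real_distribution_std_normal)
  have "(LINT z|std_normal_vec N. iexp (\<Sum>k<N. u k * z k))
      = (LINT z|std_normal_vec N. (\<Prod>k<N. iexp (u k * z k)))"
    by (simp add: exp_sum sum_distrib_left)
  also have "\<dots> = (\<Prod>k<N. (LINT x|std_normal_distribution. iexp (u k * x)))"
    unfolding std_normal_vec_def by (rule product_integral_prod) (auto intro: S.integrable_iexp)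
  also have "\<dots> = (\<Prod>k<N. complex_of_real (exp (- (u k)\<^sup>2 / 2)))"
    using fun_cong[OF char_std_normal_distribution] by (simp add: char_def)
  also have "\<dots> = complex_of_real (exp (- (\<Sum>k<N. (u k)\<^sup>2) / 2))"
    unfolding of_real_prod[symmetric] by (subst exp_sum[symmetric]) (auto simp: sum_negf sum_divide_distrib)
  finally show ?thesis .
qed

text \<open>A unit vector gives the characteristic function exp (- t^2 / 2), and Levy uniqueness
  identifies the law. This takes the place of rotation invariance of the product measure.\<close>

lemma distr_linear_form_std_normal_vec:
  assumes "(\<Sum>k<N. (u k)\<^sup>2) = 1"
  shows "distr (std_normal_vec N) borel (\<lambda>z. \<Sum>k<N. u k * z k) = std_normal_distribution"
proof -
  interpret prob_space "std_normal_vec N" by (rule prob_space_std_normal_vec)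
  have [measurable]: "(\<lambda>z. \<Sum>k<N. u k * z k) \<in> borel_measurable (std_normal_vec N)"
    by measurable
  show ?thesis
  proof (rule Levy_uniqueness[OF _ real_distribution_std_normal])
    show "real_distribution (distr (std_normal_vec N) borel (\<lambda>z. \<Sum>k<N. u k * z k))"
      by (rule real_distribution_distr) simp
    show "char (distr (std_normal_vec N) borel (\<lambda>z. \<Sum>k<N. u k * z k)) = char std_normal_distribution"
    proof
      fix t
      have "char (distr (std_normal_vec N) borel (\<lambda>z. \<Sum>k<N. u k * z k)) t
          = (LINT z|std_normal_vec N. iexp (\<Sum>k<N. (t * u k) * z k))"
        by (simp add: char_def integral_distr sum_distrib_left mult_ac)
      also have "\<dots> = complex_of_real (exp (- (t\<^sup>2 * (\<Sum>k<N. (u k)\<^sup>2)) / 2))"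
        by (subst char_linear_form_std_normal_vec) (simp add: power_mult_distrib sum_distrib_left)
      finally show "char (distr (std_normal_vec N) borel (\<lambda>z. \<Sum>k<N. u k * z k)) t
          = char std_normal_distribution t"
        by (simp add: assms char_std_normal_distribution)
    qed
  qed
qed

text \<open>After division by the length of u the form is standard normal; the zero vector cannot be
  normalised and is treated apart.\<close>

lemma linear_form_moments:
  fixes u :: "nat \<Rightarrow> real"
  shows integrable_linear_form_power: "integrable (std_normal_vec N) (\<lambda>z. (\<Sum>k<N. u k * z k) ^ p)"
    and linear_form_moment_2: "(LINT z|std_normal_vec N. (\<Sum>k<N. u k * z k)\<^sup>2) = (\<Sum>k<N. (u k)\<^sup>2)"
    and linear_form_moment_4: "(LINT z|std_normal_vec N. (\<Sum>k<N. u k * z k) ^ 4) = 3 * (\<Sum>k<N. (u k)\<^sup>2)\<^sup>2"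
proof -
  interpret prob_space "std_normal_vec N" by (rule prob_space_std_normal_vec)
  have [measurable]: "(\<lambda>z. \<Sum>k<N. u k * z k) \<in> borel_measurable (std_normal_vec N)" for u
    by measurable
  define s where "s = (\<Sum>k<N. (u k)\<^sup>2)"
  have "integrable (std_normal_vec N) (\<lambda>z. (\<Sum>k<N. u k * z k) ^ p) \<and>
     (LINT z|std_normal_vec N. (\<Sum>k<N. u k * z k)\<^sup>2) = s \<and>
     (LINT z|std_normal_vec N. (\<Sum>k<N. u k * z k) ^ 4) = 3 * s\<^sup>2"
  proof (cases "s = 0")
    case True
    then have "u k = 0" if "k < N" for k
      using that by (simp add: s_def sum_nonneg_eq_0_iff)
    then show ?thesis using True by simp
  next
    case False
    then have "s > 0" by (simp add: s_def sum_nonneg less_le)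
    define r where "r = sqrt s"
    have r: "r > 0" "r\<^sup>2 = s" using \<open>s > 0\<close> by (auto simp: r_def)
    define v where "v k = u k / r" for k
    have v: "(\<Sum>k<N. (v k)\<^sup>2) = 1"
      using r \<open>s > 0\<close> by (simp add: v_def power_divide sum_divide_distrib[symmetric] s_def[symmetric])
    have u: "(\<Sum>k<N. u k * z k) = r * (\<Sum>k<N. v k * z k)" for z
      using r by (simp add: v_def sum_distrib_left)
    note D = distr_linear_form_std_normal_vec[OF v]
    have int: "integrable (std_normal_vec N) (\<lambda>z. (\<Sum>k<N. v k * z k) ^ p)" for p
      using integrable_std_normal_distribution_moment[of p]
      unfolding D[symmetric] by (subst (asm) integrable_distr_eq) auto
    have mom: "(LINT z|std_normal_vec N. (\<Sum>k<N. v k * z k) ^ p)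
        = (LINT x|std_normal_distribution. x ^ p)" for p
      unfolding D[symmetric] by (subst integral_distr) auto
    have "(LINT z|std_normal_vec N. (\<Sum>k<N. v k * z k) ^ 2) = 1"
      using std_normal_distribution_even_moments(1)[of 1] by (simp add: mom)
    moreover have "(LINT z|std_normal_vec N. (\<Sum>k<N. v k * z k) ^ 4) = 3"
      using std_normal_distribution_even_moments(1)[of 2] by (simp add: mom fact_numeral)
    moreover have "r ^ 4 = s\<^sup>2" unfolding r(2)[symmetric] by simp
    ultimately show ?thesis using int r by (simp add: u power_mult_distrib)
  qed
  then show "integrable (std_normal_vec N) (\<lambda>z. (\<Sum>k<N. u k * z k) ^ p)"
    "(LINT z|std_normal_vec N. (\<Sum>k<N. u k * z k)\<^sup>2) = (\<Sum>k<N. (u k)\<^sup>2)"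
    "(LINT z|std_normal_vec N. (\<Sum>k<N. u k * z k) ^ 4) = 3 * (\<Sum>k<N. (u k)\<^sup>2)\<^sup>2"
    by (auto simp: s_def)
qed

text \<open>Polarisation avoids the joint law of U and V: the products are combinations of squares
  and fourth powers of U, V, U + V and U - V, each a single linear form. By orthonormality the last
  two have squared length 2, hence fourth moment 3 * 4 = 12.\<close>

lemma linear_form_product_moments:
  fixes u v :: "nat \<Rightarrow> real" and N :: nat
  defines "U \<equiv> \<lambda>z. \<Sum>k<N. u k * z k" and "V \<equiv> \<lambda>z. \<Sum>k<N. v k * z k"
  assumes u: "(\<Sum>k<N. (u k)\<^sup>2) = 1" and v: "(\<Sum>k<N. (v k)\<^sup>2) = 1" and uv: "(\<Sum>k<N. u k * v k) = 0"
  shows "has_bochner_integral (std_normal_vec N) (\<lambda>z. U z * V z) 0"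
    and "has_bochner_integral (std_normal_vec N) (\<lambda>z. ((U z)\<^sup>2 - 1) * ((V z)\<^sup>2 - 1)) 0"
proof -
  interpret prob_space "std_normal_vec N" by (rule prob_space_std_normal_vec)
  note int = integrable_linear_form_power
  have sum: "(\<Sum>k<N. (u k + v k) * z k) = U z + V z" "(\<Sum>k<N. (u k - v k) * z k) = U z - V z" for z
    by (auto simp: U_def V_def algebra_simps sum.distrib sum_subtractf)
  have norms: "(\<Sum>k<N. (u k + v k)\<^sup>2) = 2" "(\<Sum>k<N. (u k - v k)\<^sup>2) = 2"
    using u v uv by (auto simp: power2_sum power2_diff sum.distrib sum_subtractf mult.assoc sum_distrib_left[symmetric])
  have p: "has_bochner_integral (std_normal_vec N) (\<lambda>z. (U z + V z)\<^sup>2) 2"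
      "has_bochner_integral (std_normal_vec N) (\<lambda>z. (U z - V z)\<^sup>2) 2"
      "has_bochner_integral (std_normal_vec N) (\<lambda>z. (U z + V z) ^ 4) 12"
      "has_bochner_integral (std_normal_vec N) (\<lambda>z. (U z - V z) ^ 4) 12"
      "has_bochner_integral (std_normal_vec N) (\<lambda>z. (U z)\<^sup>2) 1"
      "has_bochner_integral (std_normal_vec N) (\<lambda>z. (V z)\<^sup>2) 1"
      "has_bochner_integral (std_normal_vec N) (\<lambda>z. (U z) ^ 4) 3"
      "has_bochner_integral (std_normal_vec N) (\<lambda>z. (V z) ^ 4) 3"
    using int[of N "\<lambda>k. u k + v k"] int[of N "\<lambda>k. u k - v k"] int[of N u] int[of N v]
      linear_form_moment_2[of N "\<lambda>k. u k + v k"] linear_form_moment_2[of N "\<lambda>k. u k - v k"]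
      linear_form_moment_4[of N "\<lambda>k. u k + v k"] linear_form_moment_4[of N "\<lambda>k. u k - v k"]
      linear_form_moment_2[of N u] linear_form_moment_2[of N v]
      linear_form_moment_4[of N u] linear_form_moment_4[of N v]
    unfolding sum norms u v U_def[symmetric] V_def[symmetric]
    by (auto simp: has_bochner_integral_iff U_def V_def)
  have "has_bochner_integral (std_normal_vec N) (\<lambda>z. ((U z + V z)\<^sup>2 - (U z - V z)\<^sup>2) / 4) ((2 - 2) / 4)"
    by (intro has_bochner_integral_divide_zero has_bochner_integral_diff p)
  then show "has_bochner_integral (std_normal_vec N) (\<lambda>z. U z * V z) 0"
    by (simp add: power2_sum power2_diff)
  have one: "has_bochner_integral (std_normal_vec N) (\<lambda>z. 1 :: real) 1"
    by (simp add: has_bochner_integral_iff prob_space)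
  have "has_bochner_integral (std_normal_vec N)
    (\<lambda>z. (((U z + V z) ^ 4 + (U z - V z) ^ 4) - ((U z) ^ 4 + (U z) ^ 4) - ((V z) ^ 4 + (V z) ^ 4)) / 12
       - (U z)\<^sup>2 - (V z)\<^sup>2 + 1)
    (((12 + 12) - (3 + 3) - (3 + 3)) / 12 - 1 - 1 + 1)"
    by (intro has_bochner_integral_divide_zero has_bochner_integral_diff has_bochner_integral_add p one)
  moreover have "(((a + b) ^ 4 + (a - b) ^ 4) - (a ^ 4 + a ^ 4) - (b ^ 4 + b ^ 4)) / 12
       - a\<^sup>2 - b\<^sup>2 + 1 = (a\<^sup>2 - 1) * (b\<^sup>2 - 1)" for a b :: real
    by (simp add: power4_eq_xxxx power2_eq_square field_simps)
  ultimately show "has_bochner_integral (std_normal_vec N) (\<lambda>z. ((U z)\<^sup>2 - 1) * ((V z)\<^sup>2 - 1)) 0"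
    by simp
qed

lemma linear_form_centered_square_moment:
  fixes u :: "nat \<Rightarrow> real"
  assumes u: "(\<Sum>k<N. (u k)\<^sup>2) = 1"
  shows "has_bochner_integral (std_normal_vec N) (\<lambda>z. ((\<Sum>k<N. u k * z k)\<^sup>2 - 1)\<^sup>2) 2"
proof -
  interpret prob_space "std_normal_vec N" by (rule prob_space_std_normal_vec)
  let ?U = "\<lambda>z. \<Sum>k<N. u k * z k"
  have one: "has_bochner_integral (std_normal_vec N) (\<lambda>z. 1 :: real) 1"
    by (simp add: has_bochner_integral_iff prob_space)
  have p: "has_bochner_integral (std_normal_vec N) (\<lambda>z. (?U z)\<^sup>2) 1"
     "has_bochner_integral (std_normal_vec N) (\<lambda>z. (?U z) ^ 4) 3"
    using integrable_linear_form_power[of N u] linear_form_moment_2[of N u] linear_form_moment_4[of N u] u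
    by (auto simp: has_bochner_integral_iff)
  have "has_bochner_integral (std_normal_vec N) (\<lambda>z. ?U z ^ 4 - (?U z)\<^sup>2 - (?U z)\<^sup>2 + 1) (3 - 1 - 1 + 1)"
    by (intro has_bochner_integral_diff has_bochner_integral_add p one)
  moreover have "a ^ 4 - a\<^sup>2 - a\<^sup>2 + 1 = (a\<^sup>2 - 1)\<^sup>2" for a :: real
    by (simp add: power4_eq_xxxx power2_eq_square field_simps)
  ultimately show ?thesis by simp
qed

text \<open>Orthogonality of the variables leaves only the diagonal. \<open>V\<close> is their
  common second moment: 1 for the Z_j and 2 for the Z_j^2 - 1.\<close>

lemma has_bochner_integral_quadratic_form:
  fixes \<xi> :: "'i \<Rightarrow> 'a \<Rightarrow> real"
  assumes "finite J"
    and "\<And>i j. i \<in> J \<Longrightarrow> j \<in> J \<Longrightarrow> has_bochner_integral M (\<lambda>z. \<xi> i z * \<xi> j z) (if i = j then V else 0)"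
  shows "has_bochner_integral M (\<lambda>z. \<Sum>i\<in>J. \<Sum>j\<in>J. (v i * \<xi> i z) * (v j * \<xi> j z) / d i j)
    (V * (\<Sum>j\<in>J. (v j)\<^sup>2 / d j j))"
proof -
  have "has_bochner_integral M (\<lambda>z. \<Sum>i\<in>J. \<Sum>j\<in>J. (v i * v j / d i j) * (\<xi> i z * \<xi> j z))
     (\<Sum>i\<in>J. \<Sum>j\<in>J. (v i * v j / d i j) * (if i = j then V else 0))"
    by (intro has_bochner_integral_sum has_bochner_integral_mult_right assms)
  moreover have "(\<Sum>i\<in>J. \<Sum>j\<in>J. (v i * v j / d i j) * (if i = j then V else 0)) = V * (\<Sum>j\<in>J. (v j)\<^sup>2 / d j j)"
    using assms(1) by (simp add: if_distrib sum.delta sum_distrib_left power2_eq_square mult_ac cong: if_cong)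
  ultimately show ?thesis by (simp add: mult_ac)
qed


subsection \<open>Radii of centred normal laws\<close>

text \<open>The exponential series may be integrated termwise, being dominated by that of exp |t|.
  Hence the moments of a variable with values in [0, 1] determine its characteristic function and so
  its law.\<close>

lemma char_unit_interval_sums:
  assumes M: "prob_space M" and [measurable]: "p \<in> borel_measurable M"
    and p: "\<And>z. 0 \<le> p z \<and> p z \<le> (1 :: real)"
  shows "(\<lambda>n. (\<i> * of_real t) ^ n / fact n * complex_of_real (LINT z|M. p z ^ n)) sums char (distr M borel p) t"
proof -
  interpret prob_space M by fact
  define f where "f n z = (\<i> * of_real t) ^ n / fact n * complex_of_real (p z ^ n)" for n z
  have [measurable]: "f n \<in> borel_measurable M" for n unfolding f_def by measurable
  have nf: "norm (f n z) \<le> \<bar>t\<bar> ^ n / fact n" for n z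
    using p[of z] mult_left_mono[of "p z ^ n" 1 "\<bar>t\<bar> ^ n / fact n"]
    by (simp add: f_def norm_mult norm_power norm_divide power_le_one)
  have sm: "summable (\<lambda>n. \<bar>t\<bar> ^ n / fact n)"
    using summable_exp[of "\<bar>t\<bar>"] by (simp add: field_simps)
  have int: "integrable M (f n)" for n
    by (rule integrable_const_bound[where B = "\<bar>t\<bar> ^ n / fact n"]) (auto simp: nf)
  have "(\<lambda>n. integral\<^sup>L M (f n)) sums (LINT z|M. (\<Sum>n. f n z))"
  proof (rule sums_integral)
    show "AE z in M. summable (\<lambda>n. norm (f n z))"
      by (intro AE_I2 summable_comparison_test'[OF sm, where N = 0]) (auto simp: nf)
    show "summable (\<lambda>n. LINT z|M. norm (f n z))"
    proof (rule summable_comparison_test'[OF sm, where N = 0])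
      fix n
      have "(LINT z|M. norm (f n z)) \<le> (LINT z|M. \<bar>t\<bar> ^ n / fact n)"
        by (intro integral_mono integrable_norm int) (auto simp: nf)
      then show "norm (LINT z|M. norm (f n z)) \<le> \<bar>t\<bar> ^ n / fact n"
        by (simp add: prob_space abs_of_nonneg)
    qed
  qed (rule int)
  moreover have "(\<Sum>n. f n z) = iexp (t * p z)" for z
  proof -
    have "(\<lambda>n. (\<i> * complex_of_real (t * p z)) ^ n /\<^sub>R fact n) sums iexp (t * p z)"
      by (rule exp_converges)
    moreover have "(\<i> * complex_of_real (t * p z)) ^ n /\<^sub>R fact n = f n z" for n
      by (simp add: f_def scaleR_conv_of_real power_mult_distrib field_simps)
    ultimately show ?thesis by (simp add: sums_iff)
  qed
  ultimately show ?thesis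
    unfolding f_def by (simp add: char_def integral_distr del: of_real_power)
qed

text \<open>The moments of exp (- X) are the values of the Laplace transform of X at the natural
  numbers; they determine the law of exp (- X), from which - ln recovers X.\<close>

lemma distr_eq_if_laplace_eq:
  assumes "prob_space M" "prob_space M'"
    and [measurable]: "X \<in> borel_measurable M" "Y \<in> borel_measurable M'"
    and nonneg: "\<And>z. 0 \<le> (X z :: real)" "\<And>z. 0 \<le> (Y z :: real)"
    and eq: "\<And>n :: nat. (LINT z|M. exp (- (n * X z))) = (LINT z|M'. exp (- (n * Y z)))"
  shows "distr M borel X = distr M' borel Y"
proof -
  interpret M: prob_space M by fact
  interpret M': prob_space M' by fact
  have "distr M borel (\<lambda>z. exp (- X z)) = distr M' borel (\<lambda>z. exp (- Y z))"
  proof (rule Levy_uniqueness)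
    show "char (distr M borel (\<lambda>z. exp (- X z))) = char (distr M' borel (\<lambda>z. exp (- Y z)))"
    proof
      fix t
      show "char (distr M borel (\<lambda>z. exp (- X z))) t = char (distr M' borel (\<lambda>z. exp (- Y z))) t"
        using char_unit_interval_sums[of M "\<lambda>z. exp (- X z)" t] char_unit_interval_sums[of M' "\<lambda>z. exp (- Y z)" t]
        using assms by (auto simp: exp_of_nat_mult[symmetric] intro: sums_unique2)
    qed
  qed (auto intro!: M.real_distribution_distr M'.real_distribution_distr)
  then have "distr (distr M borel (\<lambda>z. exp (- X z))) borel (\<lambda>x. - ln x)
      = distr (distr M' borel (\<lambda>z. exp (- Y z))) borel (\<lambda>x. - ln x)"
    by simp
  then show ?thesis by (simp add: distr_distr comp_def)
qed

text \<open>Writing \<open>exp (- t |a|\<^sup>2 / 2)\<close> as the mean of \<open>exp (i sqrt t (g \<bullet> a))\<close> over standard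
  normal \<open>g\<close>, both Laplace transforms become the mean of \<open>exp (i sqrt t (g \<bullet> A z))\<close> over
  independent \<open>g\<close> and \<open>z\<close>.\<close>

lemma distr_norm_square_transpose:
  fixes A :: "nat \<Rightarrow> nat \<Rightarrow> real"
  shows "distr (std_normal_vec N) borel (\<lambda>z. \<Sum>i<N. (\<Sum>k<N. A i k * z k)\<^sup>2)
    = distr (std_normal_vec N) borel (\<lambda>z. \<Sum>k<N. (\<Sum>i<N. A i k * z i)\<^sup>2)"
proof (rule distr_eq_if_laplace_eq)
  let ?S = "std_normal_vec N"
  interpret S: prob_space ?S by (rule prob_space_std_normal_vec)
  interpret P: pair_prob_space ?S ?S ..
  fix n :: nat
  \<comment> \<open>With this t the mean of \<open>F z g\<close> over g is exp (- n |A z|^2), a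
    Laplace transform at n; over z it is exp (- n |A^T g|^2).\<close>
  define t where "t = sqrt (2 * real n)"
  have t2: "t\<^sup>2 = 2 * real n" by (simp add: t_def)
  define F where "F z g = iexp (t * (\<Sum>i<N. g i * (\<Sum>k<N. A i k * z k)))" for z g :: "nat \<Rightarrow> real"
  have 1: "(LINT g|?S. F z g) = complex_of_real (exp (- (n * (\<Sum>i<N. (\<Sum>k<N. A i k * z k)\<^sup>2))))" for z
    using char_linear_form_std_normal_vec[of N "\<lambda>i. t * (\<Sum>k<N. A i k * z k)"]
    by (simp add: F_def sum_distrib_left[symmetric] power_mult_distrib t2 mult_ac)
  have F2: "F z g = iexp (\<Sum>k<N. (t * (\<Sum>i<N. A i k * g i)) * z k)" for z g
  proof -
    have "t * (\<Sum>i<N. g i * (\<Sum>k<N. A i k * z k)) = (\<Sum>i<N. \<Sum>k<N. t * A i k * g i * z k)"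
      by (simp add: sum_distrib_left mult_ac)
    also have "\<dots> = (\<Sum>k<N. \<Sum>i<N. t * A i k * g i * z k)" by (rule sum.swap)
    also have "\<dots> = (\<Sum>k<N. (t * (\<Sum>i<N. A i k * g i)) * z k)"
      by (simp add: sum_distrib_left sum_distrib_right mult_ac)
    finally show ?thesis by (simp add: F_def)
  qed
  have 2: "(LINT z|?S. F z g) = complex_of_real (exp (- (n * (\<Sum>k<N. (\<Sum>i<N. A i k * g i)\<^sup>2))))" for g
    unfolding F2
    by (subst char_linear_form_std_normal_vec)
       (simp add: power_mult_distrib t2 sum_distrib_left[symmetric])
  have "integrable (?S \<Otimes>\<^sub>M ?S) (case_prod F)"
  proof (rule P.integrable_const_bound[where B = 1])
    show "case_prod F \<in> borel_measurable (?S \<Otimes>\<^sub>M ?S)"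
      unfolding F_def by measurable
  qed (auto simp: F_def)
  then have "(LINT g|?S. LINT z|?S. F z g) = (LINT z|?S. LINT g|?S. F z g)"
    by (rule P.Fubini_integral)
  then have "complex_of_real (LINT g|?S. exp (- (n * (\<Sum>k<N. (\<Sum>i<N. A i k * g i)\<^sup>2))))
     = complex_of_real (LINT z|?S. exp (- (n * (\<Sum>i<N. (\<Sum>k<N. A i k * z k)\<^sup>2))))"
    unfolding 1 2 by (simp del: of_real_exp)
  then show "(LINT z|?S. exp (- (n * (\<Sum>i<N. (\<Sum>k<N. A i k * z k)\<^sup>2))))
     = (LINT z|?S. exp (- (n * (\<Sum>k<N. (\<Sum>i<N. A i k * z i)\<^sup>2))))"
    by (simp only: of_real_eq_iff)
qed (auto intro!: prob_space_std_normal_vec sum_nonneg)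

text \<open>Without atoms the distribution function is continuous and takes the value \<eta>;
  positive mass of every interval makes it strictly increasing on the half line, so it does so only
  once. Uniqueness gives a meaning to \<open>radius\<close>, a definite description.\<close>

lemma ex1_quantile:
  assumes M: "prob_space M" and [measurable]: "X \<in> borel_measurable M"
    and nonneg: "\<And>z. 0 \<le> (X z :: real)"
    and atom: "\<And>a. measure M {z\<in>space M. X z = a} = 0"
    and pos: "\<And>a b. 0 \<le> a \<Longrightarrow> a < b \<Longrightarrow> 0 < measure M {z\<in>space M. a < X z \<and> X z < b}"
    and \<eta>: "0 < \<eta>" "\<eta> < 1"
  shows "\<exists>!r. measure M {z\<in>space M. X z < r} = \<eta>"
proof -
  interpret prob_space M by fact
  interpret D: real_distribution "distr M borel X" by (rule real_distribution_distr) simp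
  let ?F = "\<lambda>r. measure M {z\<in>space M. X z < r}"
  have strict: "?F a < ?F b" if "0 \<le> a" "a < b" for a b
  proof -
    have "?F a + measure M {z\<in>space M. a < X z \<and> X z < b}
        = measure M ({z\<in>space M. X z < a} \<union> {z\<in>space M. a < X z \<and> X z < b})"
      by (rule finite_measure_Union[symmetric]) auto
    also have "\<dots> \<le> ?F b" using that by (intro finite_measure_mono) auto
    finally show ?thesis using pos[OF that] by linarith
  qed
  have zero: "?F a = 0" if "a \<le> 0" for a
    using nonneg that by (metis (mono_tags, lifting) Collect_empty_eq measure_empty not_less order_trans)
  have cdf: "cdf (distr M borel X) a = ?F a" for a
  proof -
    have "cdf (distr M borel X) a = measure M {z\<in>space M. X z \<le> a}"
      by (simp add: cdf_def measure_distr vimage_def Int_def conj_commute)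
    also have "{z\<in>space M. X z \<le> a} = {z\<in>space M. X z < a} \<union> {z\<in>space M. X z = a}" by auto
    also have "measure M \<dots> = ?F a + measure M {z\<in>space M. X z = a}"
      by (rule finite_measure_Union) auto
    finally show ?thesis by (simp add: atom)
  qed
  have cont: "isCont ?F a" for a
  proof -
    have "measure (distr M borel X) {a} = measure M {z\<in>space M. X z = a}"
      by (simp add: measure_distr vimage_def Int_def conj_commute)
    then have "isCont (cdf (distr M borel X)) a" using atom by (simp add: D.isCont_cdf)
    then show ?thesis by (simp add: cdf[abs_def])
  qed
  have "(?F \<longlongrightarrow> 1) at_top" using D.cdf_lim_at_top_prob by (simp add: cdf[abs_def])
  then have "\<forall>\<^sub>F r in at_top. \<eta> < ?F r" using \<eta>(2) by (rule order_tendstoD(1))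
  then obtain b where b: "b \<ge> 0" "\<eta> < ?F b"
    by (metis (mono_tags, lifting) eventually_at_top_linorder max.cobounded1 max.cobounded2)
  have "\<exists>r. 0 \<le> r \<and> r \<le> b \<and> ?F r = \<eta>"
    using b \<eta> zero[of 0] cont by (intro IVT) auto
  then obtain r where r: "0 \<le> r" "?F r = \<eta>" by auto
  show ?thesis
  proof (rule ex1I[of _ r])
    fix r' assume r': "?F r' = \<eta>"
    then have "0 < r'" using zero[of r'] \<eta> by force
    then show "r' = r" using strict[of r r'] strict[of r' r] r r' by (metis less_eq_real_def less_irrefl linorder_neqE)
  qed (rule r)
qed


section \<open>Atoms and support of the law of a weighted sum of squares\<close>

lemma std_normal_open_pos:
  assumes "open X" "X \<noteq> {}" shows "emeasure std_normal_distribution X \<noteq> 0"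
proof
  assume "emeasure std_normal_distribution X = 0"
  then have "X \<in> null_sets std_normal_distribution" using assms by (simp add: null_sets_def)
  then have "AE x in lborel. x \<in> X \<longrightarrow> ennreal (std_normal_density x) = 0"
    by (simp add: null_sets_density_iff)
  moreover have "ennreal (std_normal_density x) \<noteq> 0" for x
    using normal_density_pos[of 1 0 x] by (simp add: ennreal_eq_0_iff)
  ultimately have "AE x in lborel. x \<notin> X" by simp
  then have "X \<in> null_sets lborel" using assms by (simp add: AE_iff_null_sets[symmetric])
  then have "negligible X" by (simp add: negligible_iff_null_sets null_sets_completionI)
  then show False using open_not_negligible assms by blast
qed

text \<open>The direction \<open>j0\<close> of positive weight keeps \<open>Q\<close> from vanishing
  identically; the law of the zero form is a point mass, for which no ball has probability strictly
  between 0 and 1.\<close>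

locale quadratic_form =
  fixes N :: nat and J :: "'i set" and w :: "'i \<Rightarrow> real" and e :: "'i \<Rightarrow> nat \<Rightarrow> real" and j0 :: 'i
  assumes fin: "finite J" and w: "\<And>j. j \<in> J \<Longrightarrow> 0 \<le> w j"
    and j0: "j0 \<in> J" "0 < w j0" "(\<Sum>k<N. (e j0 k)\<^sup>2) = 1"
begin

definition Q :: "(nat \<Rightarrow> real) \<Rightarrow> real" where
  "Q z = (\<Sum>j\<in>J. w j * (\<Sum>k<N. e j k * z k)\<^sup>2)"

lemma Q_nonneg: "0 \<le> Q z"
  using w by (auto simp: Q_def intro!: sum_nonneg)

lemma measurable_Q [measurable]: "Q \<in> borel_measurable (std_normal_vec N)"
  unfolding Q_def by measurable

text \<open>With all coordinates but k fixed, \<open>Q\<close> - a is a polynomial of degree 2 in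
  coordinate k, with positive leading coefficient because \<open>e j0 k\<close> is nonzero. Its
  finitely many roots are null, and Fubini integrates the zero sections.\<close>

lemma null_level_set: "measure (std_normal_vec N) {z \<in> space (std_normal_vec N). Q z = a} = 0"
proof -
  interpret product_sigma_finite "\<lambda>_::nat. std_normal_distribution"
    by (intro product_sigma_finite.intro prob_space_imp_sigma_finite prob_space_std_normal)
  have "\<exists>k<N. e j0 k \<noteq> 0"
    using j0(3) by (rule contrapos_pp) simp
  then obtain k where k: "k < N" "e j0 k \<noteq> 0" by blast
  define I where "I = {..<N} - {k}"
  have I: "finite I" "k \<notin> I" "{..<N} = insert k I" using k by (auto simp: I_def)
  let ?A = "{z \<in> space (std_normal_vec N). Q z = a}"
  have A: "?A \<in> sets (std_normal_vec N)" by measurable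
  have "(\<integral>\<^sup>+ y. indicator ?A (x(k := y)) \<partial>std_normal_distribution) = 0"
    if x: "x \<in> space (PiM I (\<lambda>_. std_normal_distribution))" for x
  proof -
    define b where "b j = (\<Sum>i\<in>I. e j i * x i)" for j
    define p where "p = [: (\<Sum>j\<in>J. w j * (b j)\<^sup>2) - a, (\<Sum>j\<in>J. 2 * w j * b j * e j k), (\<Sum>j\<in>J. w j * (e j k)\<^sup>2) :]"
    have Q: "Q (x(k := y)) - a = poly p y" for y
    proof -
      have lin: "(\<Sum>i<N. e j i * (x(k := y)) i) = e j k * y + b j" for j
      proof -
        have "(\<Sum>i\<in>I. e j i * (x(k := y)) i) = b j"
          unfolding b_def using I by (intro sum.cong) auto
        then show ?thesis unfolding I(3) using I by (simp del: fun_upd_apply) simp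
      qed
      have sq: "w j * (e j k * y + b j)\<^sup>2 = w j * (b j)\<^sup>2 + (2 * w j * b j * e j k) * y + (w j * (e j k)\<^sup>2) * (y * y)" for j
        by (simp add: power2_eq_square algebra_simps)
      have "Q (x(k := y)) = (\<Sum>j\<in>J. w j * (b j)\<^sup>2 + (2 * w j * b j * e j k) * y + (w j * (e j k)\<^sup>2) * (y * y))"
        unfolding Q_def lin sq ..
      also have "\<dots> = (\<Sum>j\<in>J. w j * (b j)\<^sup>2) + (\<Sum>j\<in>J. 2 * w j * b j * e j k) * y + (\<Sum>j\<in>J. w j * (e j k)\<^sup>2) * (y * y)"
        by (simp only: sum.distrib sum_distrib_right)
      finally show ?thesis
        by (simp add: p_def algebra_simps)
    qed
    have "0 < (\<Sum>j\<in>J. w j * (e j k)\<^sup>2)"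
      using k j0 w by (intro sum_pos2[OF fin j0(1)]) auto
    then have "p \<noteq> 0" by (simp add: p_def)
    then have fin: "finite {y. poly p y = 0}" by (rule poly_roots_finite)
    have "{y. poly p y = 0} \<in> null_sets lborel"
      using fin by (simp add: finite_imp_null_set_lborel)
    then have "AE y in std_normal_distribution. y \<notin> {y. poly p y = 0}"
      by (subst AE_density) (auto dest: AE_not_in)
    then have "AE y in std_normal_distribution. indicator ?A (x(k := y)) = (0::ennreal)"
      by (rule AE_mp) (auto simp: Q[symmetric] split: split_indicator intro!: AE_I2)
    then show ?thesis by (simp add: nn_integral_0_iff_AE cong: nn_integral_cong_AE)
  qed
  then have "(\<integral>\<^sup>+ x. \<integral>\<^sup>+ y. indicator ?A (x(k := y)) \<partial>std_normal_distribution \<partial>PiM I (\<lambda>_. std_normal_distribution)) = 0"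
    by (simp cong: nn_integral_cong)
  also have "(\<integral>\<^sup>+ x. \<integral>\<^sup>+ y. indicator ?A (x(k := y)) \<partial>std_normal_distribution \<partial>PiM I (\<lambda>_. std_normal_distribution))
      = (\<integral>\<^sup>+ z. indicator ?A z \<partial>PiM (insert k I) (\<lambda>_. std_normal_distribution))"
    using A by (intro product_nn_integral_insert[symmetric] I)
      (simp add: std_normal_vec_def I(3)[symmetric])
  also have "\<dots> = emeasure (std_normal_vec N) ?A"
    using A by (simp add: std_normal_vec_def I(3)[symmetric])
  finally show ?thesis by (simp add: measure_def)
qed

text \<open>By homogeneity some multiple of \<open>e j0\<close> has the value (a + b) / 2; by
  continuity an open box around it stays between a and b, and a box with nonempty open sides has
  positive product measure.\<close>

lemma Q_interval_pos:
  assumes "0 \<le> a" "a < b"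
  shows "0 < measure (std_normal_vec N) {z \<in> space (std_normal_vec N). a < Q z \<and> Q z < b}"
proof -
  interpret S: prob_space "std_normal_vec N" by (rule prob_space_std_normal_vec)
  interpret product_sigma_finite "\<lambda>_::nat. std_normal_distribution"
    by (intro product_sigma_finite.intro prob_space_imp_sigma_finite prob_space_std_normal)
  let ?U = "{z. a < Q z \<and> Q z < b}"
  have Qpos: "0 < Q (e j0)"
  proof -
    have "0 < w j0 * (\<Sum>k<N. e j0 k * e j0 k)\<^sup>2" using j0 by (simp add: power2_eq_square)
    then show ?thesis unfolding Q_def
      by (intro sum_pos2[OF fin j0(1)]) (auto simp: w)
  qed
  define t where "t = sqrt ((a + b) / 2 / Q (e j0))"
  have "t\<^sup>2 = (a + b) / 2 / Q (e j0)" using assms Qpos by (simp add: t_def)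
  moreover have "Q (\<lambda>k. t * e j0 k) = t\<^sup>2 * Q (e j0)"
  proof -
    have "(\<Sum>k<N. e j k * (t * e j0 k)) = t * (\<Sum>k<N. e j k * e j0 k)" for j
      by (simp add: sum_distrib_left mult_ac)
    then have "w j * (\<Sum>k<N. e j k * (t * e j0 k))\<^sup>2 = t\<^sup>2 * (w j * (\<Sum>k<N. e j k * e j0 k)\<^sup>2)" for j
      by (simp add: power_mult_distrib)
    then show ?thesis unfolding Q_def by (simp only: sum_distrib_left[of "t\<^sup>2"])
  qed
  ultimately have "Q (\<lambda>k. t * e j0 k) = (a + b) / 2" using Qpos by simp
  define z0 where "z0 = (\<lambda>k. t * e j0 k)"
  have z0: "z0 \<in> ?U" using assms \<open>Q (\<lambda>k. t * e j0 k) = (a + b) / 2\<close> by (simp add: z0_def)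
  have cont: "continuous_on UNIV Q"
    unfolding Q_def
    by (intro continuous_intros continuous_on_product_coordinates)
  have "open ?U"
    by (intro open_Collect_conj open_Collect_less continuous_intros cont)
  then have "openin (product_topology (\<lambda>_. euclidean) UNIV) ?U" by (simp add: open_fun_def)
  from product_topology_open_contains_basis[OF this z0]
  obtain X where X: "z0 \<in> (\<Pi>\<^sub>E i\<in>UNIV. X i)" "\<And>i. open (X i)" "(\<Pi>\<^sub>E i\<in>UNIV. X i) \<subseteq> ?U"
    by auto
  have XS: "X i \<in> sets std_normal_distribution" for i using X by simp
  have sub: "(\<Pi>\<^sub>E i\<in>{..<N}. X i) \<subseteq> {z \<in> space (std_normal_vec N). a < Q z \<and> Q z < b}"
  proof
    fix z assume z: "z \<in> (\<Pi>\<^sub>E i\<in>{..<N}. X i)"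
    \<comment> \<open>The topology is that of all sequences while the measure lives on the first N
      coordinates; \<open>Q\<close> ignores the others, which are filled in from
      \<open>z0\<close>.\<close>
    define z' where "z' i = (if i < N then z i else z0 i)" for i
    have "z' \<in> (\<Pi>\<^sub>E i\<in>UNIV. X i)" using z X(1) by (auto simp: z'_def PiE_def Pi_def)
    then have "a < Q z'" "Q z' < b" using X(3) by auto
    moreover have "Q z' = Q z" by (simp add: Q_def z'_def)
    ultimately show "z \<in> {z \<in> space (std_normal_vec N). a < Q z \<and> Q z < b}"
      using z by (auto simp: space_std_normal_vec PiE_def)
  qed
  have "emeasure (std_normal_vec N) (\<Pi>\<^sub>E i\<in>{..<N}. X i) = (\<Prod>i<N. emeasure std_normal_distribution (X i))"
    unfolding std_normal_vec_def using XS by (intro emeasure_PiM) auto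
  also have "\<dots> \<noteq> 0"
  proof -
    have "X i \<noteq> {}" for i using X(1) by (auto simp: PiE_def Pi_def)
    then show ?thesis using std_normal_open_pos[OF X(2)] by (simp add: prod_zero_iff)
  qed
  finally have "0 < measure (std_normal_vec N) (\<Pi>\<^sub>E i\<in>{..<N}. X i)"
    by (simp add: S.emeasure_eq_measure zero_less_measure_iff)
  also have "\<dots> \<le> measure (std_normal_vec N) {z \<in> space (std_normal_vec N). a < Q z \<and> Q z < b}"
    by (intro S.finite_measure_mono sub) measurable
  finally show ?thesis .
qed

lemma ex1_radius:
  assumes "0 < \<eta>" "\<eta> < 1"
  shows "\<exists>!r. measure (std_normal_vec N) {z \<in> space (std_normal_vec N). sqrt (Q z) < r} = \<eta>"
proof (rule ex1_quantile)
  show "measure (std_normal_vec N) {z \<in> space (std_normal_vec N). sqrt (Q z) = a} = 0" for a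
  proof (cases "a \<ge> 0")
    case True
    then have "sqrt (Q z) = a \<longleftrightarrow> Q z = a\<^sup>2" for z
      using Q_nonneg[of z] by (auto simp: real_sqrt_unique)
    then show ?thesis using null_level_set by simp
  next
    case False
    then have "sqrt (Q z) \<noteq> a" for z using real_sqrt_ge_zero[OF Q_nonneg[of z]] by linarith
    then show ?thesis by simp
  qed
  fix a b :: real assume ab: "0 \<le> a" "a < b"
  have "a < sqrt (Q z) \<longleftrightarrow> a\<^sup>2 < Q z" "sqrt (Q z) < b \<longleftrightarrow> Q z < b\<^sup>2" for z
    using ab real_sqrt_less_iff[of "a\<^sup>2" "Q z"] real_sqrt_less_iff[of "Q z" "b\<^sup>2"] by auto
  moreover have "a\<^sup>2 < b\<^sup>2" using ab by (intro power_strict_mono) auto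
  ultimately show "0 < measure (std_normal_vec N) {z \<in> space (std_normal_vec N). a < sqrt (Q z) \<and> sqrt (Q z) < b}"
    using Q_interval_pos[of "a\<^sup>2" "b\<^sup>2"] by simp
qed (use assms Q_nonneg in \<open>auto intro: prob_space_std_normal_vec\<close>)

end


subsection \<open>Spectral calculus for the prior covariance\<close>

lemma square_integrable_gaussian_process:
  assumes gp: "centered_gaussian_process \<Omega> W"
  shows "integrable \<Omega> (\<lambda>\<omega>. (W t \<omega>)\<^sup>2)"
proof -
  have [measurable]: "W t \<in> borel_measurable \<Omega>" using gp by (simp add: centered_gaussian_process_def)
  obtain \<sigma> where \<sigma>: "\<sigma> \<ge> 0" "distr \<Omega> borel (\<lambda>\<omega>. \<Sum>s\<in>{t}. 1 * W s \<omega>) = normal_law \<sigma>"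
  proof -
    have "\<forall>T a. finite T \<longrightarrow> (\<exists>\<sigma>\<ge>0. distr \<Omega> borel (\<lambda>\<omega>. \<Sum>t\<in>T. a t * W t \<omega>) = normal_law \<sigma>)"
      using gp by (simp add: centered_gaussian_process_def)
    from this[rule_format, of "{t}" "\<lambda>_. 1"] show ?thesis using that by auto
  qed
  have "integrable (normal_law \<sigma>) (\<lambda>x. x\<^sup>2)"
  proof (cases "\<sigma> = 0")
    case True
    then show ?thesis by (simp add: normal_law_def integrable_iff_bounded nn_integral_return)
  next
    case False
    then have "\<sigma> > 0" using \<sigma> by simp
    then show ?thesis
      using integrable_normal_moment[of \<sigma> 0 2] False
      by (simp add: normal_law_def integrable_density)
  qed
  then have "integrable (distr \<Omega> borel (W t)) (\<lambda>x. x\<^sup>2)" using \<sigma>(2) by simp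
  then show ?thesis by (subst (asm) integrable_distr_eq) auto
qed

locale eigen_design =
  fixes \<Omega> :: "'w measure" and W :: "'x \<Rightarrow> 'w \<Rightarrow> real" and E :: "('x, 'i) design"
  assumes gp: "centered_gaussian_process \<Omega> W" and eb: "orthonormal_eigenbasis \<Omega> W E"
begin

abbreviation "N \<equiv> npts E"
abbreviation "J \<equiv> idx E"
abbreviation "eig \<equiv> eigval E"
abbreviation "U \<equiv> prior_cov \<Omega> W E"
abbreviation "e j k \<equiv> vec_index (eigvec E j) k"

lemma finJ [simp]: "finite J" and cardJ: "card J = N"
  and eigvec_carrier: "j \<in> J \<Longrightarrow> eigvec E j \<in> carrier_vec N"
  using eb by (auto simp: orthonormal_eigenbasis_def)

lemma dim_U [simp]: "dim_row U = N" "dim_col U = N"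
  by (auto simp: prior_cov_def)

lemma scalar_prod_eigvec: "j \<in> J \<Longrightarrow> scalar_prod v (eigvec E j) = (\<Sum>k<N. vec_index v k * e j k)"
  using eigvec_carrier[of j] by (auto simp: scalar_prod_def lessThan_atLeast0)

lemma orthonormal: "i \<in> J \<Longrightarrow> j \<in> J \<Longrightarrow> (\<Sum>k<N. e i k * e j k) = (if i = j then 1 else 0)"
  using eb scalar_prod_eigvec[of j "eigvec E i"] by (auto simp: orthonormal_eigenbasis_def)

lemma norm_eigvec: "j \<in> J \<Longrightarrow> (\<Sum>k<N. (e j k)\<^sup>2) = 1"
  using orthonormal[of j j] by (simp add: power2_eq_square)

text \<open>Numbers the abstract index set, so that the eigenvectors become the rows of a square
  matrix.\<close>

definition enum :: "nat \<Rightarrow> 'i" where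
  "enum = (SOME h. bij_betw h {..<N} J)"

lemma enum: "bij_betw enum {..<N} J"
proof -
  have "\<exists>h. bij_betw h {..<N} J"
    using ex_bij_betw_nat_finite[OF finJ] by (simp add: cardJ lessThan_atLeast0)
  then show ?thesis unfolding enum_def by (rule someI_ex)
qed

lemma enum_in: "a < N \<Longrightarrow> enum a \<in> J"
  using bij_betwE[OF enum] by blast

lemma enum_eq_iff: "a < N \<Longrightarrow> b < N \<Longrightarrow> enum a = enum b \<longleftrightarrow> a = b"
  using inj_on_eq_iff[OF bij_betw_imp_inj_on[OF enum], of a b] by simp

lemma sum_enum: "(\<Sum>a<N. g (enum a)) = (\<Sum>j\<in>J. g j)"
  by (rule sum.reindex_bij_betw[OF enum])

lemma prod_enum: "(\<Prod>a<N. g (enum a)) = (\<Prod>j\<in>J. g j)"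
  by (rule prod.reindex_bij_betw[OF enum])

definition emat :: "real mat" where
  "emat = mat N N (\<lambda>(a, k). e (enum a) k)"

lemma emat_carrier [simp]: "emat \<in> carrier_mat N N"
  by (simp add: emat_def)

lemma emat_transpose: "emat * transpose_mat emat = 1\<^sub>m N"
proof (rule eq_matI)
  fix a b assume ab: "a < dim_row (1\<^sub>m N :: real mat)" "b < dim_col (1\<^sub>m N :: real mat)"
  then have "index_mat (emat * transpose_mat emat) (a, b) = (\<Sum>k<N. e (enum a) k * e (enum b) k)"
    by (simp add: emat_def scalar_prod_def lessThan_atLeast0)
  then show "index_mat (emat * transpose_mat emat) (a, b) = index_mat (1\<^sub>m N) (a, b)"
    using ab orthonormal[of "enum a" "enum b"] by (simp add: enum_in enum_eq_iff)
qed (auto simp: emat_def)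

text \<open>The rows of \<open>emat\<close> are orthonormal; for a square matrix a right inverse is
  also a left inverse, so the columns are orthonormal too.\<close>

lemma complete:
  assumes "k < N" "l < N"
  shows "(\<Sum>j\<in>J. e j k * e j l) = (if k = l then 1 else 0)"
proof -
  have "transpose_mat emat * emat = 1\<^sub>m N"
    by (rule mat_mult_left_right_inverse[OF _ _ emat_transpose]) auto
  then have "index_mat (transpose_mat emat * emat) (k, l) = (if k = l then 1 else 0)"
    using assms by simp
  moreover have "index_mat (transpose_mat emat * emat) (k, l) = (\<Sum>a<N. e (enum a) k * e (enum a) l)"
    using assms by (simp add: emat_def scalar_prod_def lessThan_atLeast0)
  ultimately show ?thesis by (simp add: sum_enum[of "\<lambda>j. e j k * e j l"])
qed

lemma parseval:
  assumes "v \<in> carrier_vec N"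
  shows "scalar_prod v v = (\<Sum>j\<in>J. (scalar_prod v (eigvec E j))\<^sup>2)"
proof -
  have "(\<Sum>j\<in>J. (scalar_prod v (eigvec E j))\<^sup>2)
      = (\<Sum>j\<in>J. \<Sum>k<N. \<Sum>l<N. (vec_index v k * vec_index v l) * (e j k * e j l))"
    by (simp add: scalar_prod_eigvec power2_eq_square sum_product mult_ac)
  also have "\<dots> = (\<Sum>k<N. \<Sum>l<N. (vec_index v k * vec_index v l) * (\<Sum>j\<in>J. e j k * e j l))"
    by (simp add: sum_distrib_left sum.swap[of _ _ J])
  also have "\<dots> = (\<Sum>k<N. vec_index v k * vec_index v k)"
    by (simp add: complete if_distrib cong: if_cong)
  finally show ?thesis using assms by (simp add: scalar_prod_def lessThan_atLeast0)
qed

text \<open>The functional calculus g(U), diagonal in the eigenbasis. It turns product, inverse and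
  determinant of matrices into operations on the function g.\<close>

definition specmat :: "('i \<Rightarrow> real) \<Rightarrow> real mat" where
  "specmat g = mat N N (\<lambda>(k, l). \<Sum>j\<in>J. g j * (e j k * e j l))"

lemma specmat_carrier [simp]: "specmat g \<in> carrier_mat N N" "dim_row (specmat g) = N" "dim_col (specmat g) = N"
  by (auto simp: specmat_def)

lemma specmat_cong: "(\<And>j. j \<in> J \<Longrightarrow> g j = h j) \<Longrightarrow> specmat g = specmat h"
  by (simp add: specmat_def)

lemma specmat_1: "specmat (\<lambda>_. 1) = 1\<^sub>m N"
  by (rule eq_matI) (auto simp: specmat_def complete)

lemma specmat_transpose: "transpose_mat (specmat g) = specmat g"
  by (rule eq_matI) (auto simp: specmat_def mult_ac)

lemma specmat_mult: "specmat g * specmat h = specmat (\<lambda>j. g j * h j)"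
proof (rule eq_matI)
  fix k l assume "k < dim_row (specmat (\<lambda>j. g j * h j))" "l < dim_col (specmat (\<lambda>j. g j * h j))"
  then have kl: "k < N" "l < N" by auto
  then have "index_mat (specmat g * specmat h) (k, l)
      = (\<Sum>m<N. (\<Sum>i\<in>J. g i * (e i k * e i m)) * (\<Sum>j\<in>J. h j * (e j m * e j l)))"
    by (simp add: specmat_def scalar_prod_def lessThan_atLeast0)
  also have "\<dots> = (\<Sum>m<N. \<Sum>i\<in>J. \<Sum>j\<in>J. (g i * h j * e i k * e j l) * (e i m * e j m))"
    by (simp add: sum_product mult_ac)
  also have "\<dots> = (\<Sum>i\<in>J. \<Sum>j\<in>J. (g i * h j * e i k * e j l) * (\<Sum>m<N. e i m * e j m))"
    by (simp add: sum_distrib_left sum.swap[of _ _ "{..<N}"])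
  also have "\<dots> = (\<Sum>i\<in>J. g i * h i * (e i k * e i l))"
    by (simp add: orthonormal if_distrib mult_ac cong: if_cong)
  finally show "index_mat (specmat g * specmat h) (k, l) = index_mat (specmat (\<lambda>j. g j * h j)) (k, l)"
    using kl by (simp add: specmat_def)
qed auto

text \<open>Inserting the completeness relation after \<open>U\<close> lets the eigenvalue equation
  act on each eigenvector separately.\<close>

lemma U_eq: "U = specmat eig"
proof (rule eq_matI)
  fix k l assume "k < dim_row (specmat eig)" "l < dim_col (specmat eig)"
  then have kl: "k < N" "l < N" by auto
  have eig: "(\<Sum>m<N. index_mat U (k, m) * e j m) = eig j * e j k" if "j \<in> J" for j
  proof -
    have "vec_index (U *\<^sub>v eigvec E j) k = vec_index (eig j \<cdot>\<^sub>v eigvec E j) k"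
      using eb that by (simp add: orthonormal_eigenbasis_def)
    moreover have "vec_index (U *\<^sub>v eigvec E j) k = (\<Sum>m<N. index_mat U (k, m) * e j m)"
      using kl eigvec_carrier[OF that] by (simp add: scalar_prod_def lessThan_atLeast0)
    ultimately show ?thesis using kl eigvec_carrier[OF that] by simp
  qed
  have "index_mat U (k, l) = (\<Sum>m<N. index_mat U (k, m) * (\<Sum>j\<in>J. e j m * e j l))"
    using kl by (simp add: complete if_distrib cong: if_cong)
  also have "\<dots> = (\<Sum>j\<in>J. (\<Sum>m<N. index_mat U (k, m) * e j m) * e j l)"
    by (simp add: sum_distrib_left sum_distrib_right mult_ac) (rule sum.swap)
  also have "\<dots> = (\<Sum>j\<in>J. eig j * (e j k * e j l))"
    by (intro sum.cong refl) (simp add: eig mult.assoc)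
  finally show "index_mat U (k, l) = index_mat (specmat eig) (k, l)" using kl by (simp add: specmat_def)
qed auto

text \<open>The eigenvalue is the second moment of the centred process tested against the unit
  eigenvector. Square integrability of the marginals, normal or degenerate, justifies exchanging sum
  and integral.\<close>

lemma eigval_nonneg:
  assumes j: "j \<in> J" shows "0 \<le> eig j"
proof -
  interpret prob_space \<Omega> using gp by (simp add: centered_gaussian_process_def)
  define X where "X k = W (pts E (Suc k))" for k
  define Y where "Y k \<omega> = X k \<omega> - (LINT \<omega>|\<Omega>. X k \<omega>)" for k \<omega>
  have Xm [measurable]: "X k \<in> borel_measurable \<Omega>" for k
    using gp by (simp add: centered_gaussian_process_def X_def)
  have X2: "integrable \<Omega> (\<lambda>\<omega>. (X k \<omega>)\<^sup>2)" for k
    unfolding X_def by (rule square_integrable_gaussian_process[OF gp])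
  then have X1: "integrable \<Omega> (X k)" for k
    by (rule square_integrable_imp_integrable[rotated]) simp
  have Ym [measurable]: "Y k \<in> borel_measurable \<Omega>" for k unfolding Y_def by measurable
  have Y2: "integrable \<Omega> (\<lambda>\<omega>. (Y k \<omega>)\<^sup>2)" for k
    unfolding Y_def power2_diff
    by (simp add: X1 X2 Bochner_Integration.integrable_add)
  have YY: "integrable \<Omega> (\<lambda>\<omega>. Y k \<omega> * Y l \<omega>)" for k l
  proof (rule Bochner_Integration.integrable_bound)
    show "integrable \<Omega> (\<lambda>\<omega>. (Y k \<omega>)\<^sup>2 + (Y l \<omega>)\<^sup>2)" by (intro Bochner_Integration.integrable_add Y2)
    show "AE \<omega> in \<Omega>. norm (Y k \<omega> * Y l \<omega>) \<le> norm ((Y k \<omega>)\<^sup>2 + (Y l \<omega>)\<^sup>2)"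
    proof (rule AE_I2)
      fix \<omega>
      have "2 * (\<bar>Y k \<omega>\<bar> * \<bar>Y l \<omega>\<bar>) \<le> (Y k \<omega>)\<^sup>2 + (Y l \<omega>)\<^sup>2"
        using sum_squares_bound[of "\<bar>Y k \<omega>\<bar>" "\<bar>Y l \<omega>\<bar>"] by (simp add: mult.assoc)
      moreover have "0 \<le> \<bar>Y k \<omega>\<bar> * \<bar>Y l \<omega>\<bar>" by simp
      ultimately have "\<bar>Y k \<omega>\<bar> * \<bar>Y l \<omega>\<bar> \<le> (Y k \<omega>)\<^sup>2 + (Y l \<omega>)\<^sup>2" by linarith
      then show "norm (Y k \<omega> * Y l \<omega>) \<le> norm ((Y k \<omega>)\<^sup>2 + (Y l \<omega>)\<^sup>2)"
        by (simp add: abs_mult)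
    qed
  qed simp
  have Ukl: "index_mat U (k, l) = (LINT \<omega>|\<Omega>. Y k \<omega> * Y l \<omega>)" if "k < N" "l < N" for k l
    using that by (simp add: prior_cov_def covariance_def Y_def X_def)
  have "0 \<le> (LINT \<omega>|\<Omega>. (\<Sum>k<N. e j k * Y k \<omega>)\<^sup>2)" by simp
  also have "\<dots> = (LINT \<omega>|\<Omega>. (\<Sum>k<N. \<Sum>l<N. (e j k * e j l) * (Y k \<omega> * Y l \<omega>)))"
    by (simp add: power2_eq_square sum_product mult_ac)
  also have "\<dots> = (\<Sum>k<N. \<Sum>l<N. (e j k * e j l) * (LINT \<omega>|\<Omega>. Y k \<omega> * Y l \<omega>))"
    using YY by (simp add: Bochner_Integration.integral_sum)
  also have "\<dots> = (\<Sum>k<N. \<Sum>l<N. (e j k * e j l) * (\<Sum>i\<in>J. eig i * (e i k * e i l)))"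
    using Ukl by (intro sum.cong refl) (simp add: U_eq specmat_def)
  also have "\<dots> = (\<Sum>k<N. \<Sum>l<N. \<Sum>i\<in>J. eig i * ((e j k * e i k) * (e j l * e i l)))"
    by (simp add: sum_distrib_left mult_ac)
  also have "\<dots> = (\<Sum>i\<in>J. eig i * ((\<Sum>k<N. e j k * e i k) * (\<Sum>l<N. e j l * e i l)))"
  proof -
    have "(\<Sum>k<N. \<Sum>l<N. \<Sum>i\<in>J. eig i * ((e j k * e i k) * (e j l * e i l)))
        = (\<Sum>i\<in>J. \<Sum>k<N. \<Sum>l<N. eig i * ((e j k * e i k) * (e j l * e i l)))"
      by (simp add: sum.swap[of _ J])
    also have "\<dots> = (\<Sum>i\<in>J. eig i * ((\<Sum>k<N. e j k * e i k) * (\<Sum>l<N. e j l * e i l)))"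
      by (intro sum.cong refl) (subst sum_product, simp only: sum_distrib_left)
    finally show ?thesis .
  qed
  also have "\<dots> = eig j"
    using j by (simp add: orthonormal if_distrib cong: if_cong)
  finally show ?thesis .
qed

end


section \<open>Determinant, inverse and quadratic forms in eigencoordinates; the law behind the
  radius\<close>

context eigen_design
begin

text \<open>g(U) is a diagonal matrix conjugated by the orthogonal matrix \<open>emat\<close>, whose
  determinant cancels against that of its transpose.\<close>

lemma det_specmat: "Determinant.det (specmat g) = (\<Prod>j\<in>J. g j)"
proof -
  define D where "D = mat N N (\<lambda>(a, b). if a = b then g (enum a) else 0)"
  have D: "D \<in> carrier_mat N N" by (simp add: D_def)
  have "specmat g = transpose_mat emat * (D * emat)"
  proof (rule eq_matI)
    fix k l assume "k < dim_row (transpose_mat emat * (D * emat))" "l < dim_col (transpose_mat emat * (D * emat))"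
    then have kl: "k < N" "l < N" by (auto simp: emat_def)
    have De: "index_mat (D * emat) (a, l) = g (enum a) * e (enum a) l" if "a < N" for a
    proof -
      have "index_mat (D * emat) (a, l) = (\<Sum>b<N. (if a = b then g (enum a) else 0) * e (enum b) l)"
        using that kl by (simp add: D_def emat_def scalar_prod_def lessThan_atLeast0)
      also have "\<dots> = (\<Sum>b<N. if a = b then g (enum a) * e (enum a) l else 0)"
        by (intro sum.cong) auto
      finally show ?thesis using that by simp
    qed
    have "index_mat (transpose_mat emat * (D * emat)) (k, l) = (\<Sum>a<N. e (enum a) k * index_mat (D * emat) (a, l))"
      using kl by (simp add: emat_def scalar_prod_def lessThan_atLeast0 D_def)
    also have "\<dots> = (\<Sum>a<N. g (enum a) * (e (enum a) k * e (enum a) l))"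
      by (intro sum.cong) (auto simp: De)
    also have "\<dots> = (\<Sum>j\<in>J. g j * (e j k * e j l))"
      by (rule sum_enum)
    finally show "index_mat (specmat g) (k, l) = index_mat (transpose_mat emat * (D * emat)) (k, l)"
      using kl by (simp add: specmat_def)
  qed (auto simp: emat_def)
  then have "Determinant.det (specmat g) = Determinant.det (transpose_mat emat) * (Determinant.det D * Determinant.det emat)"
    using D by (simp add: det_mult[of _ N])
  moreover have "Determinant.det emat * Determinant.det (transpose_mat emat) = 1"
    using arg_cong[OF emat_transpose, of Determinant.det] by (simp add: det_mult[of _ N])
  moreover have "Determinant.det D = (\<Prod>j\<in>J. g j)"
  proof -
    have "Determinant.det D = prod_list (diag_mat D)"
      by (rule det_upper_triangular[OF _ D]) (auto simp: D_def)
    also have "\<dots> = (\<Prod>a<N. g (enum a))"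
      by (simp add: diag_mat_def D_def prod.list_conv_set_nth lessThan_atLeast0)
    finally show ?thesis by (simp add: prod_enum)
  qed
  ultimately show ?thesis by (simp add: mult_ac)
qed

lemma specmat_mult_vec:
  assumes "y \<in> carrier_vec N" "k < N"
  shows "vec_index (specmat g *\<^sub>v y) k = (\<Sum>j\<in>J. g j * scalar_prod y (eigvec E j) * e j k)"
proof -
  have "vec_index (specmat g *\<^sub>v y) k = (\<Sum>l<N. (\<Sum>j\<in>J. g j * (e j k * e j l)) * vec_index y l)"
    using assms by (simp add: specmat_def scalar_prod_def lessThan_atLeast0)
  also have "\<dots> = (\<Sum>j\<in>J. \<Sum>l<N. g j * (e j k * e j l) * vec_index y l)"
    by (simp add: sum_distrib_right sum.swap[of _ J])
  also have "\<dots> = (\<Sum>j\<in>J. g j * scalar_prod y (eigvec E j) * e j k)"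
    by (intro sum.cong refl) (simp add: scalar_prod_eigvec sum_distrib_left sum_distrib_right mult_ac)
  finally show ?thesis .
qed

lemma specmat_mult_vec_eigvec:
  assumes y: "y \<in> carrier_vec N" and j: "j \<in> J"
  shows "scalar_prod (specmat g *\<^sub>v y) (eigvec E j) = g j * scalar_prod y (eigvec E j)"
proof -
  have "scalar_prod (specmat g *\<^sub>v y) (eigvec E j)
      = (\<Sum>k<N. (\<Sum>i\<in>J. g i * scalar_prod y (eigvec E i) * e i k) * e j k)"
    using specmat_mult_vec[OF y] by (simp add: scalar_prod_eigvec[OF j])
  also have "\<dots> = (\<Sum>i\<in>J. \<Sum>k<N. g i * scalar_prod y (eigvec E i) * e i k * e j k)"
    by (simp add: sum_distrib_right sum.swap[of _ J])
  also have "\<dots> = (\<Sum>i\<in>J. g i * scalar_prod y (eigvec E i) * (\<Sum>k<N. e i k * e j k))"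
    by (simp add: sum_distrib_left mult_ac)
  also have "\<dots> = g j * scalar_prod y (eigvec E j)"
    using j by (simp add: orthonormal if_distrib cong: if_cong)
  finally show ?thesis .
qed

lemma quadratic_specmat:
  assumes y: "y \<in> carrier_vec N"
  shows "scalar_prod y (specmat g *\<^sub>v y) = (\<Sum>j\<in>J. g j * (scalar_prod y (eigvec E j))\<^sup>2)"
proof -
  have "scalar_prod y (specmat g *\<^sub>v y)
      = (\<Sum>k<N. vec_index y k * (\<Sum>j\<in>J. g j * scalar_prod y (eigvec E j) * e j k))"
    using specmat_mult_vec[OF y] by (simp add: scalar_prod_def lessThan_atLeast0)
  also have "\<dots> = (\<Sum>j\<in>J. \<Sum>k<N. vec_index y k * (g j * scalar_prod y (eigvec E j) * e j k))"
    by (simp add: sum_distrib_left sum.swap[of _ J])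
  also have "\<dots> = (\<Sum>j\<in>J. g j * scalar_prod y (eigvec E j) * (\<Sum>k<N. vec_index y k * e j k))"
    by (simp add: sum_distrib_left mult_ac)
  also have "\<dots> = (\<Sum>j\<in>J. g j * (scalar_prod y (eigvec E j))\<^sup>2)"
    by (intro sum.cong refl) (simp add: scalar_prod_eigvec power2_eq_square)
  finally show ?thesis .
qed

lemma Sigma_mat_eq: "Sigma_mat U c = specmat (\<lambda>j. 1 + c * eig j)"
proof (rule eq_matI)
  fix k l assume "k < dim_row (specmat (\<lambda>j. 1 + c * eig j))" "l < dim_col (specmat (\<lambda>j. 1 + c * eig j))"
  then have kl: "k < N" "l < N" by auto
  then have "index_mat (Sigma_mat U c) (k, l) = index_mat (specmat (\<lambda>_. 1)) (k, l) + c * index_mat (specmat eig) (k, l)"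
    by (simp add: Sigma_mat_def specmat_1 U_eq)
  then show "index_mat (Sigma_mat U c) (k, l) = index_mat (specmat (\<lambda>j. 1 + c * eig j)) (k, l)"
    using kl by (simp add: specmat_def sum.distrib[symmetric] sum_distrib_left algebra_simps)
qed (auto simp: Sigma_mat_def)

lemma det_Sigma: "Determinant.det (Sigma_mat U c) = (\<Prod>j\<in>J. 1 + c * eig j)"
  by (simp add: Sigma_mat_eq det_specmat)

lemma one_plus_pos: "0 \<le> c \<Longrightarrow> j \<in> J \<Longrightarrow> 0 < 1 + c * eig j"
  using eigval_nonneg[of j] mult_nonneg_nonneg[of c "eig j"] by linarith

text \<open>Both the eigenvalue of I - Sigma^-1 and the factor by which the posterior mean shrinks
  the j-th coefficient of the data.\<close>

definition wt :: "real \<Rightarrow> 'i \<Rightarrow> real" where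
  "wt c j = c * eig j / (1 + c * eig j)"

lemma wt_eq: "0 \<le> c \<Longrightarrow> j \<in> J \<Longrightarrow> wt c j = 1 - 1 / (1 + c * eig j)"
  using one_plus_pos[of c j] by (simp add: wt_def field_simps)

lemma wt_bounds: assumes "0 \<le> c" "j \<in> J" shows "0 \<le> wt c j" "wt c j < 1"
  using one_plus_pos[OF assms] eigval_nonneg[OF assms(2)] assms by (auto simp: wt_def)

lemma wt_mono: assumes "0 \<le> c" "c \<le> c'" "j \<in> J" shows "wt c j \<le> wt c' j"
proof -
  have "1 / (1 + c' * eig j) \<le> 1 / (1 + c * eig j)"
    using one_plus_pos[of c j] one_plus_pos[of c' j] assms eigval_nonneg[of j] mult_right_mono[of c c' "eig j"]
    by (intro divide_left_mono) auto
  then show ?thesis using assms by (simp add: wt_eq)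
qed

text \<open>\<open>mat_inverse\<close> is guaranteed to yield a matrix for units of the matrix ring,
  so both one-sided products are checked; what it yields is then identified through uniqueness of
  inverses.\<close>

lemma Sigma_inv_eq:
  assumes c: "0 \<le> c" shows "Sigma_inv U c = specmat (\<lambda>j. 1 / (1 + c * eig j))"
proof -
  let ?S = "specmat (\<lambda>j. 1 + c * eig j)" and ?T = "specmat (\<lambda>j. 1 / (1 + c * eig j))"
  have inv: "?S * ?T = 1\<^sub>m N" "?T * ?S = 1\<^sub>m N"
    using one_plus_pos[OF c]
    by (auto simp: specmat_mult specmat_1[symmetric] less_imp_neq[symmetric] intro!: specmat_cong)
  have "?S \<in> Units (ring_mat TYPE(real) N ())"
    unfolding Units_def using inv by (auto simp: ring_mat_simps intro!: bexI[of _ ?T])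
  then obtain B where B: "mat_inverse ?S = Some B"
    using mat_inverse(1)[of ?S N "()"] by (cases "mat_inverse ?S") auto
  from mat_inverse(2)[OF _ B, of N] have B': "?S * B = 1\<^sub>m N" "B \<in> carrier_mat N N" by auto
  have "B = (?T * ?S) * B" using inv B' by simp
  also have "\<dots> = ?T * (?S * B)" using B' by (intro assoc_mult_mat) auto
  also have "\<dots> = ?T" using B' by simp
  finally show ?thesis by (simp add: Sigma_inv_def Sigma_mat_eq B)
qed

lemma one_minus_Sigma_inv:
  assumes c: "0 \<le> c" shows "1\<^sub>m N - Sigma_inv U c = specmat (wt c)"
proof (rule eq_matI)
  fix k l assume "k < dim_row (specmat (wt c))" "l < dim_col (specmat (wt c))"
  then have kl: "k < N" "l < N" by auto
  then have "index_mat (1\<^sub>m N - Sigma_inv U c) (k, l)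
     = index_mat (specmat (\<lambda>_. 1)) (k, l) - index_mat (specmat (\<lambda>j. 1 / (1 + c * eig j))) (k, l)"
    by (simp add: specmat_1 Sigma_inv_eq[OF c])
  then show "index_mat (1\<^sub>m N - Sigma_inv U c) (k, l) = index_mat (specmat (wt c)) (k, l)"
    using kl c by (simp add: specmat_def sum_subtractf[symmetric] wt_eq left_diff_distrib cong: sum.cong)
qed (auto simp: Sigma_inv_eq[OF c])

lemma fvec_carrier: "fvec E f \<in> carrier_vec N"
  by (simp add: fvec_def)

lemma zcoef_eq: "j \<in> J \<Longrightarrow> zcoef E z j = (\<Sum>k<N. e j k * z k)"
  unfolding zcoef_def by (subst scalar_prod_eigvec) (auto simp: mult.commute)

lemma observation_eigvec: "j \<in> J \<Longrightarrow> scalar_prod (observation E f z) (eigvec E j) = fcoef E f j + zcoef E z j"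
  unfolding observation_def fcoef_def zcoef_def
  by (rule add_scalar_prod_distrib[of _ N]) (auto simp: fvec_carrier eigvec_carrier)

lemma observation_carrier: "observation E f z \<in> carrier_vec N"
  by (simp add: observation_def fvec_def)

lemma quadratic_Sigma_inv:
  assumes "0 \<le> c"
  shows "scalar_prod (observation E f z) (Sigma_inv U c *\<^sub>v observation E f z)
    = (\<Sum>j\<in>J. (fcoef E f j + zcoef E z j)\<^sup>2 / (1 + c * eig j))"
  by (simp add: Sigma_inv_eq[OF assms] quadratic_specmat[OF observation_carrier] observation_eigvec)

definition err2 :: "('x \<Rightarrow> real) \<Rightarrow> (nat \<Rightarrow> real) \<Rightarrow> real \<Rightarrow> real" where
  "err2 f z c = (\<Sum>j\<in>J. ((1 - wt c j) * fcoef E f j - wt c j * zcoef E z j)\<^sup>2)"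

lemma post_mean_error:
  assumes c: "0 \<le> c"
  shows "euclid_norm (fvec E f - post_mean U c (observation E f z)) = sqrt (err2 f z c)"
proof -
  let ?y = "observation E f z"
  have pm: "post_mean U c ?y = specmat (wt c) *\<^sub>v ?y"
    by (simp add: post_mean_def one_minus_Sigma_inv[OF c])
  have car: "specmat (wt c) *\<^sub>v ?y \<in> carrier_vec N"
    using mult_mat_vec_carrier[OF specmat_carrier(1) observation_carrier] .
  have "scalar_prod (fvec E f - specmat (wt c) *\<^sub>v ?y) (eigvec E j)
      = fcoef E f j - wt c j * (fcoef E f j + zcoef E z j)" if j: "j \<in> J" for j
  proof -
    have "scalar_prod (fvec E f - specmat (wt c) *\<^sub>v ?y) (eigvec E j)
       = scalar_prod (fvec E f) (eigvec E j) - scalar_prod (specmat (wt c) *\<^sub>v ?y) (eigvec E j)"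
      by (rule minus_scalar_prod_distrib[OF fvec_carrier car eigvec_carrier[OF j]])
    then show ?thesis
      by (simp add: specmat_mult_vec_eigvec[OF observation_carrier j] observation_eigvec[OF j] fcoef_def)
  qed
  then have "scalar_prod (fvec E f - specmat (wt c) *\<^sub>v ?y) (fvec E f - specmat (wt c) *\<^sub>v ?y)
    = (\<Sum>j\<in>J. (fcoef E f j - wt c j * (fcoef E f j + zcoef E z j))\<^sup>2)"
    using fvec_carrier car by (subst parseval) auto
  then show ?thesis
    by (simp add: euclid_norm_def pm err2_def algebra_simps)
qed

text \<open>Equal in law to the squared norm of a N(0, I - Sigma^-1) vector; the same sum as
  \<open>N_stat\<close>, written with \<open>wt\<close>.\<close>

definition Qc :: "real \<Rightarrow> (nat \<Rightarrow> real) \<Rightarrow> real" where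
  "Qc c z = (\<Sum>j\<in>J. wt c j * (zcoef E z j)\<^sup>2)"

lemma measurable_zcoef [measurable]: "j \<in> J \<Longrightarrow> (\<lambda>z. zcoef E z j) \<in> borel_measurable (std_normal_vec N)"
  unfolding zcoef_eq by measurable

lemma measurable_Qc [measurable]: "Qc c \<in> borel_measurable (std_normal_vec N)"
  unfolding Qc_def by measurable

text \<open>\<open>mat_root\<close> is some A with A A^T = I - Sigma^-1, about which nothing else is
  known. The law of |A z|^2 is that of |A^T z|^2 = z^T A A^T z, which involves only the
  product.\<close>

lemma measure_centered_normal_ball:
  assumes c: "0 \<le> c"
  defines "P \<equiv> centered_normal_vec N (1\<^sub>m N - Sigma_inv U c)"
  shows "measure P {v \<in> space P. euclid_norm (vec N v) < r}
    = measure (std_normal_vec N) {z \<in> space (std_normal_vec N). sqrt (Qc c z) < r}"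
proof -
  define A where "A = mat_root N (specmat (wt c))"
  \<comment> \<open>The symmetric square root shows that the choice is not void.\<close>
  have "\<exists>A. A \<in> carrier_mat N N \<and> A * transpose_mat A = specmat (wt c)"
    by (rule exI[of _ "specmat (\<lambda>j. sqrt (wt c j))"])
      (auto simp: specmat_transpose specmat_mult wt_bounds[OF c] intro!: specmat_cong)
  then have A: "A \<in> carrier_mat N N" "A * transpose_mat A = specmat (wt c)"
    unfolding A_def mat_root_def by (metis (mono_tags, lifting) someI_ex)+
  define T where "T z = (\<lambda>i\<in>{..<N}. vec_index (A *\<^sub>v vec N z) i)" for z
  have Ti: "vec_index (A *\<^sub>v vec N z) i = (\<Sum>k<N. index_mat A (i, k) * z k)" if "i < N" for i z
    using that A(1) by (simp add: scalar_prod_def lessThan_atLeast0)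
  have T [measurable]: "T \<in> std_normal_vec N \<rightarrow>\<^sub>M PiM {..<N} (\<lambda>_. borel)"
    unfolding T_def by (rule measurable_restrict) (simp add: Ti cong: measurable_cong)
  have P: "P = distr (std_normal_vec N) (PiM {..<N} (\<lambda>_. borel)) T"
    by (simp add: P_def centered_normal_vec_def one_minus_Sigma_inv[OF c] A_def[symmetric] T_def[abs_def])
  have nrm: "euclid_norm (vec N v) = sqrt (\<Sum>i<N. (v i)\<^sup>2)" for v :: "nat \<Rightarrow> real"
    by (simp add: euclid_norm_def scalar_prod_def lessThan_atLeast0 power2_eq_square)
  have nT: "(\<Sum>i<N. (T z i)\<^sup>2) = (\<Sum>i<N. (\<Sum>k<N. index_mat A (i, k) * z k)\<^sup>2)" for z
    by (simp add: T_def Ti)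
  have Tsp: "T z \<in> (\<Pi>\<^sub>E i\<in>{..<N}. UNIV)" for z by (simp add: T_def)
  let ?X = "\<lambda>z. \<Sum>i<N. (\<Sum>k<N. index_mat A (i, k) * z k)\<^sup>2"
  have Q: "(\<Sum>k<N. (\<Sum>i<N. index_mat A (i, k) * z i)\<^sup>2) = Qc c z" for z
  proof -
    have "(\<Sum>k<N. (\<Sum>i<N. index_mat A (i, k) * z i)\<^sup>2)
        = (\<Sum>k<N. \<Sum>i<N. \<Sum>l<N. z i * z l * (index_mat A (i, k) * index_mat A (l, k)))"
      by (simp add: power2_eq_square sum_product mult_ac)
    also have "\<dots> = (\<Sum>i<N. \<Sum>k<N. \<Sum>l<N. z i * z l * (index_mat A (i, k) * index_mat A (l, k)))"
      by (rule sum.swap)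
    also have "\<dots> = (\<Sum>i<N. \<Sum>l<N. \<Sum>k<N. z i * z l * (index_mat A (i, k) * index_mat A (l, k)))"
      by (intro sum.cong refl sum.swap)
    also have "\<dots> = (\<Sum>i<N. \<Sum>l<N. z i * z l * index_mat (A * transpose_mat A) (i, l))"
      using A(1) by (intro sum.cong refl) (simp add: scalar_prod_def lessThan_atLeast0 sum_distrib_left)
    also have "\<dots> = (\<Sum>i<N. \<Sum>l<N. \<Sum>j\<in>J. wt c j * ((e j i * z i) * (e j l * z l)))"
      unfolding A(2) by (intro sum.cong refl) (simp add: specmat_def sum_distrib_left mult_ac)
    also have "\<dots> = (\<Sum>j\<in>J. \<Sum>i<N. \<Sum>l<N. wt c j * ((e j i * z i) * (e j l * z l)))"
      by (simp add: sum.swap[of _ J])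
    also have "\<dots> = Qc c z"
      unfolding Qc_def
      by (intro sum.cong refl) (simp add: zcoef_eq power2_eq_square, subst sum_product, simp only: sum_distrib_left)
    finally show ?thesis .
  qed
  have "measure P {v \<in> space P. euclid_norm (vec N v) < r}
      = measure (std_normal_vec N) {z \<in> space (std_normal_vec N). sqrt (?X z) < r}"
    unfolding P nrm
    by (subst measure_distr)
      (auto simp: nT space_PiM Tsp intro!: arg_cong[where f = "measure (std_normal_vec N)"])
  also have "\<dots> = measure (distr (std_normal_vec N) borel ?X) {x. sqrt x < r}"
    by (subst measure_distr) (auto intro!: arg_cong[where f = "measure (std_normal_vec N)"])
  also have "\<dots> = measure (distr (std_normal_vec N) borel (Qc c)) {x. sqrt x < r}"
    using distr_norm_square_transpose[of N "\<lambda>i k. index_mat A (i, k)"] by (simp add: Q)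
  also have "\<dots> = measure (std_normal_vec N) {z \<in> space (std_normal_vec N). sqrt (Qc c z) < r}"
    by (subst measure_distr) (auto intro!: arg_cong[where f = "measure (std_normal_vec N)"])
  finally show ?thesis .
qed

end



section \<open>Bias, variance, error and radius as functions of c\<close>

context eigen_design
begin

lemma ceig_nonneg: "0 \<le> c \<Longrightarrow> j \<in> J \<Longrightarrow> 0 \<le> c * eig j"
  by (simp add: eigval_nonneg)

text \<open>Each term is twice the Kullback-Leibler divergence KL(N(0, 1) || N(0, 1 + c
  lambda_j)).\<close>

lemma D2L_eq: "D2L E c = (\<Sum>j\<in>J. log_gap (c * eig j))"
  by (simp add: D2L_def log_gap_def)

lemma s2_eq: "s2 E c = (\<Sum>j\<in>J. wt c j)"
  by (simp add: s2_def wt_def)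

lemma R2L_eq: "R2L E z c = - (\<Sum>j\<in>J. wt c j * ((zcoef E z j)\<^sup>2 - 1))"
  by (simp add: R2L_def wt_def mult_ac)

lemma R1L_eq: "R1L E z c f = 2 * (\<Sum>j\<in>J. zcoef E z j * fcoef E f j / (1 + c * eig j))"
  by (simp add: R1L_def)

lemma D1L_nonneg: "0 \<le> c \<Longrightarrow> 0 \<le> D1L E c f"
  unfolding D1L_def using one_plus_pos by (intro sum_nonneg divide_nonneg_nonneg) (auto intro: less_imp_le)

lemma D2L_nonneg: "0 \<le> c \<Longrightarrow> 0 \<le> D2L E c"
  unfolding D2L_eq by (intro sum_nonneg log_gap_nonneg ceig_nonneg)

lemma s2_nonneg: "0 \<le> c \<Longrightarrow> 0 \<le> s2 E c"
  unfolding s2_eq by (intro sum_nonneg wt_bounds)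

lemma D1L_antimono: assumes "0 \<le> c" "c \<le> c'" shows "D1L E c' f \<le> D1L E c f"
  unfolding D1L_def
proof (intro sum_mono divide_left_mono)
  fix j assume j: "j \<in> J"
  show "1 + c * eig j \<le> 1 + c' * eig j"
    using assms eigval_nonneg[OF j] by (simp add: mult_right_mono)
  show "0 < (1 + c' * eig j) * (1 + c * eig j)"
    using one_plus_pos[of c j] one_plus_pos[of c' j] assms j by simp
qed simp

lemma D1L_scale: assumes "0 \<le> c" "0 < k" "k \<le> 1" shows "D1L E (k * c) f \<le> D1L E c f / k"
  unfolding D1L_def sum_divide_distrib
proof (intro sum_mono)
  fix j assume j: "j \<in> J"
  have "k * (1 + c * eig j) \<le> 1 + k * c * eig j"
    using assms by (simp add: algebra_simps)
  then have "(fcoef E f j)\<^sup>2 / (1 + k * c * eig j) \<le> (fcoef E f j)\<^sup>2 / (k * (1 + c * eig j))"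
    using one_plus_pos[of c j] one_plus_pos[of "k * c" j] assms j
    by (intro divide_left_mono) auto
  then show "(fcoef E f j)\<^sup>2 / (1 + k * c * eig j) \<le> (fcoef E f j)\<^sup>2 / (1 + c * eig j) / k"
    by (simp add: mult.commute)
qed

lemma D2L_mono: "0 \<le> c \<Longrightarrow> c \<le> c' \<Longrightarrow> D2L E c \<le> D2L E c'"
  unfolding D2L_eq
  by (intro sum_mono log_gap_mono ceig_nonneg) (auto intro!: mult_right_mono eigval_nonneg)

lemma D2L_scale: "0 \<le> c \<Longrightarrow> 0 < k \<Longrightarrow> k \<le> 1 \<Longrightarrow> k\<^sup>2 * D2L E c \<le> D2L E (k * c)"
  unfolding D2L_eq sum_distrib_left
  using log_gap_scale[OF ceig_nonneg, of c _ k] by (intro sum_mono) (simp add: mult.assoc)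

lemma D2L_double: "0 \<le> c \<Longrightarrow> D2L E (2 * c) \<le> 4 * D2L E c"
  using D2L_scale[of "2 * c" "1 / 2"] by (simp add: power2_eq_square)

lemma D2L_diff_le_s2:
  assumes "0 \<le> c" "0 < k" "k \<le> 1"
  shows "D2L E c - D2L E (k * c) \<le> (1 + 2 * ln (1 / k)) * s2 E c"
  unfolding D2L_eq s2_eq sum_subtractf[symmetric] sum_distrib_left
  using log_gap_diff[OF ceig_nonneg, of c _ k] assms
  by (intro sum_mono) (simp add: mult.assoc wt_def)

lemma sum_wt_square_le_D2L: assumes "0 \<le> c" shows "(\<Sum>j\<in>J. (wt c j)\<^sup>2) \<le> 2 * D2L E c"
  unfolding D2L_eq sum_distrib_left wt_def
  using assms by (intro sum_mono log_gap_ge_square ceig_nonneg) auto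

lemma sum_wt_square_le_s2: assumes "0 \<le> c" shows "(\<Sum>j\<in>J. (wt c j)\<^sup>2) \<le> s2 E c"
  unfolding s2_eq
proof (intro sum_mono)
  fix j assume "j \<in> J"
  then show "(wt c j)\<^sup>2 \<le> wt c j"
    using wt_bounds[OF assms, of j] by (simp add: power2_eq_square mult_left_le)
qed

lemma Qc_eq: "Qc c z = s2 E c - R2L E z c"
  by (simp add: Qc_def s2_eq R2L_eq algebra_simps sum_subtractf)

text \<open>The inequality (x - y)^2 <= 2 x^2 + 2 y^2, followed by (1 - w)^2 <= 1 - w = 1 / (1 + c
  lambda) and w^2 <= w, turns the bias into \<open>D1L\<close> and the noise into
  \<open>Qc\<close>.\<close>

lemma err2_le: assumes c: "0 \<le> c" shows "err2 f z c \<le> 2 * D1L E c f + 2 * (s2 E c - R2L E z c)"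
proof -
  have "err2 f z c \<le> (\<Sum>j\<in>J. 2 * ((fcoef E f j)\<^sup>2 / (1 + c * eig j)) + 2 * (wt c j * (zcoef E z j)\<^sup>2))"
    unfolding err2_def
  proof (intro sum_mono)
    fix j assume j: "j \<in> J"
    let ?F = "fcoef E f j" and ?Z = "zcoef E z j" and ?w = "wt c j"
    have w: "0 \<le> ?w" "?w \<le> 1" using wt_bounds[OF c j] by auto
    have "((1 - ?w) * ?F - ?w * ?Z)\<^sup>2 \<le> 2 * ((1 - ?w) * ?F)\<^sup>2 + 2 * (?w * ?Z)\<^sup>2"
      using sum_squares_ge_zero[of "(1 - ?w) * ?F + ?w * ?Z" 0] by (simp add: power2_eq_square algebra_simps)
    moreover have "(1 - ?w)\<^sup>2 * ?F\<^sup>2 \<le> (1 - ?w) * ?F\<^sup>2" "?w\<^sup>2 * ?Z\<^sup>2 \<le> ?w * ?Z\<^sup>2"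
      using w by (auto intro!: mult_right_mono simp: power2_eq_square mult_left_le)
    moreover have "(1 - ?w) * ?F\<^sup>2 = ?F\<^sup>2 / (1 + c * eig j)" using wt_eq[OF c j] by simp
    ultimately show "((1 - ?w) * ?F - ?w * ?Z)\<^sup>2 \<le> 2 * (?F\<^sup>2 / (1 + c * eig j)) + 2 * (?w * ?Z\<^sup>2)"
      by (simp add: power_mult_distrib)
  qed
  also have "\<dots> = 2 * D1L E c f + 2 * Qc c z"
    by (simp add: sum.distrib D1L_def Qc_def sum_distrib_left)
  finally show ?thesis by (simp add: Qc_eq)
qed

lemma zcoef_moments:
  assumes "i \<in> J" "j \<in> J"
  shows "has_bochner_integral (std_normal_vec N) (\<lambda>z. zcoef E z i * zcoef E z j) (if i = j then 1 else 0)"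
    and "has_bochner_integral (std_normal_vec N) (\<lambda>z. ((zcoef E z i)\<^sup>2 - 1) * ((zcoef E z j)\<^sup>2 - 1)) (if i = j then 2 else 0)"
proof -
  have "has_bochner_integral (std_normal_vec N) (\<lambda>z. zcoef E z i * zcoef E z i) 1"
    using integrable_linear_form_power[of N "e i" 2] linear_form_moment_2[of N "e i"] norm_eigvec[OF assms(1)]
    by (simp add: has_bochner_integral_iff zcoef_eq[OF assms(1)] power2_eq_square)
  then show "has_bochner_integral (std_normal_vec N) (\<lambda>z. zcoef E z i * zcoef E z j) (if i = j then 1 else 0)"
    using linear_form_product_moments(1)[of "e i" N "e j"] norm_eigvec orthonormal[OF assms] assms
    by (auto simp: zcoef_eq)
  show "has_bochner_integral (std_normal_vec N) (\<lambda>z. ((zcoef E z i)\<^sup>2 - 1) * ((zcoef E z j)\<^sup>2 - 1)) (if i = j then 2 else 0)"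
    using linear_form_product_moments(2)[of "e i" N "e j"] norm_eigvec orthonormal[OF assms] assms
      linear_form_centered_square_moment[of "e i" N]
    by (auto simp: zcoef_eq power2_eq_square)
qed

lemma R2L_square_integral:
  "has_bochner_integral (std_normal_vec N) (\<lambda>z. (R2L E z c)\<^sup>2) (2 * (\<Sum>j\<in>J. (wt c j)\<^sup>2))"
proof -
  have "has_bochner_integral (std_normal_vec N)
     (\<lambda>z. \<Sum>i\<in>J. \<Sum>j\<in>J. (wt c i * ((zcoef E z i)\<^sup>2 - 1)) * (wt c j * ((zcoef E z j)\<^sup>2 - 1)) / 1)
     (2 * (\<Sum>j\<in>J. (wt c j)\<^sup>2 / 1))"
    by (rule has_bochner_integral_quadratic_form) (auto simp: zcoef_moments)
  then show ?thesis by (simp add: R2L_eq power2_eq_square sum_product)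
qed

lemma measurable_R2L [measurable]: "(\<lambda>z. R2L E z c) \<in> borel_measurable (std_normal_vec N)"
  unfolding R2L_eq by measurable

lemma prob_R2L_ge:
  assumes c: "0 \<le> c" and t: "0 < t"
  shows "measure (std_normal_vec N) {z \<in> space (std_normal_vec N). t \<le> \<bar>R2L E z c\<bar>} \<le> 2 * s2 E c / t\<^sup>2"
proof -
  have "measure (std_normal_vec N) {z \<in> space (std_normal_vec N). t\<^sup>2 \<le> (R2L E z c)\<^sup>2}
      \<le> (LINT z|std_normal_vec N. (R2L E z c)\<^sup>2) / t\<^sup>2"
    using R2L_square_integral[of c] t
    by (intro integral_Markov_inequality_measure[where A = "{}"]) (auto simp: has_bochner_integral_iff)
  also have "\<dots> \<le> 2 * s2 E c / t\<^sup>2"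
    using R2L_square_integral[of c] sum_wt_square_le_s2[OF c] t
    by (intro divide_right_mono) (auto simp: has_bochner_integral_iff)
  finally have "measure (std_normal_vec N) {z \<in> space (std_normal_vec N). t\<^sup>2 \<le> (R2L E z c)\<^sup>2} \<le> 2 * s2 E c / t\<^sup>2" .
  moreover have "t\<^sup>2 \<le> (R2L E z c)\<^sup>2 \<longleftrightarrow> t \<le> \<bar>R2L E z c\<bar>" for z
    using t abs_le_square_iff[of t "R2L E z c"] by simp
  ultimately show ?thesis by simp
qed

text \<open>An index of positive eigenvalue has positive weight, which makes \<open>Qc\<close> a
  nondegenerate form; the definite description in \<open>radius\<close> then denotes.\<close>

lemma radius_props:
  assumes pos: "\<exists>j\<in>J. 0 < eig j" and c: "0 < c" and \<eta>: "0 < \<eta>" "\<eta> < 1"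
  shows ex1_radius_sqrt: "\<exists>!r. measure (std_normal_vec N) {z \<in> space (std_normal_vec N). sqrt (Qc c z) < r} = \<eta>"
    and radius_eq: "measure (std_normal_vec N) {z \<in> space (std_normal_vec N). sqrt (Qc c z) < radius U c \<eta>} = \<eta>"
proof -
  obtain j0 where j0: "j0 \<in> J" "0 < eig j0" using pos by blast
  interpret q: quadratic_form N J "wt c" "\<lambda>j k. e j k" j0
  proof
    show "0 < wt c j0" using j0 c by (simp add: wt_def add_pos_pos)
  qed (use j0 c in \<open>auto simp: wt_bounds norm_eigvec\<close>)
  have Q: "q.Q z = Qc c z" for z by (simp add: q.Q_def Qc_def zcoef_eq)
  show ex1: "\<exists>!r. measure (std_normal_vec N) {z \<in> space (std_normal_vec N). sqrt (Qc c z) < r} = \<eta>"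
    using q.ex1_radius[OF \<eta>] by (simp add: Q)
  have "radius U c \<eta> = (THE r. measure (std_normal_vec N) {z \<in> space (std_normal_vec N). sqrt (Qc c z) < r} = \<eta>)"
    using c by (simp add: radius_def Let_def measure_centered_normal_ball)
  then show "measure (std_normal_vec N) {z \<in> space (std_normal_vec N). sqrt (Qc c z) < radius U c \<eta>} = \<eta>"
    using theI'[OF ex1] by simp
qed

lemma Qc_nonneg: "0 \<le> c \<Longrightarrow> 0 \<le> Qc c z"
  unfolding Qc_def by (intro sum_nonneg mult_nonneg_nonneg wt_bounds) auto

lemma radius_less:
  assumes pos: "\<exists>j\<in>J. 0 < eig j" and c: "0 < c" and \<eta>: "0 < \<eta>" "\<eta> < 1"
    and r: "measure (std_normal_vec N) {z \<in> space (std_normal_vec N). sqrt (Qc c z) < r} < \<eta>"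
  shows "r < radius U c \<eta>"
proof (rule ccontr)
  interpret S: prob_space "std_normal_vec N" by (rule prob_space_std_normal_vec)
  assume "\<not> r < radius U c \<eta>"
  then have "measure (std_normal_vec N) {z \<in> space (std_normal_vec N). sqrt (Qc c z) < radius U c \<eta>}
     \<le> measure (std_normal_vec N) {z \<in> space (std_normal_vec N). sqrt (Qc c z) < r}"
    by (intro S.finite_measure_mono) auto
  then show False using r radius_eq[OF pos c \<eta>] by linarith
qed

lemma radius_pos:
  assumes pos: "\<exists>j\<in>J. 0 < eig j" and c: "0 < c" and \<eta>: "0 < \<eta>" "\<eta> < 1"
  shows "0 < radius U c \<eta>"
proof (rule radius_less[OF assms])
  have "{z \<in> space (std_normal_vec N). sqrt (Qc c z) < 0} = {}"
    using Qc_nonneg[of c] c by (auto simp: not_less)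
  then show "measure (std_normal_vec N) {z \<in> space (std_normal_vec N). sqrt (Qc c z) < 0} < \<eta>"
    using \<eta> by (metis measure_empty)
qed

text \<open>The weights grow with c, hence so does \<open>Qc\<close> pointwise. Were the radius at
  c' smaller, the ball of that radius would already have probability \<eta> at c, against uniqueness
  of the radius there. Monotonicity serves the measurability of the coverage event.\<close>

lemma radius_mono:
  assumes pos: "\<exists>j\<in>J. 0 < eig j" and c: "0 < c" "c \<le> c'" and \<eta>: "0 < \<eta>" "\<eta> < 1"
  shows "radius U c \<eta> \<le> radius U c' \<eta>"
proof (rule ccontr)
  interpret S: prob_space "std_normal_vec N" by (rule prob_space_std_normal_vec)
  assume less: "\<not> ?thesis"
  have c': "0 < c'" using c by simp
  have le: "Qc c z \<le> Qc c' z" for z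
    unfolding Qc_def using c by (intro sum_mono mult_right_mono wt_mono) auto
  let ?m = "\<lambda>r. measure (std_normal_vec N) {z \<in> space (std_normal_vec N). sqrt (Qc c z) < r}"
  have "measure (std_normal_vec N) {z \<in> space (std_normal_vec N). sqrt (Qc c' z) < radius U c' \<eta>}
      \<le> ?m (radius U c' \<eta>)"
    by (intro S.finite_measure_mono) (auto intro: order.strict_trans1[OF real_sqrt_le_mono[OF le]])
  then have "\<eta> \<le> ?m (radius U c' \<eta>)"
    using radius_eq[OF pos c' \<eta>] by simp
  moreover have "?m (radius U c' \<eta>) \<le> ?m (radius U c \<eta>)"
    using less by (intro S.finite_measure_mono) auto
  ultimately have "?m (radius U c' \<eta>) = \<eta>"
    using radius_eq[OF pos c(1) \<eta>] by linarith
  then have "radius U c' \<eta> = radius U c \<eta>"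
    using ex1_radius_sqrt[OF pos c(1) \<eta>] radius_eq[OF pos c(1) \<eta>] by blast
  then show False using less by simp
qed

text \<open>\<open>Qc\<close> = \<open>s2\<close> - \<open>R2L\<close>, so \<open>Qc\<close> <
  \<open>s2\<close> / 2 forces |R2L| >= s2 / 2. The Chebyshev bound for this is 2 s2 / (s2 / 2)^2 =
  8 / s2, which the threshold in the hypothesis makes less than \<eta>.\<close>

lemma radius_lower_bound:
  assumes c: "0 < c" and \<eta>: "0 < \<eta>" "\<eta> < 1" and s2: "8 / \<eta> < s2 E c"
  shows "s2 E c / 2 \<le> (radius U c \<eta>)\<^sup>2"
proof -
  interpret S: prob_space "std_normal_vec N" by (rule prob_space_std_normal_vec)
  have s: "0 < s2 E c" using s2 \<eta> by (meson divide_pos_pos less_trans zero_less_numeral)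
  have pos: "\<exists>j\<in>J. 0 < eig j"
  proof (rule ccontr)
    assume "\<not> ?thesis"
    then have "eig j = 0" if "j \<in> J" for j using eigval_nonneg[OF that] that by force
    then show False using s by (simp add: s2_def)
  qed
  have "sqrt (s2 E c / 2) < radius U c \<eta>"
  proof (rule radius_less[OF pos c \<eta>])
    have "measure (std_normal_vec N) {z \<in> space (std_normal_vec N). sqrt (Qc c z) < sqrt (s2 E c / 2)}
      \<le> measure (std_normal_vec N) {z \<in> space (std_normal_vec N). s2 E c / 2 \<le> \<bar>R2L E z c\<bar>}"
      by (intro S.finite_measure_mono) (auto simp: Qc_eq)
    also have "\<dots> \<le> 2 * s2 E c / (s2 E c / 2)\<^sup>2"
      using c s by (intro prob_R2L_ge) auto
    also have "\<dots> = 8 / s2 E c" using s by (simp add: power2_eq_square)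
    also have "\<dots> < \<eta>" using s2 s \<eta> by (simp add: field_simps)
    finally show "measure (std_normal_vec N) {z \<in> space (std_normal_vec N). sqrt (Qc c z) < sqrt (s2 E c / 2)} < \<eta>" .
  qed
  then have "(sqrt (s2 E c / 2))\<^sup>2 \<le> (radius U c \<eta>)\<^sup>2"
    using s by (intro power_mono) auto
  then show ?thesis using s by simp
qed

end


subsection \<open>Posterior distribution and quantiles\<close>

context real_distribution
begin

text \<open>The infimum runs over a set that is bounded below, because the distribution function
  tends to 0 at minus infinity.\<close>

lemma quantile_le:
  assumes "0 < q" "q \<le> measure M {..t}" shows "quantile M q \<le> t"
  unfolding quantile_def
proof (rule cInf_lower)
  have "\<forall>\<^sub>F t in at_bot. cdf M t < q" using cdf_lim_at_bot assms(1) by (rule order_tendstoD(2))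
  then obtain t0 where t0: "\<And>t. t \<le> t0 \<Longrightarrow> cdf M t < q" by (auto simp: eventually_at_bot_linorder)
  have "t0 \<le> t" if "q \<le> measure M {..t}" for t
  proof (rule ccontr)
    assume "\<not> t0 \<le> t"
    then have "cdf M t < q" using t0[of t] by simp
    then show False using that by (simp add: cdf_def)
  qed
  then show "bdd_below {t. q \<le> measure M {..t}}" by (intro bdd_belowI[of _ t0]) auto
qed (use assms in simp)

lemma measure_atMost_mono: "s \<le> t \<Longrightarrow> measure M {..s} \<le> measure M {..t}"
  using cdf_nondecreasing[of s t] by (simp add: cdf_def)

lemma quantile_set_nonempty:
  assumes "q < 1" shows "\<exists>t. q \<le> measure M {..t}"
proof -
  have "\<forall>\<^sub>F t in at_top. q < cdf M t" using cdf_lim_at_top_prob assms by (rule order_tendstoD(1))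
  then obtain t where "q < cdf M t" by (auto simp: eventually_at_top_linorder)
  then show ?thesis by (auto simp: cdf_def intro: less_imp_le)
qed

lemma le_quantile:
  assumes "q < 1" "measure M {..t} < q" shows "t \<le> quantile M q"
  unfolding quantile_def
proof (rule cInf_greatest)
  show "{t. q \<le> measure M {..t}} \<noteq> {}" using quantile_set_nonempty[OF assms(1)] by simp
  fix s assume "s \<in> {t. q \<le> measure M {..t}}"
  then show "t \<le> s" using assms(2) measure_atMost_mono[of s t] by (cases "t \<le> s") auto
qed

text \<open>A countable description of the event that a quantile lies below x, from which quantiles
  of random laws are seen to be measurable.\<close>

lemma quantile_less_iff:
  assumes "0 < q" "q < 1"
  shows "quantile M q < x \<longleftrightarrow> (\<exists>t\<in>\<rat>. t < x \<and> q \<le> measure M {..t})"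
proof
  assume "quantile M q < x"
  then obtain t where t: "q \<le> measure M {..t}" "t < x"
    using cInf_lessD[of "{t. q \<le> measure M {..t}}" x] quantile_set_nonempty[OF assms(2)]
    unfolding quantile_def by auto
  obtain r where "r \<in> \<rat>" "t < r" "r < x" using Rats_dense_in_real[OF t(2)] by auto
  then show "\<exists>t\<in>\<rat>. t < x \<and> q \<le> measure M {..t}"
    using t measure_atMost_mono[of t r] by (intro bexI[of _ r]) auto
next
  assume "\<exists>t\<in>\<rat>. t < x \<and> q \<le> measure M {..t}"
  then show "quantile M q < x" using quantile_le[OF assms(1)] by (meson le_less_trans)
qed

text \<open>A continuous distribution function attains two levels strictly between q and q', at
  points t < t' that separate the quantiles.\<close>

lemma quantile_strict_mono:
  assumes atom: "\<And>x. measure M {x} = 0" and q: "0 < q" "q < q'" "q' < 1"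
  shows "quantile M q < quantile M q'"
proof -
  have cont: "isCont (cdf M) x" for x using atom by (simp add: isCont_cdf)
  have ex: "\<exists>t. cdf M t = p" if p: "0 < p" "p < 1" for p
  proof -
    have "\<forall>\<^sub>F t in at_bot. cdf M t < p" using cdf_lim_at_bot p(1) by (rule order_tendstoD(2))
    then obtain t0 where t0: "cdf M t0 < p" by (auto simp: eventually_at_bot_linorder)
    have "\<forall>\<^sub>F t in at_top. p < cdf M t" using cdf_lim_at_top_prob p(2) by (rule order_tendstoD(1))
    then obtain t1 where t1: "p < cdf M t1" by (auto simp: eventually_at_top_linorder)
    have "t0 \<le> t1" using t0 t1 cdf_nondecreasing[of t1 t0] by (cases "t0 \<le> t1") auto
    then show ?thesis using IVT[of "cdf M" t0 p t1] t0 t1 cont by auto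
  qed
  define p where "p = q + (q' - q) / 3"
  define p' where "p' = q + 2 * (q' - q) / 3"
  have p: "q < p" "p < p'" "p' < q'" using q by (auto simp: p_def p'_def field_simps)
  obtain t where t: "cdf M t = p" using ex[of p] p q by auto
  obtain t' where t': "cdf M t' = p'" using ex[of p'] p q by auto
  have "t < t'" using t t' p cdf_nondecreasing[of t' t] by (cases "t < t'") auto
  moreover have "quantile M q \<le> t" using t p q by (intro quantile_le) (auto simp: cdf_def)
  moreover have "t' \<le> quantile M q'" using t' p q by (intro le_quantile) (auto simp: cdf_def)
  ultimately show ?thesis by simp
qed

end

locale interval_weight =
  fixes w :: "real \<Rightarrow> real" and a b :: real
  assumes ab: "a < b" and zero: "\<And>c. c \<notin> {a..b} \<Longrightarrow> w c = 0"
    and pos: "\<And>c. c \<in> {a..b} \<Longrightarrow> 0 < w c" and cont: "continuous_on {a..b} w"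
begin

lemma nonneg: "0 \<le> w c"
  using zero pos by (cases "c \<in> {a..b}") (auto intro: less_imp_le)

lemma integrable: "integrable lborel w"
proof -
  have "set_integrable lborel {a..b} w" by (rule borel_integrable_atLeastAtMost'[OF cont])
  moreover have "(\<lambda>c. indicator {a..b} c *\<^sub>R w c) = w"
    using zero by (intro ext) (auto split: split_indicator)
  ultimately show ?thesis by (simp add: set_integrable_def)
qed

lemma measurable [measurable]: "w \<in> borel_measurable borel"
  using integrable by (simp add: borel_measurable_integrable)

lemma integral_ge:
  assumes "0 \<le> d" "s \<le> s'" and d: "\<And>c. c \<in> {s..s'} \<Longrightarrow> d \<le> w c"
  shows "d * (s' - s) \<le> (LINT c|lborel. w c)"
proof -
  have "d * (s' - s) = (LINT c|lborel. d * indicator {s..s'} c)"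
    using assms by simp
  also have "\<dots> \<le> (LINT c|lborel. w c)"
    using d nonneg assms(2) by (intro integral_mono integrable) (auto split: split_indicator)
  finally show ?thesis .
qed

lemma integral_pos: "0 < (LINT c|lborel. w c)"
proof -
  obtain x where x: "x \<in> {a..b}" "\<And>y. y \<in> {a..b} \<Longrightarrow> w x \<le> w y"
    using continuous_attains_inf[OF compact_Icc _ cont] ab by auto
  have "w x * (b - a) \<le> (LINT c|lborel. w c)"
    using x ab pos[OF x(1)] by (intro integral_ge) auto
  moreover have "0 < w x * (b - a)" using pos[OF x(1)] ab by simp
  ultimately show ?thesis by linarith
qed

definition \<mu> :: "real measure" where
  "\<mu> = density lborel (\<lambda>c. ennreal (w c / (LINT t|lborel. w t)))"

lemma measure_\<mu>:
  assumes [measurable]: "A \<in> sets borel"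
  shows "emeasure \<mu> A = ennreal ((LINT c|lborel. w c * indicator A c) / (LINT t|lborel. w t))"
    and "measure \<mu> A = (LINT c|lborel. w c * indicator A c) / (LINT t|lborel. w t)"
proof -
  let ?Z = "LINT t|lborel. w t"
  have "integrable lborel (\<lambda>c. indicator A c *\<^sub>R w c)"
    by (rule integrable_mult_indicator) (auto intro: integrable)
  then have int: "integrable lborel (\<lambda>c. w c * indicator A c / ?Z)"
    by (simp add: mult.commute)
  have "emeasure \<mu> A = (\<integral>\<^sup>+ c. ennreal (w c / ?Z) * indicator A c \<partial>lborel)"
    unfolding \<mu>_def by (rule emeasure_density) auto
  also have "\<dots> = (\<integral>\<^sup>+ c. ennreal (w c * indicator A c / ?Z) \<partial>lborel)"
    by (intro nn_integral_cong) (auto split: split_indicator)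
  also have "\<dots> = ennreal (LINT c|lborel. w c * indicator A c / ?Z)"
    using nonneg integral_pos by (intro nn_integral_eq_integral int AE_I2) auto
  finally show 1: "emeasure \<mu> A = ennreal ((LINT c|lborel. w c * indicator A c) / ?Z)" by simp
  show "measure \<mu> A = (LINT c|lborel. w c * indicator A c) / ?Z"
    unfolding measure_def 1 using nonneg integral_pos
    by (intro enn2real_ennreal divide_nonneg_nonneg Bochner_Integration.integral_nonneg) auto
qed

lemma real_distribution_\<mu>: "real_distribution \<mu>"
proof -
  have "emeasure \<mu> UNIV = 1" using integral_pos by (simp add: measure_\<mu>)
  then have "prob_space \<mu>" by (intro prob_spaceI) (simp add: \<mu>_def)
  then show ?thesis
    by (simp add: real_distribution_def real_distribution_axioms_def \<mu>_def)
qed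

lemma \<mu>_singleton: "measure \<mu> {x} = 0"
proof -
  have "(LINT c|lborel. w c * indicator {x} c) = 0"
    by (intro integral_eq_zero_AE AE_I[of _ _ "{x}"]) (auto split: split_indicator)
  then show ?thesis by (simp add: measure_\<mu>)
qed

lemma \<mu>_atMost_a: "measure \<mu> {..a} = 0"
proof -
  have "(LINT c|lborel. w c * indicator {..a} c) = 0"
  proof (intro integral_eq_zero_AE AE_I[of _ _ "{a}"])
    show "{c \<in> space lborel. \<not> w c * indicator {..a} c = 0} \<subseteq> {a}"
    proof
      fix c assume "c \<in> {c \<in> space lborel. \<not> w c * indicator {..a} c = 0}"
      then have "c \<le> a" "w c \<noteq> 0" by (auto split: split_indicator_asm)
      then show "c \<in> {a}" using zero[of c] by force
    qed
  qed auto
  then show ?thesis by (simp add: measure_\<mu>)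
qed

lemma \<mu>_atMost_b: "measure \<mu> {..b} = 1"
proof -
  have "(\<lambda>c. w c * indicator {..b} c) = w"
    using zero by (intro ext) (auto split: split_indicator)
  then show ?thesis using integral_pos by (simp add: measure_\<mu>)
qed

lemma quantile_in:
  assumes "0 < q" "q < 1" shows "a \<le> quantile \<mu> q" "quantile \<mu> q \<le> b"
proof -
  interpret real_distribution \<mu> by (rule real_distribution_\<mu>)
  show "a \<le> quantile \<mu> q" using assms by (intro le_quantile) (auto simp: \<mu>_atMost_a)
  show "quantile \<mu> q \<le> b" using assms by (intro quantile_le) (auto simp: \<mu>_atMost_b)
qed

text \<open>The numerator is at most a bound n of the weight times the length; the normalising
  integral is at least its part over the window from s to 2 s, of length s. The window is later
  placed at the minimizer, whose double also lies in the range of c.\<close>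

lemma \<mu>_atMost_le:
  assumes t: "0 \<le> a" "a \<le> t" "t \<le> b" and n: "0 \<le> n" "\<And>c. c \<in> {a..t} \<Longrightarrow> w c \<le> n"
    and d: "0 < d" "0 < s" "\<And>c. c \<in> {s..2 * s} \<Longrightarrow> d \<le> w c"
  shows "measure \<mu> {..t} \<le> (n * t) / (d * s)"
proof -
  have "(LINT c|lborel. w c * indicator {..t} c) \<le> (LINT c|lborel. n * indicator {a..t} c)"
  proof (rule integral_mono)
    show "integrable lborel (\<lambda>c. w c * indicator {..t} c)"
      using integrable_mult_indicator[OF _ integrable, of "{..t}"] by (simp add: mult.commute)
    show "w c * indicator {..t} c \<le> n * indicator {a..t} c" for c
      using n zero[of c] by (auto split: split_indicator)
  qed (use t in auto)
  also have "\<dots> = n * (t - a)" using t by simp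
  also have "\<dots> \<le> n * t" using t n by (intro mult_left_mono) auto
  finally have 1: "(LINT c|lborel. w c * indicator {..t} c) \<le> n * t" .
  have "d * (2 * s - s) \<le> (LINT c|lborel. w c)"
    using d by (intro integral_ge) auto
  then have 2: "d * s \<le> (LINT c|lborel. w c)" by simp
  have "measure \<mu> {..t} \<le> (n * t) / (LINT c|lborel. w c)"
    using 1 integral_pos by (simp add: measure_\<mu> divide_right_mono)
  also have "\<dots> \<le> (n * t) / (d * s)"
    using 2 d n t integral_pos by (intro divide_left_mono) auto
  finally show ?thesis .
qed

end

section \<open>Posterior density of c in eigencoordinates\<close>

context eigen_design
begin

lemma post_weight_eq:
  assumes c: "0 < c"
  shows "post_weight \<kappa> lam I U (observation E f z) c =
    exp (- (\<Sum>j\<in>J. ln (1 + c * eig j)) / 2 - (\<Sum>j\<in>J. (fcoef E f j + zcoef E z j)\<^sup>2 / (1 + c * eig j)) / 2)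
    * prior_weight \<kappa> lam I c"
proof -
  have "Determinant.det (Sigma_mat U c) = exp (\<Sum>j\<in>J. ln (1 + c * eig j))"
    unfolding det_Sigma exp_sum[OF finJ] using one_plus_pos[of c] c by (intro prod.cong) auto
  then have "Determinant.det (Sigma_mat U c) powr (- 1 / 2) = exp (- (\<Sum>j\<in>J. ln (1 + c * eig j)) / 2)"
    by (simp add: powr_def)
  then show ?thesis
    using c by (simp add: post_weight_def quadratic_Sigma_inv exp_add[symmetric])
qed

lemma post_weight_decomp:
  assumes c: "0 < c" "c \<in> I"
  shows "post_weight \<kappa> lam I U (observation E f z) c = exp (- (\<Sum>j\<in>J. (zcoef E z j)\<^sup>2) / 2)
    * (exp (- (DL E c f + R1L E z c f + R2L E z c) / 2 - lam / c) * c powr (- 1 - \<kappa>))"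
proof -
  have "(\<Sum>j\<in>J. ln (1 + c * eig j)) + (\<Sum>j\<in>J. (fcoef E f j + zcoef E z j)\<^sup>2 / (1 + c * eig j))
     = (\<Sum>j\<in>J. (zcoef E z j)\<^sup>2) + DL E c f + R1L E z c f + R2L E z c"
    unfolding DL_def D1L_def D2L_def R1L_def R2L_def sum_distrib_left sum_negf[symmetric] sum.distrib[symmetric]
  proof (rule sum.cong[OF refl])
    fix j assume j: "j \<in> J"
    define F where "F = fcoef E f j"
    define Z where "Z = zcoef E z j"
    define p where "p = 1 + c * eig j"
    have p: "p \<noteq> 0" using one_plus_pos[OF less_imp_le[OF c(1)] j] by (simp add: p_def)
    have cp: "c * eig j = p - 1" by (simp add: p_def)
    \<comment> \<open>Z^2 / p = Z^2 - Z^2 (p - 1) / p. The first Z^2 leaves as a factor free of c;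
      the second is centred by 1, and the resulting - (p - 1) / p is the term that completes the
      logarithm to \<open>D2L\<close>.\<close>
    have "(F + Z)\<^sup>2 / p = Z\<^sup>2 + F\<^sup>2 / p - (p - 1) / p + 2 * (Z * F / p) + - ((Z\<^sup>2 - 1) * (p - 1) / p)"
      using p by (simp add: field_simps power2_eq_square)
    then show "ln (1 + c * eig j) + (fcoef E f j + zcoef E z j)\<^sup>2 / (1 + c * eig j)
      = (zcoef E z j)\<^sup>2 + ((fcoef E f j)\<^sup>2 / (1 + c * eig j) + (ln (1 + c * eig j) - c * eig j / (1 + c * eig j)))
        + 2 * (zcoef E z j * fcoef E f j / (1 + c * eig j))
        + - (((zcoef E z j)\<^sup>2 - 1) * (c * eig j) / (1 + c * eig j))"
      unfolding F_def[symmetric] Z_def[symmetric] p_def[symmetric] cp by simp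
  qed
  then have "- (\<Sum>j\<in>J. ln (1 + c * eig j)) / 2 - (\<Sum>j\<in>J. (fcoef E f j + zcoef E z j)\<^sup>2 / (1 + c * eig j)) / 2
     = - (\<Sum>j\<in>J. (zcoef E z j)\<^sup>2) / 2 + - (DL E c f + R1L E z c f + R2L E z c) / 2"
    by (simp add: field_simps)
  moreover have "exp (- (DL E c f + R1L E z c f + R2L E z c) / 2 - lam / c)
      = exp (- (DL E c f + R1L E z c f + R2L E z c) / 2) * exp (- lam / c)"
    by (simp add: exp_add[symmetric])
  ultimately show ?thesis
    using c(2) by (simp only: post_weight_eq[OF c(1)] exp_add prior_weight_def if_True mult_ac)
qed

lemma interval_weight_post:
  assumes "0 < a" "a < b"
  shows "interval_weight (post_weight \<kappa> lam {a..b} U (observation E f z)) a b"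
proof
  fix c assume c: "c \<in> {a..b}"
  then have "0 < c" using assms by auto
  then show "0 < post_weight \<kappa> lam {a..b} U (observation E f z) c"
    using c by (simp add: post_weight_eq prior_weight_def)
next
  let ?g = "\<lambda>c. exp (- (\<Sum>j\<in>J. ln (1 + c * eig j)) / 2 - (\<Sum>j\<in>J. (fcoef E f j + zcoef E z j)\<^sup>2 / (1 + c * eig j)) / 2)
    * (c powr (- 1 - \<kappa>) * exp (- lam / c))"
  have "continuous_on {a..b} ?g"
    using assms one_plus_pos
    by (intro continuous_intros) (auto simp: less_imp_neq[symmetric] order_trans[of 0 a] intro!: less_imp_neq[symmetric])
  moreover have "?g c = post_weight \<kappa> lam {a..b} U (observation E f z) c" if "c \<in> {a..b}" for c
    using that assms by (simp add: post_weight_eq prior_weight_def)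
  ultimately show "continuous_on {a..b} (post_weight \<kappa> lam {a..b} U (observation E f z))"
    by (rule continuous_on_eq)
qed (use assms in \<open>auto simp: post_weight_def prior_weight_def\<close>)

end


section \<open>Measurability of posterior quantiles and of the coverage event\<close>

lemma (in eigen_design) posterior_eq:
  assumes "0 < a" "a < b"
  shows "posterior \<kappa> lam {a..b} U (observation E f z)
    = interval_weight.\<mu> (post_weight \<kappa> lam {a..b} U (observation E f z))"
  by (simp add: posterior_def interval_weight.\<mu>_def[OF interval_weight_post[OF assms]])

text \<open>The weight is written as a jointly measurable function of z and c, with the noise
  coordinates explicit and the range as an indicator; numerator and normaliser are then measurable
  parameter integrals.\<close>

lemma (in eigen_design) measurable_posterior_atMost:
  assumes "0 < a" "a < b"
  shows "(\<lambda>z. measure (posterior \<kappa> lam {a..b} U (observation E f z)) {..t})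
    \<in> borel_measurable (std_normal_vec N)"
proof -
  let ?w = "\<lambda>z. post_weight \<kappa> lam {a..b} U (observation E f z)"
  define g where "g z c = indicator {a..b} c *
    (exp (- (\<Sum>j\<in>J. ln (1 + c * eig j)) / 2
        - (\<Sum>j\<in>J. (fcoef E f j + (\<Sum>k<N. e j k * z k))\<^sup>2 / (1 + c * eig j)) / 2)
     * (c powr (- 1 - \<kappa>) * exp (- lam / c)))" for z :: "nat \<Rightarrow> real" and c :: real
  have g: "?w z = g z" for z
  proof
    fix c show "?w z c = g z c"
    proof (cases "c \<in> {a..b}")
      case True
      then show ?thesis using assms by (simp add: g_def post_weight_eq prior_weight_def zcoef_eq)
    next
      case False
      then show ?thesis by (simp add: g_def post_weight_def prior_weight_def del: atLeastAtMost_iff)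
    qed
  qed
  have [measurable]: "case_prod g \<in> borel_measurable (std_normal_vec N \<Otimes>\<^sub>M lborel)"
    unfolding g_def by measurable
  have "measure (posterior \<kappa> lam {a..b} U (observation E f z)) {..t}
     = (LINT c|lborel. g z c * indicator {..t} c) / (LINT c|lborel. g z c)" for z
    using interval_weight.measure_\<mu>(2)[OF interval_weight_post[OF assms, of \<kappa> lam f z], of "{..t}"]
    by (simp add: posterior_eq[OF assms] g)
  then show ?thesis by simp
qed

lemma (in eigen_design) measurable_posterior_quantile:
  assumes "0 < a" "a < b" "0 < q" "q < 1"
  shows "(\<lambda>z. quantile (posterior \<kappa> lam {a..b} U (observation E f z)) q) \<in> borel_measurable (std_normal_vec N)"
  unfolding borel_measurable_iff_less
proof
  fix x
  note [measurable] = measurable_posterior_atMost[OF assms(1,2)]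
  let ?P = "\<lambda>z. posterior \<kappa> lam {a..b} U (observation E f z)"
  have "quantile (?P z) q < x \<longleftrightarrow> (\<exists>t\<in>\<rat>. t < x \<and> q \<le> measure (?P z) {..t})" for z
  proof -
    interpret P: interval_weight "post_weight \<kappa> lam {a..b} U (observation E f z)" a b
      by (rule interval_weight_post[OF assms(1,2)])
    interpret D: real_distribution "?P z"
      unfolding posterior_eq[OF assms(1,2)] by (rule P.real_distribution_\<mu>)
    show ?thesis by (rule D.quantile_less_iff[OF assms(3,4)])
  qed
  then have "{z \<in> space (std_normal_vec N). quantile (?P z) q < x}
     = (\<Union>t\<in>\<rat> \<inter> {..<x}. {z \<in> space (std_normal_vec N). q \<le> measure (?P z) {..t}})"
    by auto
  also have "\<dots> \<in> sets (std_normal_vec N)"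
    by (intro sets.countable_UN'') (auto intro: countable_rat countable_Int1)
  finally show "{z \<in> space (std_normal_vec N). quantile (?P z) q < x} \<in> sets (std_normal_vec N)" .
qed

lemma (in eigen_design) measurable_err2: "(\<lambda>z. err2 f z c) \<in> borel_measurable (std_normal_vec N)"
  unfolding err2_def by measurable

lemma (in eigen_design) continuous_err2: "0 < c \<Longrightarrow> isCont (err2 f z) c"
  unfolding err2_def wt_def
  using one_plus_pos[of c] by (intro continuous_intros) (auto simp: less_imp_neq[symmetric])

text \<open>The lower quantile is at least a > 0, so that every c in the union is positive and the
  spectral formula for the error applies.\<close>

lemma (in eigen_design) mem_credible_set_iff:
  assumes "0 < a" "a < b" and I: "c_range m E = {a..b}" and q: "0 < q1 (fst \<eta>)" "q1 (fst \<eta>) < q2 (fst \<eta>)" "q2 (fst \<eta>) < 1"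
  shows "f \<in> credible_set m \<kappa> lam q1 q2 \<eta> \<Omega> W E M (observation E f z) \<longleftrightarrow>
    (\<exists>c. quantile (posterior \<kappa> lam {a..b} U (observation E f z)) (q1 (fst \<eta>)) < c \<and>
         c < quantile (posterior \<kappa> lam {a..b} U (observation E f z)) (q2 (fst \<eta>)) \<and>
         sqrt (err2 f z c) < M * radius U c (snd \<eta>))"
proof -
  interpret P: interval_weight "post_weight \<kappa> lam {a..b} U (observation E f z)" a b
    by (rule interval_weight_post[OF assms(1,2)])
  have "a \<le> quantile (posterior \<kappa> lam {a..b} U (observation E f z)) (q1 (fst \<eta>))"
    using q unfolding posterior_eq[OF assms(1,2)] by (intro P.quantile_in) auto
  then show ?thesis
    using assms(1) by (auto simp: credible_set_def Let_def I post_mean_error)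
qed

text \<open>The union over the uncountably many \<open>c\<close> is reduced to rational \<open>c\<close>: the radius is
  nondecreasing and the error is continuous in \<open>c\<close>, so that with \<open>c\<close> also its right neighbours
  satisfy the defining inequality.\<close>

lemma (in eigen_design) coverage_event_measurable:
  assumes "0 < a" "a < b" and I: "c_range m E = {a..b}" and q: "0 < q1 (fst \<eta>)" "q1 (fst \<eta>) < q2 (fst \<eta>)" "q2 (fst \<eta>) < 1"
    and pos: "\<exists>j\<in>J. 0 < eig j" and \<eta>: "0 < snd \<eta>" "snd \<eta> < 1" and M: "0 \<le> M"
  shows "{z \<in> space (std_normal_vec N). f \<in> credible_set m \<kappa> lam q1 q2 \<eta> \<Omega> W E M (observation E f z)}
    \<in> sets (std_normal_vec N)"
proof -
  define A where "A z = quantile (posterior \<kappa> lam {a..b} U (observation E f z)) (q1 (fst \<eta>))" for z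
  define B where "B z = quantile (posterior \<kappa> lam {a..b} U (observation E f z)) (q2 (fst \<eta>))" for z
  have [measurable]: "A \<in> borel_measurable (std_normal_vec N)" "B \<in> borel_measurable (std_normal_vec N)"
    unfolding A_def B_def using q by (auto intro!: measurable_posterior_quantile assms)
  note [measurable] = measurable_err2
  let ?good = "\<lambda>z c. A z < c \<and> c < B z \<and> sqrt (err2 f z c) < M * radius U c (snd \<eta>)"
  have aA: "a \<le> A z" for z
  proof -
    interpret P: interval_weight "post_weight \<kappa> lam {a..b} U (observation E f z)" a b
      by (rule interval_weight_post[OF assms(1,2)])
    show ?thesis
      using q unfolding A_def posterior_eq[OF assms(1,2)] by (intro P.quantile_in) auto
  qed
  have "(\<exists>c. ?good z c) \<longleftrightarrow> (\<exists>c\<in>\<rat>. ?good z c)" for z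
  proof
    assume "\<exists>c. ?good z c"
    then obtain c where c: "A z < c" "c < B z" "sqrt (err2 f z c) < M * radius U c (snd \<eta>)" by blast
    have "0 < c" using c(1) aA[of z] assms(1) by simp
    then have "isCont (\<lambda>c. sqrt (err2 f z c)) c"
      by (intro continuous_intros continuous_err2)
    then have "((\<lambda>c. sqrt (err2 f z c)) \<longlongrightarrow> sqrt (err2 f z c)) (at_right c)"
      using isContD filterlim_at_split by blast
    then have "\<forall>\<^sub>F x in at_right c. sqrt (err2 f z x) < M * radius U c (snd \<eta>)"
      using c(3) by (rule order_tendstoD(2))
    then obtain d where d: "d > c" "\<And>x. c < x \<Longrightarrow> x < d \<Longrightarrow> sqrt (err2 f z x) < M * radius U c (snd \<eta>)"
      using c by (auto simp: eventually_at_right[of c "B z"])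
    obtain r where r: "r \<in> \<rat>" "c < r" "r < min d (B z)"
      using Rats_dense_in_real[of c "min d (B z)"] d c by auto
    have "sqrt (err2 f z r) < M * radius U c (snd \<eta>)" using d r by auto
    also have "\<dots> \<le> M * radius U r (snd \<eta>)"
      using r \<open>0 < c\<close> M pos \<eta> by (intro mult_left_mono radius_mono) auto
    finally show "\<exists>c\<in>\<rat>. ?good z c" using r c by (intro bexI[of _ r]) auto
  qed auto
  moreover have "f \<in> credible_set m \<kappa> lam q1 q2 \<eta> \<Omega> W E M (observation E f z) \<longleftrightarrow> (\<exists>c. ?good z c)" for z
    unfolding A_def B_def by (rule mem_credible_set_iff) (use assms in auto)
  ultimately have "{z \<in> space (std_normal_vec N). f \<in> credible_set m \<kappa> lam q1 q2 \<eta> \<Omega> W E M (observation E f z)}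
    = (\<Union>c\<in>\<rat>. {z \<in> space (std_normal_vec N). ?good z c})"
    by auto
  also have "\<dots> \<in> sets (std_normal_vec N)"
    by (intro sets.countable_UN'' countable_rat) measurable
  finally show ?thesis .
qed

section \<open>Balance of bias and variance around the minimizer\<close>

definition bias_const :: "real \<Rightarrow> real" where
  "bias_const \<alpha> = 3 / (1 - 2 powr (- \<alpha>))"

text \<open>The second entry makes k1 powr (- \<alpha>) at least 8 (2 + 12 / k0): an eighth of it,
  the exponential gain below k1 c0, then exceeds the loss 1 + 12 / k0 in the normaliser by at least
  1. Standing outside the locale, it visibly does not depend on n.\<close>

definition tail_scale :: "real \<Rightarrow> real \<Rightarrow> real" where
  "tail_scale \<alpha> k0 = min k0 ((1 / (8 * (2 + 12 / k0))) powr (1 / \<alpha>))"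

text \<open>Comparing the criterion at \<open>c0\<close> with its values at \<open>2 * c0\<close> and at \<open>k0 * c0\<close> shows that bias
  and variance are of the same order at the minimizer \<open>c0\<close>. Below \<open>k1 * c0\<close> the bias dominates so
  strongly that the posterior has almost no mass there, and above it the bias is bounded by the
  variance.\<close>

locale minimizer_design = eigen_design \<Omega> W E
  for \<Omega> :: "'w measure" and W :: "'x \<Rightarrow> 'w \<Rightarrow> real" and E :: "('x, 'i) design" +
  fixes f :: "'x \<Rightarrow> real" and a b lam \<alpha> k0 Cs c0 :: real
  assumes ab: "0 < a" "a < b" and lam: "0 < lam" and \<alpha>: "0 < \<alpha>" "\<alpha> \<le> 1" and k0: "0 < k0" "k0 < 1"
    and bias: "\<And>c K. c \<in> {a..b} \<Longrightarrow> 1 < K \<Longrightarrow> D1L E (K * c) f \<le> K powr (- \<alpha>) * D1L E c f"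
    and halving: "\<And>c. c \<in> {a..b} \<Longrightarrow> k0 * c \<in> {a..b} \<Longrightarrow> D2L E (k0 * c) \<le> D2L E c / 2"
    and Cs: "0 < Cs" "\<And>c. c \<in> {a..b} \<Longrightarrow> D2L E c \<le> Cs * s2 E c"
    and c0: "c0 \<in> {a..b}" "2 * c0 \<in> {a..b}"
    and minimal: "\<And>c. 0 < c \<Longrightarrow> DL E c0 f + 2 * lam / c0 \<le> DL E c f + 2 * lam / c"
begin

text \<open>The prior exponent lam / c behaves like a bias, decreasing in c with rate 1. It
  therefore joins the squared bias in every comparison.\<close>

definition A0 :: real where "A0 = D1L E c0 f + lam / c0"

abbreviation "C1 \<equiv> bias_const \<alpha>"

abbreviation "k1 \<equiv> tail_scale \<alpha> k0"

lemma c0_pos: "0 < c0" using c0 ab by auto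

lemma two_powr_less: "2 powr (- \<alpha>) < 1"
  using \<alpha> powr_less_mono[of "- \<alpha>" 0 2] by simp

lemma C1_pos: "0 < C1" using two_powr_less by (simp add: bias_const_def)


text \<open>From c0 to 2 c0 the bias drops by the factor 2 powr (- \<alpha>), the penalty halves,
  and the variance, which at most quadruples, gains at most 3 \<open>D2L E c0\<close>. Minimality
  gives (1 - 2 powr (- \<alpha>)) A0 <= 3 D2L, the origin of \<open>bias_const\<close>.\<close>

lemma A0_le_D2L: "A0 \<le> C1 * D2L E c0"
proof -
  let ?t = "2 powr (- \<alpha>)"
  have "D1L E (2 * c0) f \<le> ?t * D1L E c0 f" using bias[OF c0(1), of 2] by simp
  moreover have "D2L E (2 * c0) \<le> 4 * D2L E c0" using D2L_double c0_pos by simp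
  moreover have "D1L E c0 f + D2L E c0 + 2 * lam / c0 \<le> D1L E (2 * c0) f + D2L E (2 * c0) + 2 * lam / (2 * c0)"
    using minimal[of "2 * c0"] c0_pos by (simp add: DL_def)
  moreover have "2 * lam / (2 * c0) = lam / c0" "2 * lam / c0 = 2 * (lam / c0)" by auto
  ultimately have "D1L E c0 f - ?t * D1L E c0 f + lam / c0 \<le> 3 * D2L E c0" by linarith
  moreover have "0 \<le> ?t * (lam / c0)" using lam c0_pos by simp
  ultimately have "(1 - ?t) * A0 \<le> 3 * D2L E c0" by (simp add: A0_def algebra_simps)
  then show ?thesis
    using two_powr_less by (simp add: bias_const_def pos_le_divide_eq mult.commute)
qed

text \<open>From c0 to k0 c0 the variance loses at least half, while bias and penalty grow at most
  by 1 / k0. The constant 4 is 2 from the halving times 2 from the coefficient of the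
  penalty.\<close>

lemma D2L_le_A0:
  assumes "a \<le> k0 * c0" shows "D2L E c0 \<le> 4 / k0 * A0"
proof -
  have "k0 * c0 \<le> c0" using k0 c0_pos by (simp add: mult_left_le_one_le)
  then have k0c0: "k0 * c0 \<in> {a..b}" using assms c0 by auto
  have "D2L E (k0 * c0) \<le> D2L E c0 / 2" by (rule halving[OF c0(1) k0c0])
  moreover have "D1L E (k0 * c0) f \<le> D1L E c0 f / k0" using D1L_scale[of c0 k0 f] c0_pos k0 by simp
  moreover have "D1L E c0 f + D2L E c0 + 2 * lam / c0 \<le> D1L E (k0 * c0) f + D2L E (k0 * c0) + 2 * lam / (k0 * c0)"
    using minimal[of "k0 * c0"] c0_pos k0 by (simp add: DL_def)
  moreover define p q r where "p = lam / c0" and "q = lam / c0 / k0" and "r = D1L E c0 f / k0"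
  moreover have "2 * lam / (k0 * c0) = 2 * q" "2 * lam / c0 = 2 * p" by (auto simp: p_def q_def)
  moreover have "0 \<le> D1L E c0 f" "0 \<le> p" "0 \<le> r"
    using D1L_nonneg[of c0 f] c0_pos lam k0 by (auto simp: p_def r_def)
  ultimately have "D2L E c0 \<le> 4 * (r + q)" by argo
  then have "D2L E c0 \<le> 4 * (D1L E c0 f / k0 + lam / c0 / k0)" by (simp add: r_def q_def)
  also have "\<dots> = 4 / k0 * A0" by (simp add: A0_def add_divide_distrib distrib_left mult.commute)
  finally show ?thesis .
qed


lemma k1: "0 < k1" "k1 \<le> k0" "8 * (2 + 12 / k0) \<le> k1 powr (- \<alpha>)"
proof -
  let ?K = "8 * (2 + 12 / k0)"
  have K: "0 < ?K" using k0 by (simp add: add_pos_pos)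
  show k1: "0 < k1" "k1 \<le> k0" using k0 K by (auto simp: tail_scale_def)
  have "k1 powr \<alpha> \<le> ((1 / ?K) powr (1 / \<alpha>)) powr \<alpha>"
    using k1 \<alpha> by (intro powr_mono2) (auto simp: tail_scale_def)
  also have "\<dots> = 1 / ?K" using \<alpha> K by (simp add: powr_powr)
  finally have "inverse (1 / ?K) \<le> inverse (k1 powr \<alpha>)" using k1 by (intro le_imp_inverse_le) auto
  then show "?K \<le> k1 powr (- \<alpha>)" by (simp add: powr_minus)
qed

lemma k1_c0_le: "k1 * c0 \<le> k0 * c0"
  using k1(2) c0_pos by simp

text \<open>Above c0 the bias decreases and the variance grows, so the comparison at c0 persists. At
  c = k c0 with k1 <= k <= 1 the bias grows at most by 1 / k and the variance keeps at least the
  fraction k^2, whence the cube.\<close>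

lemma D1L_le_D2L:
  assumes c: "c \<in> {a..b}" "k1 * c0 \<le> c"
  shows "D1L E c f \<le> C1 / k1 ^ 3 * D2L E c"
proof (cases "c0 \<le> c")
  case True
  have "D1L E c f \<le> D1L E c0 f" using True c0_pos by (intro D1L_antimono) auto
  also have "\<dots> \<le> A0" using lam c0_pos by (simp add: A0_def)
  also have "\<dots> \<le> C1 * D2L E c0" by (rule A0_le_D2L)
  also have "\<dots> \<le> C1 * D2L E c" using C1_pos True c0_pos by (intro mult_left_mono D2L_mono) auto
  also have "\<dots> \<le> C1 / k1 ^ 3 * D2L E c"
  proof (rule mult_right_mono)
    have "k1 ^ 3 \<le> 1" using k1 k0 by (intro power_le_one) auto
    then show "C1 \<le> C1 / k1 ^ 3" using k1 C1_pos by (simp add: le_divide_eq mult_left_le)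
  qed (use D2L_nonneg[of c] True c0_pos in auto)
  finally show ?thesis .
next
  case False
  define k where "k = c / c0"
  have c_eq: "c = k * c0" using c0_pos by (simp add: k_def)
  have k: "0 < k" "k \<le> 1" "k1 \<le> k" using False c c0_pos ab by (auto simp: k_def le_divide_eq)
  have "D1L E c f \<le> D1L E c0 f / k" unfolding c_eq using k c0_pos by (intro D1L_scale) auto
  also have "\<dots> \<le> A0 / k" using lam c0_pos k by (intro divide_right_mono) (auto simp: A0_def)
  also have "\<dots> \<le> C1 * D2L E c0 / k" using k A0_le_D2L by (intro divide_right_mono) auto
  also have "\<dots> = C1 / k ^ 3 * (k\<^sup>2 * D2L E c0)" using k by (simp add: power2_eq_square power3_eq_cube)
  also have "\<dots> \<le> C1 / k ^ 3 * D2L E c"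
    unfolding c_eq using k C1_pos c0_pos by (intro mult_left_mono D2L_scale) auto
  also have "\<dots> \<le> C1 / k1 ^ 3 * D2L E c"
    using k k1 C1_pos D2L_nonneg[of c] c ab
    by (intro mult_right_mono divide_left_mono power_mono) auto
  finally show ?thesis .
qed

definition regular :: "(nat \<Rightarrow> real) \<Rightarrow> bool" where
  "regular z \<longleftrightarrow> (\<forall>c\<in>{a..b}. \<bar>R1L E z c f\<bar> + \<bar>R2L E z c\<bar> \<le> DL E c f / 2)"

text \<open>At c = c0 / x the negative exponent is at least x powr \<alpha> * A0 / 4; one half of it
  pays, through \<open>Cp\<close>, for the factor x powr (1 + \<kappa>) of the prior, and the other
  half is at least k1 powr (- \<alpha>) * A0 / 8. Between c0 and 2 c0 the negative exponent is at
  most (1 + 12 / k0) * A0, which bounds the normaliser from below. The choice of k1 leaves exp (-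
  A0).\<close>

lemma post_tail:
  assumes z: "regular z" and \<kappa>: "0 < \<kappa>" and A1: "1 \<le> A0" and low: "a \<le> k1 * c0"
    and Cp: "0 < Cp" "\<And>x A. 1 \<le> x \<Longrightarrow> 1 \<le> A \<Longrightarrow> x powr (1 + \<kappa>) * exp (- (x powr \<alpha> * A / 8)) \<le> Cp"
  shows "measure (posterior \<kappa> lam {a..b} U (observation E f z)) {..k1 * c0} \<le> Cp * 2 powr (1 + \<kappa>) * exp (- A0)"
proof -
  interpret P: interval_weight "post_weight \<kappa> lam {a..b} U (observation E f z)" a b
    by (rule interval_weight_post[OF ab])
  let ?w = "post_weight \<kappa> lam {a..b} U (observation E f z)"
  define Kz where "Kz = exp (- (\<Sum>j\<in>J. (zcoef E z j)\<^sup>2) / 2)"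
  have Kz: "0 < Kz" by (simp add: Kz_def)
  have w: "?w c = Kz * (exp (- (DL E c f + R1L E z c f + R2L E z c) / 2 - lam / c) * c powr (- 1 - \<kappa>))"
    if "c \<in> {a..b}" for c
    unfolding Kz_def using that ab by (intro post_weight_decomp) auto
  have R: "\<bar>R1L E z c f\<bar> + \<bar>R2L E z c\<bar> \<le> DL E c f / 2" if "c \<in> {a..b}" for c
    using z that by (simp add: regular_def)
  have k1c0: "k1 * c0 \<le> c0" using k1 k0 c0_pos by (simp add: mult_left_le_one_le)
  define n where "n = Kz * (c0 powr (- 1 - \<kappa>) * (Cp * exp (- (k1 powr (- \<alpha>) * A0 / 8))))"
  define d where "d = Kz * (exp (- (1 + 12 / k0) * A0) * (2 * c0) powr (- 1 - \<kappa>))"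
  have upper: "?w c \<le> n" if c: "c \<in> {a..k1 * c0}" for c
  proof -
    have cI: "c \<in> {a..b}" using c k1c0 c0 by auto
    have c_pos: "0 < c" using c ab by auto
    define x where "x = c0 / c"
    have x: "1 \<le> x" "1 / k1 \<le> x" "c0 = x * c"
      using c c_pos k1c0 k1 by (auto simp: x_def field_simps)
    have "x powr \<alpha> * D1L E c0 f \<le> D1L E c f"
    proof (cases "x = 1")
      case False
      then have "D1L E c0 f \<le> x powr (- \<alpha>) * D1L E c f"
        unfolding x(3) using x cI by (intro bias) auto
      then show ?thesis using x by (simp add: powr_minus field_simps)
    qed (use x in simp)
    moreover have "x powr \<alpha> * (lam / c0) \<le> lam / c"
    proof -
      \<comment> \<open>Here \<alpha> <= 1 enters: the penalty grows like x, the bias is only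
        guaranteed to grow like x powr \<alpha>, and the smaller rate serves for both.\<close>
      have "x powr \<alpha> \<le> x" using x \<alpha> powr_mono[of \<alpha> 1 x] by simp
      then have "x powr \<alpha> * (lam / c0) \<le> x * (lam / c0)" using lam c0_pos by (intro mult_right_mono) auto
      also have "\<dots> = lam / c" using c_pos c0_pos by (simp add: x_def)
      finally show ?thesis .
    qed
    ultimately have xA: "x powr \<alpha> * A0 \<le> D1L E c f + lam / c" by (simp add: A0_def distrib_left)
    have D2: "0 \<le> D2L E c" "0 \<le> lam / c" using D2L_nonneg[of c] c_pos lam by auto
    have cp: "c powr (- 1 - \<kappa>) = c0 powr (- 1 - \<kappa>) * x powr (1 + \<kappa>)"
    proof -
      have "c0 powr (- 1 - \<kappa>) * x powr (1 + \<kappa>) = c powr (- 1 - \<kappa>) * (x powr (- 1 - \<kappa>) * x powr (1 + \<kappa>))"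
        using x c_pos by (simp add: powr_mult)
      also have "x powr (- 1 - \<kappa>) * x powr (1 + \<kappa>) = 1" using x by (simp add: powr_add[symmetric])
      finally show ?thesis by simp
    qed
    have "- (DL E c f + R1L E z c f + R2L E z c) / 2 - lam / c \<le> - (x powr \<alpha> * A0 / 4)"
    proof -
      have "- (DL E c f + R1L E z c f + R2L E z c) \<le> - (DL E c f / 2)"
        using R[OF cI] by linarith
      then have "- (DL E c f + R1L E z c f + R2L E z c) / 2 \<le> - (DL E c f / 2) / 2"
        by (rule divide_right_mono) simp
      then have "- (DL E c f + R1L E z c f + R2L E z c) / 2 - lam / c \<le> - (DL E c f / 4) - lam / c" by simp
      also have "\<dots> \<le> - ((D1L E c f + lam / c) / 4)"
      proof -
        define l where "l = lam / c"
        show ?thesis using D2 unfolding DL_def l_def[symmetric] by argo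
      qed
      also have "\<dots> \<le> - (x powr \<alpha> * A0 / 4)" using xA by (simp add: divide_right_mono)
      finally show ?thesis .
    qed
    then have "exp (- (DL E c f + R1L E z c f + R2L E z c) / 2 - lam / c) * c powr (- 1 - \<kappa>)
        \<le> exp (- (x powr \<alpha> * A0 / 4)) * c powr (- 1 - \<kappa>)"
      by (intro mult_right_mono) auto
    also have "exp (- (x powr \<alpha> * A0 / 4)) * c powr (- 1 - \<kappa>)
      = c0 powr (- 1 - \<kappa>) * ((x powr (1 + \<kappa>) * exp (- (x powr \<alpha> * A0 / 8))) * exp (- (x powr \<alpha> * A0 / 8)))"
    proof -
      have "exp (- (x powr \<alpha> * A0 / 4)) = exp (- (x powr \<alpha> * A0 / 8)) * exp (- (x powr \<alpha> * A0 / 8))"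
        by (simp add: exp_add[symmetric])
      then show ?thesis unfolding cp by (simp add: mult_ac)
    qed
    also have "\<dots> \<le> c0 powr (- 1 - \<kappa>) * (Cp * exp (- (k1 powr (- \<alpha>) * A0 / 8)))"
    proof (intro mult_left_mono mult_mono)
      have "k1 powr (- \<alpha>) = (1 / k1) powr \<alpha>" using k1 by (simp add: powr_minus_divide powr_divide)
      also have "\<dots> \<le> x powr \<alpha>" using x \<alpha> k1 by (intro powr_mono2) auto
      finally have "k1 powr (- \<alpha>) * A0 \<le> x powr \<alpha> * A0" using A1 by (intro mult_right_mono) auto
      then show "exp (- (x powr \<alpha> * A0 / 8)) \<le> exp (- (k1 powr (- \<alpha>) * A0 / 8))" by simp
    qed (use Cp x A1 in auto)
    finally show ?thesis
      unfolding w[OF cI] n_def using Kz by (intro mult_left_mono) auto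
  qed
  have lower: "d \<le> ?w c" if c: "c \<in> {c0..2 * c0}" for c
  proof -
    have cI: "c \<in> {a..b}" using c c0 by auto
    have c_pos: "0 < c" using c c0_pos by auto
    have "D1L E c f \<le> D1L E c0 f" using c c0_pos by (intro D1L_antimono) auto
    moreover have "D2L E c \<le> 4 * D2L E c0"
      using D2L_mono[of c "2 * c0"] D2L_double[of c0] c c_pos c0_pos by auto
    moreover have "D2L E c0 \<le> 4 / k0 * A0"
      using low k1_c0_le by (intro D2L_le_A0) linarith
    moreover have "lam / c \<le> lam / c0" using c c0_pos lam by (intro divide_left_mono) auto
    moreover have "(DL E c f + R1L E z c f + R2L E z c) / 2 \<le> 3 / 4 * DL E c f"
      using R[OF cI] abs_ge_self[of "R1L E z c f"] abs_ge_self[of "R2L E z c"] by argo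
    moreover have "0 \<le> D1L E c0 f" using D1L_nonneg c0_pos by simp
    \<comment> \<open>In three quarters of \<open>DL\<close> the variance contributes at most 3 * (4
      / k0) * A0; bias and penalty together contribute at most \<open>A0\<close>.\<close>
    ultimately have "(DL E c f + R1L E z c f + R2L E z c) / 2 + lam / c \<le> A0 + 3 * (4 / k0 * A0)"
      unfolding DL_def[of E c f] A0_def by argo
    also have "\<dots> = (1 + 12 / k0) * A0" by (simp add: algebra_simps)
    finally have X: "(DL E c f + R1L E z c f + R2L E z c) / 2 + lam / c \<le> (1 + 12 / k0) * A0" .
    have "x / 2 + l \<le> y \<Longrightarrow> - y \<le> - x / 2 - l" for x y l :: real by argo
    from this[OF X] have "- (1 + 12 / k0) * A0 \<le> - (DL E c f + R1L E z c f + R2L E z c) / 2 - lam / c"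
      by (simp only: mult_minus_left)
    then have "exp (- (1 + 12 / k0) * A0) \<le> exp (- (DL E c f + R1L E z c f + R2L E z c) / 2 - lam / c)"
      by (simp only: exp_le_cancel_iff)
    moreover have "(2 * c0) powr (- 1 - \<kappa>) \<le> c powr (- 1 - \<kappa>)"
      using c c_pos \<kappa> by (intro powr_mono2') auto
    ultimately show ?thesis
      unfolding w[OF cI] d_def using Kz by (intro mult_left_mono mult_mono) auto
  qed
  have "measure P.\<mu> {..k1 * c0} \<le> (n * (k1 * c0)) / (d * c0)"
  proof (rule P.\<mu>_atMost_le)
    show "k1 * c0 \<le> b" using k1c0 c0(1) by (meson atLeastAtMost_iff order_trans)
    show "0 \<le> n" "0 < d" using Kz Cp(1) c0_pos by (auto simp: n_def d_def)
  qed (use upper lower ab low c0_pos in auto)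
  also have "\<dots> = k1 * (n / d)" using c0_pos by simp
  also have "\<dots> \<le> n / d" using k1 k0 Kz Cp by (intro mult_left_le_one_le) (auto simp: n_def d_def)
  also have "n / d = Cp * 2 powr (1 + \<kappa>) * exp (- (k1 powr (- \<alpha>) * A0 / 8) + (1 + 12 / k0) * A0)"
  proof -
    have "(2 * c0) powr (- 1 - \<kappa>) = c0 powr (- 1 - \<kappa>) / 2 powr (1 + \<kappa>)"
    proof -
      have "(2 * c0) powr (- 1 - \<kappa>) = 2 powr (- (1 + \<kappa>)) * c0 powr (- 1 - \<kappa>)"
        using c0_pos by (simp add: powr_mult)
      also have "(2 :: real) powr (- (1 + \<kappa>)) = 1 / 2 powr (1 + \<kappa>)" by (rule powr_minus_divide)
      finally show ?thesis by simp
    qed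
    moreover have "exp (- (1 + 12 / k0) * A0) = 1 / exp ((1 + 12 / k0) * A0)"
      by (simp only: mult_minus_left exp_minus inverse_eq_divide)
    ultimately show ?thesis
      using Kz c0_pos by (simp add: n_def d_def exp_add[symmetric])
  qed
  also have "\<dots> \<le> Cp * 2 powr (1 + \<kappa>) * exp (- A0)"
  proof -
    have "8 * (2 + 12 / k0) * A0 \<le> k1 powr (- \<alpha>) * A0" using k1(3) A1 by (intro mult_right_mono) auto
    then have "- (k1 powr (- \<alpha>) * A0 / 8) + (1 + 12 / k0) * A0 \<le> - A0"
      by (simp add: algebra_simps)
    then show ?thesis using Cp by (intro mult_left_mono) auto
  qed
  finally show ?thesis by (simp add: posterior_eq[OF ab])
qed

end


subsection \<open>Coverage\<close>

text \<open>\<open>L\<close> bounds \<open>D2L\<close> from below and is large in three respects: it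
  forces \<open>A0\<close> >= 1, pushes the posterior mass up to k1 c0 below the lower level, and
  lifts \<open>s2\<close> above the threshold of the radius bound. The condition on \<open>M\<close>
  compares the error constant with the factor 1 / 2 of that bound.\<close>

lemma (in minimizer_design) regular_imp_covered:
  assumes z: "regular z" and I: "c_range m E = {a..b}" and \<kappa>: "0 < \<kappa>"
    and q: "0 < q1 (fst \<eta>)" "q1 (fst \<eta>) < q2 (fst \<eta>)" "q2 (fst \<eta>) < 1"
    and \<eta>: "0 < snd \<eta>" "snd \<eta> < 1"
    and Cp: "0 < Cp" "\<And>x A. 1 \<le> x \<Longrightarrow> 1 \<le> A \<Longrightarrow> x powr (1 + \<kappa>) * exp (- (x powr \<alpha> * A / 8)) \<le> Cp"
    and L: "\<And>c. c \<in> {a..b} \<Longrightarrow> L \<le> D2L E c"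
    and L1: "4 / k0 \<le> L" and L2: "Cp * 2 powr (1 + \<kappa>) * exp (- (k0 * L / 4)) < q1 (fst \<eta>)"
    and L3: "Cs * (8 / snd \<eta>) < L"
    and M: "0 \<le> M" "2 * ((3 * (C1 / k1 ^ 3) + 1) * Cs + 2) < M\<^sup>2"
  shows "f \<in> credible_set m \<kappa> lam q1 q2 \<eta> \<Omega> W E M (observation E f z)"
proof -
  let ?P = "posterior \<kappa> lam {a..b} U (observation E f z)"
  interpret P: interval_weight "post_weight \<kappa> lam {a..b} U (observation E f z)" a b
    by (rule interval_weight_post[OF ab])
  interpret D: real_distribution ?P
    unfolding posterior_eq[OF ab] by (rule P.real_distribution_\<mu>)
  let ?q = "quantile ?P (q1 (fst \<eta>))" and ?q' = "quantile ?P (q2 (fst \<eta>))"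
  have less: "?q < ?q'"
    using q by (intro D.quantile_strict_mono) (auto simp: posterior_eq[OF ab] P.\<mu>_singleton)
  have range: "a \<le> ?q" "?q' \<le> b"
    using q unfolding posterior_eq[OF ab] by (auto intro!: P.quantile_in)
  have k1q: "k1 * c0 \<le> ?q"
  \<comment> \<open>If k1 c0 lies below the range, there is no tail to remove: the quantile is at
    least a.\<close>
  proof (cases "a \<le> k1 * c0")
    case True
    have "a \<le> k0 * c0" using True k1_c0_le by linarith
    then have "L \<le> 4 / k0 * A0" using D2L_le_A0 L[OF c0(1)] by linarith
    then have A0: "k0 * L / 4 \<le> A0" using k0 by (simp add: field_simps)
    moreover have "1 \<le> k0 * L / 4" using L1 k0 by (simp add: field_simps)
    ultimately have A1: "1 \<le> A0" by linarith
    have "measure ?P {..k1 * c0} \<le> Cp * 2 powr (1 + \<kappa>) * exp (- A0)"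
      by (rule post_tail[OF z \<kappa> A1 True Cp])
    also have "\<dots> \<le> Cp * 2 powr (1 + \<kappa>) * exp (- (k0 * L / 4))"
      using Cp A0 by (intro mult_left_mono) auto
    also have "\<dots> < q1 (fst \<eta>)" by (rule L2)
    finally show ?thesis using q by (intro D.le_quantile) auto
  qed (use range in linarith)
  define c where "c = (?q + ?q') / 2"
  have c: "?q < c" "c < ?q'" using less by (auto simp: c_def field_simps)
  have cI: "c \<in> {a..b}" using c range by auto
  have c_pos: "0 < c" using cI ab by auto
  have D1: "D1L E c f \<le> C1 / k1 ^ 3 * D2L E c" using cI k1q c by (intro D1L_le_D2L) auto
  let ?K = "3 * (C1 / k1 ^ 3) + 1"
  have K: "0 \<le> ?K" using C1_pos k1 by (auto intro!: add_nonneg_nonneg)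
  have "err2 f z c \<le> 2 * D1L E c f + 2 * (s2 E c - R2L E z c)"
    using c_pos by (intro err2_le) auto
  \<comment> \<open>Regularity gives 2 |R2L| <= DL = D1L + D2L, whence the coefficients 3 and
    1.\<close>
  also have "\<dots> \<le> 3 * D1L E c f + D2L E c + 2 * s2 E c"
  proof -
    have "\<bar>R1L E z c f\<bar> + \<bar>R2L E z c\<bar> \<le> DL E c f / 2" using z cI unfolding regular_def by blast
    then have "2 * \<bar>R2L E z c\<bar> \<le> DL E c f" using abs_ge_zero[of "R1L E z c f"] by argo
    then show ?thesis using abs_ge_minus_self[of "R2L E z c"] unfolding DL_def by argo
  qed
  also have "\<dots> \<le> ?K * D2L E c + 2 * s2 E c"
  proof -
    define t where "t = C1 / k1 ^ 3"
    show ?thesis using D1 unfolding t_def[symmetric] by (simp add: algebra_simps)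
  qed
  also have "\<dots> \<le> (?K * Cs + 2) * s2 E c"
    using mult_left_mono[OF Cs(2)[OF cI] K] by (simp add: algebra_simps)
  finally have err: "err2 f z c \<le> (?K * Cs + 2) * s2 E c" .
  have "Cs * (8 / snd \<eta>) < Cs * s2 E c" using L3 L[OF cI] Cs(2)[OF cI] by linarith
  then have s2: "8 / snd \<eta> < s2 E c" using mult_less_cancel_left_pos[OF Cs(1)] by blast
  then have s2_pos: "0 < s2 E c" using \<eta> by (meson divide_pos_pos less_trans zero_less_numeral)
  have rad: "s2 E c / 2 \<le> (radius U c (snd \<eta>))\<^sup>2"
    using c_pos \<eta> s2 by (intro radius_lower_bound) auto
  have pos: "\<exists>j\<in>J. 0 < eig j"
  proof (rule ccontr)
    assume "\<not> ?thesis"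
    then have "eig j = 0" if "j \<in> J" for j using eigval_nonneg[OF that] that by force
    then show False using s2_pos by (simp add: s2_def)
  qed
  have "err2 f z c < M\<^sup>2 * (s2 E c / 2)"
  proof -
    have "(?K * Cs + 2) * s2 E c < M\<^sup>2 / 2 * s2 E c" using M s2_pos by (intro mult_strict_right_mono) auto
    then show ?thesis using err by simp
  qed
  also have "\<dots> \<le> (M * radius U c (snd \<eta>))\<^sup>2"
    unfolding power_mult_distrib using rad by (intro mult_left_mono) auto
  finally have "sqrt (err2 f z c) < M * radius U c (snd \<eta>)"
    using M radius_pos[OF pos c_pos \<eta>] by (intro real_less_lsqrt) (auto intro!: sum_nonneg simp: err2_def)
  moreover have "f \<in> credible_set m \<kappa> lam q1 q2 \<eta> \<Omega> W E M (observation E f z) \<longleftrightarrow>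
      (\<exists>c. ?q < c \<and> c < ?q' \<and> sqrt (err2 f z c) < M * radius U c (snd \<eta>))"
    by (rule mem_credible_set_iff) (use ab I q in auto)
  ultimately show ?thesis using c by blast
qed

text \<open>Common end of both routes: on the measurable event \<open>G n\<close> coverage is
  certain, so the coverage probability lies between that of \<open>G n\<close> and 1. All constants,
  \<open>L\<close> and \<open>M0\<close> included, are chosen before n.\<close>

lemma coverage_tendsto_1:
  fixes E :: "nat \<Rightarrow> ('x, 'i) design" and W :: "'x \<Rightarrow> 'w \<Rightarrow> real" and f :: "'x \<Rightarrow> real"
  assumes gp: "centered_gaussian_process \<Omega> W" and eb: "\<And>n. orthonormal_eigenbasis \<Omega> W (E n)"
    and npts: "\<forall>\<^sub>F n in sequentially. 2 \<le> npts (E n)"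
    and \<kappa>: "0 < \<kappa>" and lam: "0 < lam"
    and \<eta>: "0 < \<eta>2" "\<eta>2 < 1" and q: "0 < q1 \<eta>1" "q1 \<eta>1 < q2 \<eta>1" "q2 \<eta>1 < 1"
    and minimizer: "interior_minimizer m lam E f" and bias: "good_bias m E f"
    and k0: "0 < k0" "k0 < 1"
    and halving: "\<forall>\<^sub>F n in sequentially. \<forall>c\<in>c_range m (E n). k0 * c \<in> c_range m (E n) \<longrightarrow>
        D2L (E n) (k0 * c) \<le> D2L (E n) c / 2"
    and Cs: "0 < Cs" and D2L_s2: "\<forall>\<^sub>F n in sequentially. \<forall>c\<in>c_range m (E n). D2L (E n) c \<le> Cs * s2 (E n) c"
    and growth: "\<And>L. \<forall>\<^sub>F n in sequentially. \<forall>c\<in>c_range m (E n). L \<le> D2L (E n) c"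
    and G_sets: "\<forall>\<^sub>F n in sequentially. G n \<in> sets (std_normal_vec (npts (E n)))"
    and G: "\<forall>\<^sub>F n in sequentially. \<forall>z\<in>G n. \<forall>c\<in>c_range m (E n).
        \<bar>R1L (E n) z c f\<bar> + \<bar>R2L (E n) z c\<bar> \<le> DL (E n) c f / 2"
    and G_prob: "(\<lambda>n. measure (std_normal_vec (npts (E n))) (G n)) \<longlonglongrightarrow> 1"
  shows "\<exists>M0. \<forall>M\<ge>M0. (\<lambda>n. coverage m \<kappa> lam q1 q2 (\<eta>1, \<eta>2) \<Omega> W (E n) M f) \<longlonglongrightarrow> 1"
proof -
  obtain \<alpha>0 where \<alpha>0: "0 < \<alpha>0" and bias0: "\<forall>\<^sub>F n in sequentially. \<forall>c\<in>c_range m (E n). \<forall>K>1.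
        D1L (E n) (K * c) f \<le> K powr (- \<alpha>0) * D1L (E n) c f"
    using bias unfolding good_bias_def by blast
  \<comment> \<open>Lowering the exponent weakens the bias condition, since K > 1, and makes it
    comparable with the rate 1 of the penalty.\<close>
  define \<alpha> where "\<alpha> = min \<alpha>0 1"
  have \<alpha>: "0 < \<alpha>" "\<alpha> \<le> 1" "\<alpha> \<le> \<alpha>0" using \<alpha>0 by (auto simp: \<alpha>_def)
  obtain Cp :: real where Cp: "0 < Cp" "\<And>x A. 1 \<le> x \<Longrightarrow> 1 \<le> A \<Longrightarrow> x powr (1 + \<kappa>) * exp (- (x powr \<alpha> * A / 8)) \<le> Cp"
    using powr_exp_bounded[of \<alpha> "1 + \<kappa>"] \<alpha> \<kappa> by auto
  define KM where "KM = 2 * ((3 * (bias_const \<alpha> / tail_scale \<alpha> k0 ^ 3) + 1) * Cs + 2)"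
  \<comment> \<open>The summand 1 makes M >= 1, so that M^2 >= M >= M0 > KM.\<close>
  define M0 where "M0 = 1 + \<bar>KM\<bar>"
  have "((\<lambda>L. Cp * 2 powr (1 + \<kappa>) * exp (- (k0 * L / 4))) \<longlongrightarrow> 0) at_top"
  proof -
    have "LIM L at_top. k0 * L / 4 :> at_top"
      using filterlim_tendsto_pos_mult_at_top[OF tendsto_const[of "k0 / 4"] _ filterlim_ident] k0 by simp
    then have "((\<lambda>L. exp (- (k0 * L / 4))) \<longlongrightarrow> 0) at_top"
      by (intro filterlim_compose[OF exp_at_bot] filterlim_compose[OF filterlim_uminus_at_bot_at_top])
    from tendsto_mult_right_zero[OF this] show ?thesis .
  qed
  then have "\<forall>\<^sub>F L in at_top. Cp * 2 powr (1 + \<kappa>) * exp (- (k0 * L / 4)) < q1 \<eta>1"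
    using q(1) by (rule order_tendstoD(2))
  then have "\<forall>\<^sub>F L in at_top. Cp * 2 powr (1 + \<kappa>) * exp (- (k0 * L / 4)) < q1 \<eta>1 \<and> 4 / k0 \<le> L \<and> Cs * (8 / \<eta>2) < L"
    by (intro eventually_conj eventually_ge_at_top eventually_gt_at_top)
  then obtain L where L: "Cp * 2 powr (1 + \<kappa>) * exp (- (k0 * L / 4)) < q1 \<eta>1" "4 / k0 \<le> L" "Cs * (8 / \<eta>2) < L"
    using eventually_happens'[of at_top] by (metis (no_types, lifting) trivial_limit_at_top_linorder)
  have "(\<lambda>n. coverage m \<kappa> lam q1 q2 (\<eta>1, \<eta>2) \<Omega> W (E n) M f) \<longlonglongrightarrow> 1" if M: "M0 \<le> M" for M
  proof -
    have M_pos: "0 \<le> M" using M by (simp add: M0_def)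
    have M2: "KM < M\<^sup>2"
    proof -
      have "KM < M0" by (simp add: M0_def)
      also have "\<dots> \<le> M * M" using M mult_mono[of 1 M M0 M] by (simp add: M0_def)
      finally show ?thesis by (simp add: power2_eq_square)
    qed
    have "\<forall>\<^sub>F n in sequentially. measure (std_normal_vec (npts (E n))) (G n)
        \<le> coverage m \<kappa> lam q1 q2 (\<eta>1, \<eta>2) \<Omega> W (E n) M f"
      using npts minimizer[unfolded interior_minimizer_def] bias0 halving D2L_s2 growth[of L] G_sets G
    proof eventually_elim
      case (elim n)
      define a where "a = ln (real (npts (E n))) / real (npts (E n))"
      define b where "b = real (npts (E n)) powr (m - 1)"
      have I: "c_range m (E n) = {a..b}" by (simp add: c_range_def a_def b_def)
      have a: "0 < a" using elim(1) by (simp add: a_def)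
      obtain c0 where c0: "is_arg_min (\<lambda>c. DL (E n) c f + 2 * lam / c) (\<lambda>c. c > 0) c0"
          "c0 \<in> {a..b}" "2 * c0 \<in> {a..b}"
        using elim(2) unfolding I by blast
      have ab: "a < b" using c0 a by auto
      interpret eigen_design \<Omega> W "E n" using gp eb by unfold_locales
      interpret minimizer_design \<Omega> W "E n" f a b lam \<alpha> k0 Cs c0
      proof
        fix c K :: real assume c: "c \<in> {a..b}" and K: "1 < K"
        have "D1L (E n) (K * c) f \<le> K powr (- \<alpha>0) * D1L (E n) c f" using elim(3) c K unfolding I by blast
        also have "\<dots> \<le> K powr (- \<alpha>) * D1L (E n) c f"
          using K \<alpha> c a D1L_nonneg[of c f] by (intro mult_right_mono powr_mono) auto
        finally show "D1L (E n) (K * c) f \<le> K powr (- \<alpha>) * D1L (E n) c f" .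
      next
        fix c :: real assume "0 < c"
        then show "DL (E n) c0 f + 2 * lam / c0 \<le> DL (E n) c f + 2 * lam / c"
          using c0(1) unfolding is_arg_min_def by (meson not_le)
      qed (use elim a ab lam \<alpha> k0 Cs c0 in \<open>auto simp: I\<close>)
      \<comment> \<open>L > 0 rules out a spectrum that is identically 0, the degenerate case of the
        radius.\<close>
      have pos: "\<exists>j\<in>J. 0 < eig j"
      proof (rule ccontr)
        assume "\<not> ?thesis"
        then have "eig j = 0" if "j \<in> J" for j using eigval_nonneg[OF that] that by force
        then have "D2L (E n) c0 = 0" by (simp add: D2L_def)
        moreover have "L \<le> D2L (E n) c0" using elim(6) c0 unfolding I by blast
        moreover have "0 < L" using L(2) k0 by (meson divide_pos_pos less_le_trans zero_less_numeral)
        ultimately show False by simp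
      qed
      interpret S: prob_space "std_normal_vec N" by (rule prob_space_std_normal_vec)
      have "G n \<subseteq> {z \<in> space (std_normal_vec N). f \<in> credible_set m \<kappa> lam q1 q2 (\<eta>1, \<eta>2) \<Omega> W (E n) M (observation (E n) f z)}"
      proof
        fix z assume z: "z \<in> G n"
        then have "regular z" using elim(8) unfolding regular_def I by blast
        then have "f \<in> credible_set m \<kappa> lam q1 q2 (\<eta>1, \<eta>2) \<Omega> W (E n) M (observation (E n) f z)"
          using I \<kappa> q \<eta> Cp L M_pos M2 elim(6)
          by (intro regular_imp_covered[where L = L and Cp = Cp]) (auto simp: KM_def)
        moreover have "z \<in> space (std_normal_vec N)" using z elim(7) sets.sets_into_space by blast
        ultimately show "z \<in> {z \<in> space (std_normal_vec N). f \<in> credible_set m \<kappa> lam q1 q2 (\<eta>1, \<eta>2) \<Omega> W (E n) M (observation (E n) f z)}"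
          by simp
      qed
      \<comment> \<open>Monotonicity of \<open>measure\<close> requires the larger set to be
        measurable.\<close>
      moreover have "{z \<in> space (std_normal_vec N). f \<in> credible_set m \<kappa> lam q1 q2 (\<eta>1, \<eta>2) \<Omega> W (E n) M (observation (E n) f z)}
          \<in> sets (std_normal_vec N)"
        using a ab I q pos \<eta> M_pos by (intro coverage_event_measurable[where a = a and b = b]) auto
      ultimately show "measure (std_normal_vec N) (G n) \<le> coverage m \<kappa> lam q1 q2 (\<eta>1, \<eta>2) \<Omega> W (E n) M f"
        unfolding coverage_def by (intro S.finite_measure_mono)
    qed
    moreover have "\<forall>\<^sub>F n in sequentially. coverage m \<kappa> lam q1 q2 (\<eta>1, \<eta>2) \<Omega> W (E n) M f \<le> 1"
      unfolding coverage_def by (intro always_eventually allI prob_space.prob_le_1 prob_space_std_normal_vec)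
    ultimately show ?thesis by (rule tendsto_sandwich[OF _ _ G_prob tendsto_const])
  qed
  then show ?thesis by blast
qed


section \<open>Suprema over c as events, and coverage under the assumptions on the
  remainders\<close>

lemma rational_near_in_interval:
  assumes ab: "a < b" and c: "c \<in> {a..b}" and ev: "\<forall>\<^sub>F x in nhds (c::real). P x"
  shows "\<exists>r\<in>\<rat> \<inter> {a..b}. P r"
proof -
  obtain d where d: "0 < d" "\<And>x. dist x c < d \<Longrightarrow> P x"
    using ev unfolding eventually_nhds_metric by blast
  have "max a (c - d) < min b (c + d)" using ab c d by auto
  then obtain r where r: "r \<in> \<rat>" "max a (c - d) < r" "r < min b (c + d)"
    using Rats_dense_in_real by blast
  then show ?thesis using d(2)[of r] by (intro bexI[of _ r]) (auto simp: dist_real_def)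
qed

text \<open>By continuity an exceedance at some c occurs at a rational one nearby; a < b provides
  rationals of the interval next to its endpoints as well.\<close>

lemma sup_event_measurable:
  fixes X :: "'a \<Rightarrow> real \<Rightarrow> real"
  assumes ab: "a < b" and X [measurable]: "\<And>c. (\<lambda>z. X z c) \<in> borel_measurable M"
    and cont: "\<And>z c. c \<in> {a..b} \<Longrightarrow> isCont (X z) c"
  shows "{z \<in> space M. (SUP c\<in>{a..b}. ereal \<bar>X z c\<bar>) > ereal \<epsilon>} \<in> sets M"
proof -
  have "(SUP c\<in>{a..b}. ereal \<bar>X z c\<bar>) > ereal \<epsilon> \<longleftrightarrow> (\<exists>c\<in>\<rat> \<inter> {a..b}. \<epsilon> < \<bar>X z c\<bar>)" for z
  proof
    assume "(SUP c\<in>{a..b}. ereal \<bar>X z c\<bar>) > ereal \<epsilon>"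
    then obtain c where c: "c \<in> {a..b}" "\<epsilon> < \<bar>X z c\<bar>" by (auto simp: less_SUP_iff)
    have "isCont (\<lambda>c. \<bar>X z c\<bar>) c" using cont[OF c(1)] by (intro continuous_intros)
    then have "((\<lambda>c. \<bar>X z c\<bar>) \<longlongrightarrow> \<bar>X z c\<bar>) (nhds c)"
      by (simp add: isCont_def tendsto_nhds_iff)
    then have "\<forall>\<^sub>F x in nhds c. \<epsilon> < \<bar>X z x\<bar>" using c(2) by (rule order_tendstoD(1))
    then show "\<exists>c\<in>\<rat> \<inter> {a..b}. \<epsilon> < \<bar>X z c\<bar>" by (rule rational_near_in_interval[OF ab c(1)])
  qed (auto simp: less_SUP_iff)
  then have "{z \<in> space M. (SUP c\<in>{a..b}. ereal \<bar>X z c\<bar>) > ereal \<epsilon>}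
     = (\<Union>c\<in>\<rat> \<inter> {a..b}. {z \<in> space M. \<epsilon> < \<bar>X z c\<bar>})"
    by auto
  also have "\<dots> \<in> sets M"
    by (intro sets.countable_UN'') (auto intro: countable_rat countable_Int1)
  finally show ?thesis .
qed

context eigen_design
begin

lemma isCont_resolvent: "0 < c \<Longrightarrow> j \<in> J \<Longrightarrow> isCont (\<lambda>c. x / (1 + c * eig j)) c"
  using one_plus_pos[of c j] by (intro continuous_intros) auto

lemma isCont_R1L: "0 < c \<Longrightarrow> isCont (\<lambda>c. R1L E z c f) c"
  unfolding R1L_eq by (intro continuous_intros isCont_resolvent)

lemma isCont_wt: "0 < c \<Longrightarrow> j \<in> J \<Longrightarrow> isCont (\<lambda>c. wt c j) c"
  unfolding wt_def using one_plus_pos[of c j] by (intro continuous_intros) auto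

lemma isCont_R2L: "0 < c \<Longrightarrow> isCont (\<lambda>c. R2L E z c) c"
  unfolding R2L_eq by (intro continuous_intros isCont_wt)

lemma isCont_DL: "0 < c \<Longrightarrow> isCont (\<lambda>c. DL E c f) c"
  unfolding DL_def D1L_def D2L_def
  by (intro continuous_intros isCont_resolvent isCont_wt[unfolded wt_def])
    (use one_plus_pos[of c] in \<open>auto simp: less_imp_neq[symmetric]\<close>)

lemma measurable_R1L [measurable]: "(\<lambda>z. R1L E z c f) \<in> borel_measurable (std_normal_vec N)"
  unfolding R1L_eq by measurable

lemma ratio_sup_event_measurable:
  assumes "0 < a" "a < b" and "\<And>c. c \<in> {a..b} \<Longrightarrow> 0 < DL E c f"
  shows "{z \<in> space (std_normal_vec N).
      (SUP c\<in>{a..b}. ereal \<bar>(\<bar>R1L E z c f\<bar> + \<bar>R2L E z c\<bar>) / DL E c f\<bar>) > ereal \<epsilon>} \<in> sets (std_normal_vec N)"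
proof (rule sup_event_measurable[OF assms(2)])
  fix z c assume c: "c \<in> {a..b}"
  then have "0 < c" using assms(1) by auto
  then show "isCont (\<lambda>c. (\<bar>R1L E z c f\<bar> + \<bar>R2L E z c\<bar>) / DL E c f) c"
    using assms(3)[OF c] by (intro continuous_intros isCont_R1L isCont_R2L isCont_DL) auto
qed measurable

end

text \<open>\<open>G\<close> is the event that the supremum of the ratio is at most 1 / 2. Halving
  comes from the upper bound in \<open>good_variance\<close>, growth from the logarithmic bound, and
  \<open>Cs\<close> from the equivalence of \<open>D2L\<close> and \<open>s2\<close>.\<close>

lemma coverage_good_variance:
  fixes E :: "nat \<Rightarrow> ('x, nat) design" and W :: "'x \<Rightarrow> 'w \<Rightarrow> real" and f :: "'x \<Rightarrow> real"
  assumes gp: "centered_gaussian_process \<Omega> W"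
    and \<kappa>: "0 < \<kappa>" and lam: "0 < lam"
    and \<eta>: "0 < \<eta>2" "\<eta>2 < 1" and q: "0 < q1 \<eta>1" "q1 \<eta>1 < q2 \<eta>1" "q2 \<eta>1 < 1"
    and design: "single_index_design \<Omega> W E"
    and sup1: "sup_tendsto_0_in_prob E (\<lambda>n. c_range m (E n))
          (\<lambda>n z c. (\<bar>R1L (E n) z c f\<bar> + \<bar>R2L (E n) z c\<bar>) / DL (E n) c f)"
    and variance: "good_variance m E"
    and log: "\<forall>\<^sub>F n in sequentially. \<forall>c\<in>c_range m (E n). D2L (E n) c \<ge> ln (real n * c)"
    and minimizer: "interior_minimizer m lam E f"
    and asymp: "unif_asymp (\<lambda>n. c_range m (E n)) (\<lambda>n. D2L (E n)) (\<lambda>n. s2 (E n))"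
    and bias: "good_bias m E f"
  shows "\<exists>M0. \<forall>M\<ge>M0. (\<lambda>n. coverage m \<kappa> lam q1 q2 (\<eta>1, \<eta>2) \<Omega> W (E n) M f) \<longlonglongrightarrow> 1"
proof -
  have npts: "npts (E n) = n" and eb: "orthonormal_eigenbasis \<Omega> W (E n)" for n
    using design by (auto simp: single_index_design_def)
  obtain \<beta> B0 B' where \<beta>: "0 < \<beta>" "0 < B'" and var: "\<forall>\<^sub>F n in sequentially. \<forall>c\<in>c_range m (E n). \<forall>k\<in>{0<..<1}.
        k * c \<in> c_range m (E n) \<longrightarrow> B0 * k powr \<beta> * D2L (E n) c \<le> D2L (E n) (k * c) \<and>
        D2L (E n) (k * c) \<le> B' * k powr \<beta> * D2L (E n) c"
    using variance unfolding good_variance_def by blast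
  \<comment> \<open>Solves B' k0 powr \<beta> <= 1 / 2; the cap 1 / 2 keeps k0 below 1.\<close>
  define k0 where "k0 = min (1 / 2) ((1 / (2 * B')) powr (1 / \<beta>))"
  have k0: "0 < k0" "k0 < 1" using \<beta> by (auto simp: k0_def)
  have "k0 powr \<beta> \<le> ((1 / (2 * B')) powr (1 / \<beta>)) powr \<beta>"
    using k0 \<beta> by (intro powr_mono2) (auto simp: k0_def)
  also have "\<dots> = 1 / (2 * B')" using \<beta> by (simp add: powr_powr)
  finally have k0_le: "B' * k0 powr \<beta> \<le> 1 / 2" using \<beta> by (simp add: field_simps)
  obtain A B where A: "0 < A" and AB: "\<forall>\<^sub>F n in sequentially. \<forall>c\<in>c_range m (E n).
      A \<le> D2L (E n) c / s2 (E n) c \<and> D2L (E n) c / s2 (E n) c \<le> B"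
    using asymp unfolding unif_asymp_def by blast
  define Cs where "Cs = max B 1"
  \<comment> \<open>On the range n c >= ln n, so that \<open>D2L\<close> >= ln (ln n), which tends
    to infinity; n >= 3 makes ln n >= 1.\<close>
  have growth: "\<forall>\<^sub>F n in sequentially. \<forall>c\<in>c_range m (E n). L \<le> D2L (E n) c" for L
  proof -
    have "\<forall>\<^sub>F n in sequentially. L \<le> ln (ln (real n))"
      using filterlim_at_top[THEN iffD1, OF filterlim_compose[OF ln_at_top filterlim_compose[OF ln_at_top filterlim_real_sequentially]]]
      by blast
    then show ?thesis
      using log eventually_ge_at_top[of "3::nat"]
    proof eventually_elim
      case (elim n)
      show ?case
      proof
        fix c assume c: "c \<in> c_range m (E n)"
        have "1 \<le> ln (real n)" using elim(3) exp_le by (subst ln_ge_iff) auto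
        moreover have "ln (real n) \<le> real n * c"
          using c elim(3) by (simp add: c_range_def npts field_simps)
        ultimately have "ln (ln (real n)) \<le> ln (real n * c)" by (intro ln_mono) auto
        then show "L \<le> D2L (E n) c" using elim(1,2) c by (meson order_trans)
      qed
    qed
  qed
  define G where "G n = {z \<in> space (std_normal_vec (npts (E n))).
      \<not> (SUP c\<in>c_range m (E n). ereal \<bar>(\<bar>R1L (E n) z c f\<bar> + \<bar>R2L (E n) z c\<bar>) / DL (E n) c f\<bar>) > ereal (1 / 2)}" for n
  define H where "H n = {z \<in> space (std_normal_vec (npts (E n))).
      (SUP c\<in>c_range m (E n). ereal \<bar>(\<bar>R1L (E n) z c f\<bar> + \<bar>R2L (E n) z c\<bar>) / DL (E n) c f\<bar>) > ereal (1 / 2)}" for n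
  have GH: "G n = space (std_normal_vec (npts (E n))) - H n" for n by (auto simp: G_def H_def)
  have DLpos: "\<forall>\<^sub>F n in sequentially. \<forall>c\<in>c_range m (E n). 0 < c \<and> 0 < DL (E n) c f"
    using growth[of 1] eventually_ge_at_top[of "2::nat"]
  proof eventually_elim
    case (elim n)
    interpret eigen_design \<Omega> W "E n" using gp eb by unfold_locales
    show ?case
    proof
      fix c assume c: "c \<in> c_range m (E n)"
      have "0 < ln (real n) / real n" using elim by simp
      then have "0 < c" using c by (auto simp: c_range_def npts)
      moreover have "1 \<le> D2L (E n) c" using c elim(1) by blast
      ultimately show "0 < c \<and> 0 < DL (E n) c f" using D1L_nonneg[of c f] by (simp add: DL_def)
    qed
  qed
  have H_sets: "\<forall>\<^sub>F n in sequentially. H n \<in> sets (std_normal_vec (npts (E n)))"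
    using DLpos minimizer[unfolded interior_minimizer_def]
  proof eventually_elim
    case (elim n)
    interpret eigen_design \<Omega> W "E n" using gp eb by unfold_locales
    obtain a b where I: "c_range m (E n) = {a..b}" unfolding c_range_def by blast
    \<comment> \<open>A point c with 2 c in the range shows that the interval is nonempty and, c
      being positive, not a single point.\<close>
    obtain c where "c \<in> {a..b}" "2 * c \<in> {a..b}" using elim(2) unfolding I by blast
    then have "a \<in> c_range m (E n)" unfolding I by auto
    then have "0 < a" using elim(1) by blast
    then have "a < b" using \<open>c \<in> {a..b}\<close> \<open>2 * c \<in> {a..b}\<close> by auto
    then show ?case unfolding H_def I using elim(1) \<open>0 < a\<close> unfolding I
      by (intro ratio_sup_event_measurable) auto
  qed
  show ?thesis
  proof (rule coverage_tendsto_1[where G = G and Cs = Cs and ?k0.0 = k0 and ?q1.0 = q1 and ?q2.0 = q2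
        and ?\<eta>1.0 = \<eta>1 and ?\<eta>2.0 = \<eta>2])
    show "\<forall>\<^sub>F n in sequentially. 2 \<le> npts (E n)" unfolding npts by (rule eventually_ge_at_top)
    show "\<forall>\<^sub>F n in sequentially. \<forall>c\<in>c_range m (E n). k0 * c \<in> c_range m (E n) \<longrightarrow>
        D2L (E n) (k0 * c) \<le> D2L (E n) c / 2"
      using var growth[of 0]
    proof eventually_elim
      case (elim n)
      show ?case
      proof (intro ballI impI)
        fix c assume c: "c \<in> c_range m (E n)" "k0 * c \<in> c_range m (E n)"
        have "D2L (E n) (k0 * c) \<le> (B' * k0 powr \<beta>) * D2L (E n) c" using elim(1) c k0 by auto
        also have "\<dots> \<le> 1 / 2 * D2L (E n) c" using elim(2) c by (intro mult_right_mono k0_le) auto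
        finally show "D2L (E n) (k0 * c) \<le> D2L (E n) c / 2" by simp
      qed
    qed
    show "0 < Cs" by (simp add: Cs_def)
    show "\<forall>\<^sub>F n in sequentially. \<forall>c\<in>c_range m (E n). D2L (E n) c \<le> Cs * s2 (E n) c"
      using AB DLpos
    proof eventually_elim
      case (elim n)
      interpret eigen_design \<Omega> W "E n" using gp eb by unfold_locales
      show ?case
      proof
        fix c assume c: "c \<in> c_range m (E n)"
        have AB: "A \<le> D2L (E n) c / s2 (E n) c" "D2L (E n) c / s2 (E n) c \<le> B"
          using elim(1) c by auto
        have "0 \<le> s2 (E n) c" using elim(2) c s2_nonneg[of c] by (auto intro: less_imp_le)
        \<comment> \<open>Division by 0 gives 0, which the lower bound A > 0 excludes.\<close>
        moreover have "s2 (E n) c \<noteq> 0" using AB(1) A by auto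
        ultimately have "0 < s2 (E n) c" by simp
        then have "D2L (E n) c \<le> B * s2 (E n) c" using AB(2) by (simp add: pos_divide_le_eq)
        also have "\<dots> \<le> Cs * s2 (E n) c" using \<open>0 < s2 (E n) c\<close> by (intro mult_right_mono) (auto simp: Cs_def)
        finally show "D2L (E n) c \<le> Cs * s2 (E n) c" .
      qed
    qed
    show "\<forall>\<^sub>F n in sequentially. \<forall>c\<in>c_range m (E n). L \<le> D2L (E n) c" for L by (rule growth)
    show "\<forall>\<^sub>F n in sequentially. G n \<in> sets (std_normal_vec (npts (E n)))"
      using H_sets by eventually_elim (auto simp: GH)
    show "\<forall>\<^sub>F n in sequentially. \<forall>z\<in>G n. \<forall>c\<in>c_range m (E n).
        \<bar>R1L (E n) z c f\<bar> + \<bar>R2L (E n) z c\<bar> \<le> DL (E n) c f / 2"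
      using DLpos
    proof eventually_elim
      case (elim n)
      show ?case
      proof (intro ballI)
        fix z c assume z: "z \<in> G n" and c: "c \<in> c_range m (E n)"
        have pos: "0 < DL (E n) c f" using elim c by blast
        have "\<not> ereal (1 / 2) < ereal \<bar>(\<bar>R1L (E n) z c f\<bar> + \<bar>R2L (E n) z c\<bar>) / DL (E n) c f\<bar>"
          using z c unfolding G_def less_SUP_iff by blast
        then have "(\<bar>R1L (E n) z c f\<bar> + \<bar>R2L (E n) z c\<bar>) / DL (E n) c f \<le> 1 / 2"
          using pos by simp
        then show "\<bar>R1L (E n) z c f\<bar> + \<bar>R2L (E n) z c\<bar> \<le> DL (E n) c f / 2"
          using pos by (simp add: pos_divide_le_eq)
      qed
    qed
    show "(\<lambda>n. measure (std_normal_vec (npts (E n))) (G n)) \<longlonglongrightarrow> 1"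
    proof -
      have "(\<lambda>n. measure (std_normal_vec (npts (E n))) (H n)) \<longlonglongrightarrow> 0"
        using sup1 unfolding sup_tendsto_0_in_prob_def H_def by (elim allE[of _ "1 / 2"]) simp
      then have "(\<lambda>n. 1 - measure (std_normal_vec (npts (E n))) (H n)) \<longlonglongrightarrow> 1 - 0"
        by (intro tendsto_intros)
      moreover have "\<forall>\<^sub>F n in sequentially. 1 - measure (std_normal_vec (npts (E n))) (H n)
          = measure (std_normal_vec (npts (E n))) (G n)"
        using H_sets
        by eventually_elim (simp add: GH prob_space.prob_compl prob_space_std_normal_vec)
      ultimately show ?thesis by (simp add: tendsto_cong)
    qed
  qed (fact gp eb \<kappa> lam \<eta> q minimizer bias k0)+
qed


subsection \<open>Remainders on a geometric grid\<close>

lemma filterlim_powr_at_top: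
  assumes "0 < (p :: real)" shows "LIM x at_top. x powr p :> at_top"
  unfolding filterlim_at_top
proof
  fix Z :: real
  have "\<forall>\<^sub>F x in at_top. max Z 1 powr (1 / p) \<le> x" by (rule eventually_ge_at_top)
  then show "\<forall>\<^sub>F x in at_top. Z \<le> x powr p"
  proof eventually_elim
    case (elim x)
    have "Z \<le> (max Z 1 powr (1 / p)) powr p" using assms by (simp add: powr_powr)
    also have "\<dots> \<le> x powr p" using elim assms by (intro powr_mono2) auto
    finally show ?case .
  qed
qed

context eigen_design
begin

text \<open>The quadratic form that \<open>square_sum_resolvent_le\<close> yields at the left end a
  of a cell, with y = \<open>wt a\<close>; likewise \<open>R2_form\<close> for the centred squares.
  Neither depends on the position within the cell.\<close>

definition R1_form :: "('x \<Rightarrow> real) \<Rightarrow> real \<Rightarrow> (nat \<Rightarrow> real) \<Rightarrow> real" where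
  "R1_form f a z = (\<Sum>i\<in>J. \<Sum>j\<in>J. (fcoef E f i / (1 + a * eig i) * zcoef E z i) * (fcoef E f j / (1 + a * eig j) * zcoef E z j)
      / (1 - wt a i * wt a j / 2))"

definition R2_form :: "real \<Rightarrow> (nat \<Rightarrow> real) \<Rightarrow> real" where
  "R2_form a z = (\<Sum>i\<in>J. \<Sum>j\<in>J. (wt a i * ((zcoef E z i)\<^sup>2 - 1)) * (wt a j * ((zcoef E z j)\<^sup>2 - 1))
      / (1 - wt a i * wt a j / 2))"

lemma wt_le_1: "0 \<le> a \<Longrightarrow> j \<in> J \<Longrightarrow> 0 \<le> wt a j \<and> wt a j \<le> 1"
  using wt_bounds[of a j] by simp

text \<open>At c = a (1 + s) the position s enters only through 1 + s y with y =
  \<open>wt a j\<close> in [0, 1], the shape that the geometric series requires.\<close>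

lemma cell_factor:
  assumes "0 < a" "0 \<le> s" "j \<in> J"
  shows "1 + a * (1 + s) * eig j = (1 + a * eig j) * (1 + s * wt a j)"
  using one_plus_pos[of a j] assms by (simp add: wt_def field_simps)

lemma R1L_square_le:
  assumes a: "0 < a" and s: "0 \<le> s" "s \<le> 1 / 2"
  shows "(R1L E z (a * (1 + s)) f)\<^sup>2 \<le> 8 * R1_form f a z"
proof -
  have "R1L E z (a * (1 + s)) f = 2 * (\<Sum>j\<in>J. (fcoef E f j / (1 + a * eig j)) * zcoef E z j / (1 + s * wt a j))"
    unfolding R1L_eq using a s
    by (intro arg_cong[where f = "\<lambda>x. 2 * x"] sum.cong refl) (simp add: cell_factor)
  then have "(R1L E z (a * (1 + s)) f)\<^sup>2
      = 4 * (\<Sum>j\<in>J. (fcoef E f j / (1 + a * eig j)) * zcoef E z j / (1 + s * wt a j))\<^sup>2"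
    by (simp add: power_mult_distrib)
  also have "\<dots> \<le> 4 * (2 * R1_form f a z)"
    unfolding R1_form_def using a s wt_le_1
    by (intro mult_left_mono square_sum_resolvent_le) auto
  finally show ?thesis by simp
qed

lemma R2L_square_le:
  assumes a: "0 < a" and s: "0 \<le> s" "s \<le> 1 / 2"
  shows "(R2L E z (a * (1 + s)))\<^sup>2 \<le> 8 * R2_form a z"
proof -
  let ?S = "\<Sum>j\<in>J. wt a j * ((zcoef E z j)\<^sup>2 - 1) / (1 + s * wt a j)"
  have "wt (a * (1 + s)) j = (1 + s) * (wt a j / (1 + s * wt a j))" if j: "j \<in> J" for j
    unfolding wt_def[of "a * (1 + s)"] cell_factor[OF a s(1) j] by (simp add: wt_def)
  then have "R2L E z (a * (1 + s)) = - ((1 + s) * ?S)"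
    by (simp add: R2L_eq sum_distrib_left mult_ac)
  then have "(R2L E z (a * (1 + s)))\<^sup>2 = (1 + s)\<^sup>2 * ?S\<^sup>2" by (simp add: power_mult_distrib)
  also have "\<dots> \<le> (3 / 2)\<^sup>2 * (2 * R2_form a z)"
    unfolding R2_form_def using a s wt_le_1
    by (intro mult_mono square_sum_resolvent_le power_mono) auto
  \<comment> \<open>The constant 9/2 is rounded up to the 8 of the other remainder, which
    presupposes a nonnegative form; the resolvent bound at s = 0 shows this.\<close>
  also have "\<dots> \<le> 8 * R2_form a z"
  proof -
    have "0 \<le> (\<Sum>j\<in>J. wt a j * ((zcoef E z j)\<^sup>2 - 1) / (1 + 0 * wt a j))\<^sup>2" by simp
    also have "\<dots> \<le> 2 * R2_form a z"
      unfolding R2_form_def using a wt_le_1 by (intro square_sum_resolvent_le) auto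
    finally show ?thesis by (simp add: power2_eq_square)
  qed
  finally show ?thesis .
qed

lemma measurable_forms [measurable]:
  "R1_form f a \<in> borel_measurable (std_normal_vec N)" "R2_form a \<in> borel_measurable (std_normal_vec N)"
  unfolding R1_form_def R2_form_def by measurable

lemma forms_nonneg: assumes a: "0 < a" shows "0 \<le> R1_form f a z" "0 \<le> R2_form a z"
proof -
  have "(R1L E z a f)\<^sup>2 \<le> 8 * R1_form f a z" "(R2L E z a)\<^sup>2 \<le> 8 * R2_form a z"
    using R1L_square_le[OF a, of 0 z f] R2L_square_le[OF a, of 0 z] by simp_all
  then show "0 \<le> R1_form f a z" "0 \<le> R2_form a z"
    using zero_le_power2[of "R1L E z a f"] zero_le_power2[of "R2L E z a"] by linarith+
qed

lemma resolvent_diag_le: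
  assumes a: "0 < a"
  shows "(\<Sum>j\<in>J. (v j)\<^sup>2 / (1 - wt a j * wt a j / 2)) \<le> 2 * (\<Sum>j\<in>J. (v j)\<^sup>2)"
  unfolding sum_distrib_left
proof (intro sum_mono)
  fix j assume j: "j \<in> J"
  have "wt a j * wt a j \<le> 1" using wt_le_1[of a j] a j by (intro mult_le_one) auto
  then have "(v j)\<^sup>2 / (1 - wt a j * wt a j / 2) \<le> (v j)\<^sup>2 / (1 / 2)"
    by (intro divide_left_mono) auto
  then show "(v j)\<^sup>2 / (1 - wt a j * wt a j / 2) \<le> 2 * (v j)\<^sup>2" by simp
qed

text \<open>Each diagonal term is at most 2 (F_j / (1 + a lambda_j))^2, and one factor 1 + a
  lambda_j >= 1 is dropped to reach \<open>D1L\<close>.\<close>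

lemma R1_form_integral:
  assumes a: "0 < a"
  shows "integrable (std_normal_vec N) (R1_form f a)" "(LINT z|std_normal_vec N. R1_form f a z) \<le> 2 * D1L E a f"
proof -
  let ?v = "\<lambda>j. fcoef E f j / (1 + a * eig j)"
  have h: "has_bochner_integral (std_normal_vec N) (R1_form f a) (1 * (\<Sum>j\<in>J. (?v j)\<^sup>2 / (1 - wt a j * wt a j / 2)))"
    unfolding R1_form_def by (rule has_bochner_integral_quadratic_form) (auto simp: zcoef_moments)
  then show "integrable (std_normal_vec N) (R1_form f a)" by (simp add: has_bochner_integral_iff)
  have "(LINT z|std_normal_vec N. R1_form f a z) \<le> 2 * (\<Sum>j\<in>J. (?v j)\<^sup>2)"
    using h resolvent_diag_le[OF a, of ?v] by (simp add: has_bochner_integral_iff)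
  also have "(\<Sum>j\<in>J. (?v j)\<^sup>2) \<le> D1L E a f"
    unfolding D1L_def
  proof (intro sum_mono)
    fix j assume j: "j \<in> J"
    have "1 + a * eig j \<le> (1 + a * eig j)\<^sup>2"
      using ceig_nonneg[of a j] a j by (simp add: power2_eq_square algebra_simps)
    then show "(?v j)\<^sup>2 \<le> (fcoef E f j)\<^sup>2 / (1 + a * eig j)"
      using one_plus_pos[of a j] a j unfolding power_divide by (intro divide_left_mono) auto
  qed
  finally show "(LINT z|std_normal_vec N. R1_form f a z) \<le> 2 * D1L E a f" by simp
qed

lemma R2_form_integral:
  assumes a: "0 < a"
  shows "integrable (std_normal_vec N) (R2_form a)" "(LINT z|std_normal_vec N. R2_form a z) \<le> 8 * D2L E a"
proof -
  have h: "has_bochner_integral (std_normal_vec N) (R2_form a) (2 * (\<Sum>j\<in>J. (wt a j)\<^sup>2 / (1 - wt a j * wt a j / 2)))"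
    unfolding R2_form_def by (rule has_bochner_integral_quadratic_form) (auto simp: zcoef_moments)
  then show "integrable (std_normal_vec N) (R2_form a)" by (simp add: has_bochner_integral_iff)
  have "(LINT z|std_normal_vec N. R2_form a z) \<le> 4 * (\<Sum>j\<in>J. (wt a j)\<^sup>2)"
    using h resolvent_diag_le[OF a, of "wt a"] by (simp add: has_bochner_integral_iff)
  then show "(LINT z|std_normal_vec N. R2_form a z) \<le> 8 * D2L E a"
    using sum_wt_square_le_D2L[of a] a by simp
qed

text \<open>288 = 8 * 36: outside the event 8 \<open>R1_form\<close> and 8 \<open>R2_form\<close>
  are at most (DL / 6)^2, so each remainder is at most DL / 6 on the whole cell, with DL taken at
  a.\<close>

definition bad_cell :: "('x \<Rightarrow> real) \<Rightarrow> real \<Rightarrow> (nat \<Rightarrow> real) set" where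
  "bad_cell f a = {z \<in> space (std_normal_vec N). (DL E a f)\<^sup>2 / 288 \<le> R1_form f a z + R2_form a z}"

lemma bad_cell_sets [measurable]: "bad_cell f a \<in> sets (std_normal_vec N)"
  unfolding bad_cell_def by measurable

text \<open>Markov's inequality: the mean of the two forms is at most 8 DL, against a level of order
  DL^2; 2304 = 8 * 288.\<close>

lemma prob_bad_cell:
  assumes a: "0 < a" and D: "0 < D2L E a"
  shows "measure (std_normal_vec N) (bad_cell f a) \<le> 2304 / D2L E a"
proof -
  have DL: "D2L E a \<le> DL E a f" using D1L_nonneg[of a f] a by (simp add: DL_def)
  then have DLp: "0 < DL E a f" using D by simp
  have "measure (std_normal_vec N) (bad_cell f a)
     \<le> (LINT z|std_normal_vec N. R1_form f a z + R2_form a z) / ((DL E a f)\<^sup>2 / 288)"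
    unfolding bad_cell_def
    using R1_form_integral[OF a] R2_form_integral[OF a] forms_nonneg[OF a] DLp
    by (intro integral_Markov_inequality_measure[where A = "{}"]) auto
  also have "\<dots> \<le> 8 * DL E a f / ((DL E a f)\<^sup>2 / 288)"
  proof (rule divide_right_mono)
    have "(LINT z|std_normal_vec N. R1_form f a z + R2_form a z) \<le> 2 * D1L E a f + 8 * D2L E a"
      using R1_form_integral[OF a, of f] R2_form_integral[OF a] by simp
    also have "\<dots> \<le> 8 * DL E a f" using D1L_nonneg[of a f] a by (simp add: DL_def)
    finally show "(LINT z|std_normal_vec N. R1_form f a z + R2_form a z) \<le> 8 * DL E a f" .
  qed simp
  also have "\<dots> = 2304 / DL E a f" using DLp by (simp add: power2_eq_square)
  also have "\<dots> \<le> 2304 / D2L E a" using DL D by (intro divide_left_mono) auto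
  finally show ?thesis .
qed

text \<open>The remainders add up to at most DL(a) / 3. From a to at most 3 a / 2 the bias keeps at
  least 2/3 of its size and the variance grows, so that DL(a) <= 3/2 DL(c).\<close>

lemma cell_regular:
  assumes a: "0 < a" and z: "z \<in> space (std_normal_vec N)" "z \<notin> bad_cell f a" and c: "a \<le> c" "c \<le> 3 / 2 * a"
  shows "\<bar>R1L E z c f\<bar> + \<bar>R2L E z c\<bar> \<le> DL E c f / 2"
proof -
  define s where "s = c / a - 1"
  have s: "0 \<le> s" "s \<le> 1 / 2" "c = a * (1 + s)" using a c by (auto simp: s_def field_simps)
  have DLn: "0 \<le> DL E a f" using D1L_nonneg[of a f] D2L_nonneg[of a] a by (simp add: DL_def)
  have H: "8 * R1_form f a z \<le> (DL E a f / 6)\<^sup>2" "8 * R2_form a z \<le> (DL E a f / 6)\<^sup>2"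
  proof -
    have split: "8 * h \<le> d / 36" "8 * k \<le> d / 36" if "0 \<le> h" "0 \<le> k" "h + k < d / 288" for h k d :: real
      using that by (auto simp: field_simps)
    have lt: "R1_form f a z + R2_form a z < (DL E a f)\<^sup>2 / 288" using z by (simp add: bad_cell_def)
    have sq: "(DL E a f / 6)\<^sup>2 = (DL E a f)\<^sup>2 / 36" by (simp add: power_divide)
    show "8 * R1_form f a z \<le> (DL E a f / 6)\<^sup>2" "8 * R2_form a z \<le> (DL E a f / 6)\<^sup>2"
      unfolding sq by (rule split[OF forms_nonneg(1)[OF a] forms_nonneg(2)[OF a] lt])+
  qed
  have abs_le: "\<bar>x\<bar> \<le> DL E a f / 6" if "x\<^sup>2 \<le> (DL E a f / 6)\<^sup>2" for x
  proof (rule power2_le_imp_le)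
    show "\<bar>x\<bar>\<^sup>2 \<le> (DL E a f / 6)\<^sup>2" unfolding power2_abs by (rule that)
  qed (use DLn in simp)
  have "\<bar>R1L E z c f\<bar> \<le> DL E a f / 6"
    unfolding s(3) by (rule abs_le[OF order_trans[OF R1L_square_le[OF a s(1,2)] H(1)]])
  moreover have "\<bar>R2L E z c\<bar> \<le> DL E a f / 6"
    unfolding s(3) by (rule abs_le[OF order_trans[OF R2L_square_le[OF a s(1,2)] H(2)]])
  moreover have "2 / 3 * DL E a f \<le> DL E c f"
  proof -
    have "D1L E (2 / 3 * (3 / 2 * a)) f \<le> D1L E (3 / 2 * a) f / (2 / 3)"
      using a by (intro D1L_scale) auto
    then have "2 / 3 * D1L E a f \<le> D1L E (3 / 2 * a) f" by simp
    also have "\<dots> \<le> D1L E c f" using a c by (intro D1L_antimono) auto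
    finally have "2 / 3 * D1L E a f \<le> D1L E c f" .
    moreover have "D2L E a \<le> D2L E c" using a c by (intro D2L_mono) auto
    moreover have "0 \<le> D2L E a" using a by (intro D2L_nonneg) auto
    ultimately show ?thesis unfolding DL_def by argo
  qed
  ultimately show ?thesis by argo
qed

lemma geometric_cell:
  fixes a c :: real
  assumes "0 < a" "a \<le> c"
  shows "\<exists>i. a * (3 / 2) ^ i \<le> c \<and> c \<le> 3 / 2 * (a * (3 / 2) ^ i)"
proof -
  obtain K where "c / a < (3 / 2) ^ K" using real_arch_pow[of "3 / 2 :: real"] by auto
  then have ex: "c < a * (3 / 2) ^ K" using assms by (simp add: pos_divide_less_eq mult.commute)
  define i where "i = (LEAST i. c < a * (3 / 2) ^ i)"
  have i: "c < a * (3 / 2) ^ i" unfolding i_def using ex by (rule LeastI)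
  have "i \<noteq> 0"
  proof
    assume "i = 0"
    then show False using i assms by simp
  qed
  then obtain i' where i': "i = Suc i'" by (cases i) auto
  have "\<not> c < a * (3 / 2) ^ i'" using not_less_Least[of i' "\<lambda>i. c < a * (3 / 2) ^ i"] i' by (simp add: i_def[symmetric])
  then show ?thesis using i i' by (intro exI[of _ i']) auto
qed

text \<open>Union bound over the cells that start in the range. At a (3/2)^i the lower bound for
  \<open>D2L\<close> has grown by (3/2)^(p i), so the bounds on the failure probabilities form a
  geometric series controlled by its first term, whatever b is.\<close>

lemma regular_event:
  assumes a: "0 < a" and T: "0 < T" and \<delta>: "0 < \<delta>" "0 < p"
    and low: "\<And>c. c \<in> {a..b} \<Longrightarrow> \<delta> * (c * T) powr p \<le> D2L E c"
  shows "\<exists>G\<in>sets (std_normal_vec N). (\<forall>z\<in>G. \<forall>c\<in>{a..b}. \<bar>R1L E z c f\<bar> + \<bar>R2L E z c\<bar> \<le> DL E c f / 2)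
    \<and> 1 - 2304 / (\<delta> * (1 - (2 / 3) powr p)) * (1 / (a * T) powr p) \<le> measure (std_normal_vec N) G"
proof -
  interpret S: prob_space "std_normal_vec N" by (rule prob_space_std_normal_vec)
  define g where "g i = a * (3 / 2) ^ i" for i :: nat
  have g_pos: "0 < g i" for i using a by (simp add: g_def)
  define Ig where "Ig = {i. g i \<le> b}"
  have "finite Ig"
  proof -
    obtain K where K: "b / a < (3 / 2) ^ K" using real_arch_pow[of "3 / 2 :: real"] by auto
    have "i \<le> K" if "i \<in> Ig" for i
    proof (rule ccontr)
      assume "\<not> i \<le> K"
      then have "(3 / 2 :: real) ^ K \<le> (3 / 2) ^ i" by (intro power_increasing) auto
      then have "a * (3 / 2) ^ K \<le> g i" unfolding g_def using a by (intro mult_left_mono) auto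
      moreover have "b < a * (3 / 2) ^ K" using K a by (simp add: pos_divide_less_eq mult.commute)
      ultimately have "b < g i" by simp
      then show False using that by (simp add: Ig_def)
    qed
    then show ?thesis by (meson finite_nat_set_iff_bounded_le)
  qed
  define G where "G = space (std_normal_vec N) - (\<Union>i\<in>Ig. bad_cell f (g i))"
  have Gs: "G \<in> sets (std_normal_vec N)" unfolding G_def using \<open>finite Ig\<close> by measurable
  define \<rho> where "\<rho> = (2 / 3 :: real) powr p"
  have \<rho>: "0 < \<rho>" "\<rho> < 1" using \<delta> powr_less_mono2[of p "2 / 3" 1] by (auto simp: \<rho>_def)
  define \<tau> where "\<tau> = (a * T) powr p"
  have \<tau>: "0 < \<tau>" using a T by (simp add: \<tau>_def)
  have "measure (std_normal_vec N) (\<Union>i\<in>Ig. bad_cell f (g i)) \<le> (\<Sum>i\<in>Ig. measure (std_normal_vec N) (bad_cell f (g i)))"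
    using \<open>finite Ig\<close> by (intro S.finite_measure_subadditive_finite) auto
  also have "\<dots> \<le> (\<Sum>i\<in>Ig. 2304 / (\<delta> * \<tau>) * \<rho> ^ i)"
  proof (rule sum_mono)
    fix i assume i: "i \<in> Ig"
    have "a * 1 \<le> a * (3 / 2) ^ i" using a by (intro mult_left_mono one_le_power) auto
    then have gi: "g i \<in> {a..b}" using i by (auto simp: Ig_def g_def)
    have "(g i * T) powr p = \<tau> / \<rho> ^ i"
    proof -
      have "(g i * T) powr p = ((a * T) * (3 / 2) ^ i) powr p" by (simp add: g_def mult_ac)
      also have "\<dots> = \<tau> * ((3 / 2) ^ i) powr p" using a T by (simp add: powr_mult \<tau>_def)
      also have "((3 / 2 :: real) ^ i) powr p = ((3 / 2) powr p) ^ i"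
        by (simp add: powr_realpow[symmetric] powr_powr mult.commute)
      also have "(3 / 2 :: real) powr p = 1 / \<rho>" by (simp add: \<rho>_def powr_divide)
      finally show ?thesis by (simp add: power_divide)
    qed
    then have low': "\<delta> * \<tau> / \<rho> ^ i \<le> D2L E (g i)" using low[OF gi] by simp
    moreover have "0 < \<delta> * \<tau> / \<rho> ^ i" using \<delta> \<tau> \<rho> by simp
    ultimately have D: "0 < D2L E (g i)" by linarith
    have "measure (std_normal_vec N) (bad_cell f (g i)) \<le> 2304 / D2L E (g i)" by (rule prob_bad_cell[OF g_pos D])
    also have "\<dots> \<le> 2304 / (\<delta> * \<tau> / \<rho> ^ i)" 
      by (rule divide_left_mono[OF low' _ mult_pos_pos[OF D \<open>0 < \<delta> * \<tau> / \<rho> ^ i\<close>]]) simp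
    finally show "measure (std_normal_vec N) (bad_cell f (g i)) \<le> 2304 / (\<delta> * \<tau>) * \<rho> ^ i" by simp
  qed
  also have "\<dots> \<le> 2304 / (\<delta> * \<tau>) * (1 / (1 - \<rho>))"
  proof -
    have "(\<Sum>i\<in>Ig. \<rho> ^ i) \<le> (\<Sum>i. \<rho> ^ i)"
      using \<rho> \<open>finite Ig\<close> by (intro sum_le_suminf summable_geometric) auto
    also have "\<dots> = 1 / (1 - \<rho>)" using \<rho> by (intro suminf_geometric) auto
    finally show ?thesis
      unfolding sum_distrib_left[symmetric] using \<delta> \<tau> by (intro mult_left_mono) auto
  qed
  finally have bound: "measure (std_normal_vec N) (\<Union>i\<in>Ig. bad_cell f (g i)) \<le> 2304 / (\<delta> * (1 - \<rho>)) * (1 / \<tau>)"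
    by (simp add: mult_ac)
  have U: "(\<Union>i\<in>Ig. bad_cell f (g i)) \<in> sets (std_normal_vec N)" using \<open>finite Ig\<close> by measurable
  have "1 - 2304 / (\<delta> * (1 - \<rho>)) * (1 / \<tau>) \<le> measure (std_normal_vec N) G"
    unfolding G_def using bound by (simp add: S.prob_compl[OF U])
  moreover have "\<bar>R1L E z c f\<bar> + \<bar>R2L E z c\<bar> \<le> DL E c f / 2" if z: "z \<in> G" and c: "c \<in> {a..b}" for z c
  proof -
    obtain i where i: "g i \<le> c" "c \<le> 3 / 2 * g i"
      using geometric_cell[OF a, of c] c unfolding g_def by auto
    then have "i \<in> Ig" using c by (simp add: Ig_def)
    then show ?thesis using z i g_pos[of i] by (intro cell_regular[of "g i"]) (auto simp: G_def)
  qed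
  ultimately show ?thesis using Gs unfolding \<rho>_def \<tau>_def by blast
qed

end

text \<open>The first cell starts where c N = ln N, so the failure probability is of order (ln N)
  powr (- p). Halving gives D2L(c) <= 2 (D2L(c) - D2L(k0 c)), and this difference is bounded by a
  multiple of \<open>s2\<close>.\<close>

lemma coverage_growth:
  fixes E :: "nat \<Rightarrow> ('x, 'i) design" and W :: "'x \<Rightarrow> 'w \<Rightarrow> real" and f :: "'x \<Rightarrow> real"
  assumes gp: "centered_gaussian_process \<Omega> W" and eb: "\<And>n. orthonormal_eigenbasis \<Omega> W (E n)"
    and npts: "LIM n sequentially. npts (E n) :> at_top"
    and \<kappa>: "0 < \<kappa>" and lam: "0 < lam"
    and \<eta>: "0 < \<eta>2" "\<eta>2 < 1" and q: "0 < q1 \<eta>1" "q1 \<eta>1 < q2 \<eta>1" "q2 \<eta>1 < 1"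
    and minimizer: "interior_minimizer m lam E f" and bias: "good_bias m E f"
    and k0: "0 < k0" "k0 < 1" and \<delta>: "0 < \<delta>" "0 < p"
    and spec: "\<forall>\<^sub>F n in sequentially. \<forall>c\<in>c_range m (E n). D2L (E n) (k0 * c) \<le> D2L (E n) c / 2 \<and>
        \<delta> * (c * real (npts (E n))) powr p \<le> D2L (E n) c"
  shows "\<exists>M0. \<forall>M\<ge>M0. (\<lambda>n. coverage m \<kappa> lam q1 q2 (\<eta>1, \<eta>2) \<Omega> W (E n) M f) \<longlonglongrightarrow> 1"
proof -
  define \<tau> where "\<tau> n = ln (real (npts (E n))) powr p" for n
  have ev2: "\<forall>\<^sub>F n in sequentially. 2 \<le> npts (E n)" using npts by (simp add: filterlim_at_top)
  have \<tau>_top: "LIM n sequentially. \<tau> n :> at_top"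
    unfolding \<tau>_def
    by (intro filterlim_compose[OF filterlim_powr_at_top[OF \<delta>(2)]] filterlim_compose[OF ln_at_top]
        filterlim_compose[OF filterlim_real_sequentially npts])
  have facts: "\<forall>\<^sub>F n in sequentially. \<forall>c\<in>c_range m (E n). 0 < c \<and> \<delta> * \<tau> n \<le> D2L (E n) c"
    using spec ev2
  proof eventually_elim
    case (elim n)
    show ?case
    proof
      fix c assume c: "c \<in> c_range m (E n)"
      have le: "ln (real (npts (E n))) \<le> c * real (npts (E n))"
        using c elim(2) by (simp add: c_range_def field_simps)
      have "0 < ln (real (npts (E n))) / real (npts (E n))" using elim(2) by simp
      then have "0 < c" using c by (auto simp: c_range_def)
      moreover have "\<delta> * \<tau> n \<le> \<delta> * (c * real (npts (E n))) powr p"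
        unfolding \<tau>_def using le elim(2) \<delta> by (intro mult_left_mono powr_mono2) auto
      moreover have "\<dots> \<le> D2L (E n) c" using elim(1) c by blast
      ultimately show "0 < c \<and> \<delta> * \<tau> n \<le> D2L (E n) c" by linarith
    qed
  qed
  define Kp where "Kp = 2304 / (\<delta> * (1 - (2 / 3) powr p))"
  define ok where "ok n G \<longleftrightarrow> G \<in> sets (std_normal_vec (npts (E n))) \<and>
      (\<forall>z\<in>G. \<forall>c\<in>c_range m (E n). \<bar>R1L (E n) z c f\<bar> + \<bar>R2L (E n) z c\<bar> \<le> DL (E n) c f / 2) \<and>
      1 - Kp * (1 / \<tau> n) \<le> measure (std_normal_vec (npts (E n))) G" for n G
  \<comment> \<open>One event is chosen for each n; the choice is meaningful for the large n at
    which such an event exists.\<close>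
  define G where "G n = (SOME G. ok n G)" for n
  have G: "\<forall>\<^sub>F n in sequentially. ok n (G n)"
    using spec ev2
  proof eventually_elim
    case (elim n)
    interpret eigen_design \<Omega> W "E n" using gp eb by unfold_locales
    have "\<exists>G. ok n G"
    proof -
      have "0 < ln (real N) / real N" "0 < real N" using elim(2) by auto
      moreover have "ln (real N) / real N * real N = ln (real N)" using elim(2) by simp
      ultimately show ?thesis
        using regular_event[of "ln (real N) / real N" "real N" \<delta> p "real N powr (m - 1)" f] \<delta> elim(1)
        unfolding c_range_def ok_def Kp_def \<tau>_def by auto
    qed
    then show ?case unfolding G_def by (rule someI_ex)
  qed
  show ?thesis
  proof (rule coverage_tendsto_1[where G = G and Cs = "2 * (1 + 2 * ln (1 / k0))" and ?k0.0 = k0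
        and ?q1.0 = q1 and ?q2.0 = q2 and ?\<eta>1.0 = \<eta>1 and ?\<eta>2.0 = \<eta>2])
    show "\<forall>\<^sub>F n in sequentially. \<forall>c\<in>c_range m (E n). k0 * c \<in> c_range m (E n) \<longrightarrow>
        D2L (E n) (k0 * c) \<le> D2L (E n) c / 2"
      using spec by eventually_elim blast
    have "0 < ln (1 / k0)" using k0 by (intro ln_gt_zero) simp
    then show "0 < 2 * (1 + 2 * ln (1 / k0))" by argo
    show "\<forall>\<^sub>F n in sequentially. \<forall>c\<in>c_range m (E n). D2L (E n) c \<le> 2 * (1 + 2 * ln (1 / k0)) * s2 (E n) c"
      using spec facts
    proof eventually_elim
      case (elim n)
      interpret eigen_design \<Omega> W "E n" using gp eb by unfold_locales
      show ?case
      proof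
        fix c assume c: "c \<in> c_range m (E n)"
        have "0 < c" using elim(2) c by blast
        then have "D2L (E n) c - D2L (E n) (k0 * c) \<le> (1 + 2 * ln (1 / k0)) * s2 (E n) c"
          using k0 by (intro D2L_diff_le_s2) auto
        moreover have "D2L (E n) (k0 * c) \<le> D2L (E n) c / 2" using elim(1) c by blast
        ultimately show "D2L (E n) c \<le> 2 * (1 + 2 * ln (1 / k0)) * s2 (E n) c"
          unfolding mult.assoc by argo
      qed
    qed
    show "\<forall>\<^sub>F n in sequentially. \<forall>c\<in>c_range m (E n). L \<le> D2L (E n) c" for L
    proof -
      have "\<forall>\<^sub>F n in sequentially. L / \<delta> \<le> \<tau> n" using \<tau>_top by (simp add: filterlim_at_top)
      then show ?thesis using facts
      proof eventually_elim
        case (elim n)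
        have "L \<le> \<delta> * \<tau> n" using elim(1) \<delta> by (simp add: pos_divide_le_eq mult.commute)
        then show ?case using elim(2) by (meson order_trans)
      qed
    qed
    show "\<forall>\<^sub>F n in sequentially. G n \<in> sets (std_normal_vec (npts (E n)))"
      using G by eventually_elim (simp add: ok_def)
    show "\<forall>\<^sub>F n in sequentially. \<forall>z\<in>G n. \<forall>c\<in>c_range m (E n).
        \<bar>R1L (E n) z c f\<bar> + \<bar>R2L (E n) z c\<bar> \<le> DL (E n) c f / 2"
      using G by eventually_elim (simp add: ok_def)
    show "(\<lambda>n. measure (std_normal_vec (npts (E n))) (G n)) \<longlonglongrightarrow> 1"
    proof (rule tendsto_sandwich)
      show "\<forall>\<^sub>F n in sequentially. 1 - Kp * (1 / \<tau> n) \<le> measure (std_normal_vec (npts (E n))) (G n)"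
        using G by eventually_elim (simp add: ok_def)
      show "\<forall>\<^sub>F n in sequentially. measure (std_normal_vec (npts (E n))) (G n) \<le> 1"
        by (intro always_eventually allI prob_space.prob_le_1 prob_space_std_normal_vec)
      have "(\<lambda>n. 1 - Kp * (1 / \<tau> n)) \<longlonglongrightarrow> 1 - Kp * 0"
        by (intro tendsto_intros tendsto_divide_0[OF tendsto_const] filterlim_at_top_imp_at_infinity \<tau>_top)
      then show "(\<lambda>n. 1 - Kp * (1 / \<tau> n)) \<longlonglongrightarrow> 1" by simp
    qed (rule tendsto_const)
  qed (fact gp eb ev2 \<kappa> lam \<eta> q minimizer bias k0)+
qed


subsection \<open>Eigenvalue conditions\<close>

text \<open>The first entry compensates the gap between the eigenvalue bounds when an index is
  replaced by one with g larger by a factor of at most \<kappa>. The second makes terms with c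
  lambda <= B \<kappa> drop to a quarter, as in \<open>sum_log_gap_small\<close>.\<close>

definition shrink_factor :: "real \<Rightarrow> real \<Rightarrow> real \<Rightarrow> real" where
  "shrink_factor A B \<kappa> = min (A / (B * \<kappa>)) (1 / (2 * (1 + B * \<kappa>)))"

lemma shrink_factor:
  assumes "0 < A" "0 < B" "0 < \<kappa>"
  shows "0 < shrink_factor A B \<kappa>" "shrink_factor A B \<kappa> < 1" "shrink_factor A B \<kappa> * (B * \<kappa>) \<le> A"
    "shrink_factor A B \<kappa> * (1 + B * \<kappa>) \<le> 1 / 2"
proof -
  let ?k = "shrink_factor A B \<kappa>"
  have Bk: "0 < B * \<kappa>" using assms by simp
  show "0 < ?k" using assms Bk by (simp add: shrink_factor_def add_pos_pos)
  have "?k \<le> A / (B * \<kappa>)" by (simp add: shrink_factor_def)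
  then show "?k * (B * \<kappa>) \<le> A" using Bk by (simp add: pos_le_divide_eq)
  have "?k \<le> 1 / (2 * (1 + B * \<kappa>))" by (simp add: shrink_factor_def)
  then have "?k * (2 * (1 + B * \<kappa>)) \<le> 1" using Bk by (subst (asm) pos_le_divide_eq) auto
  then show half: "?k * (1 + B * \<kappa>) \<le> 1 / 2" by (simp add: algebra_simps)
  have "?k * 1 \<le> ?k * (1 + B * \<kappa>)" using \<open>0 < ?k\<close> Bk by (intro mult_left_mono) auto
  then show "?k < 1" using half by simp
qed

text \<open>The eigenvalues are compared with \<open>N / g j\<close>. Multiplying an index by 8 changes \<open>g\<close> by a
  bounded factor; spreading the mass of one small index over its 8 multiples \<open>8 i - r\<close> shows that
  shrinking \<open>c\<close> halves \<open>D2L\<close>. Where this is not possible, \<open>c \<lambda>\<close> is bounded and \<open>D2L\<close> is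
  quadratic.\<close>

lemma (in eigen_design) spectral_conditions:
  fixes A B \<kappa> m :: real and g :: "'i \<Rightarrow> real" and \<phi> \<psi> :: "nat \<Rightarrow> 'i \<Rightarrow> 'i" and \<rho> :: "nat \<Rightarrow> 'i"
  assumes A: "0 < A" and B: "0 < B" and \<kappa>: "0 < \<kappa>" and m: "1 \<le> m" and N: "3 \<le> N"
    and g: "\<And>j. j \<in> J \<Longrightarrow> 0 < g j"
    and eig: "\<And>j. j \<in> J \<Longrightarrow> A * N / g j \<le> eig j \<and> eig j \<le> B * N / g j"
    and X: "X1 \<subseteq> J" "X2 \<subseteq> J"
    and \<phi>: "inj_on (\<lambda>(r, j). \<phi> r j) ({..<8} \<times> X1)"
      "\<And>r j. r < 8 \<Longrightarrow> j \<in> X1 \<Longrightarrow> \<phi> r j \<in> J \<and> g (\<phi> r j) \<le> \<kappa> * g j"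
    and \<psi>: "inj_on (\<lambda>(r, j). \<psi> r j) ({..<8} \<times> X2)"
      "\<And>r j. r < 8 \<Longrightarrow> j \<in> X2 \<Longrightarrow> \<psi> r j \<in> J \<and> g (\<psi> r j) \<le> \<kappa> * g j"
    and rest: "\<And>j. j \<in> J - X1 - X2 \<Longrightarrow> real N powr m \<le> \<kappa> * g j"
    and \<rho>: "inj_on \<rho> {1..}" "\<And>i. 1 \<le> i \<Longrightarrow> i\<^sup>2 \<le> N \<Longrightarrow> \<rho> i \<in> J \<and> g (\<rho> i) \<le> \<kappa> * real i powr (2 * m)"
    and c: "c \<in> c_range m E"
  shows "D2L E (shrink_factor A B \<kappa> * c) \<le> D2L E c / 2"
    and "log_gap (A / \<kappa>) / 2 * (c * real N) powr (1 / (2 * m)) \<le> D2L E c"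
proof -
  let ?k = "shrink_factor A B \<kappa>"
  note k = shrink_factor[OF A B \<kappa>]
  have N0: "0 < real N" using N by simp
  have c_bounds: "ln (real N) / real N \<le> c" "c \<le> real N powr (m - 1)" using c by (auto simp: c_range_def)
  have "0 < ln (real N) / real N" using N by simp
  then have c0: "0 < c" using c_bounds by linarith
  have T: "1 \<le> c * real N" "c * real N \<le> real N powr m"
  proof -
    have "1 \<le> ln (real N)" using N exp_le by (subst ln_ge_iff) auto
    also have "\<dots> \<le> c * real N" using c_bounds(1) N0 by (simp add: pos_divide_le_eq)
    finally show "1 \<le> c * real N" .
    have "c * real N \<le> real N powr (m - 1) * real N powr 1" using c_bounds(2) N0 by simp
    also have "\<dots> = real N powr m" unfolding powr_add[symmetric] by simp
    finally show "c * real N \<le> real N powr m" .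
  qed
  have x: "0 \<le> c * eig j" if "j \<in> J" for j using that c0 by (intro ceig_nonneg) auto
  have move: "?k * (c * eig j) \<le> c * eig i" if j: "j \<in> J" and i: "i \<in> J" "g i \<le> \<kappa> * g j" for i j
  proof -
    have "?k * eig j \<le> ?k * (B * N / g j)" using eig[OF j] k by (intro mult_left_mono) auto
    also have "\<dots> = (?k * (B * \<kappa>)) * N / (\<kappa> * g j)" using \<kappa> by simp
    also have "\<dots> \<le> A * N / (\<kappa> * g j)"
      using k(3) g[OF j] \<kappa> by (intro divide_right_mono mult_right_mono) auto
    also have "\<dots> \<le> A * N / g i"
      using i(2) g[OF j] g[OF i(1)] \<kappa> A by (intro divide_left_mono) auto
    also have "\<dots> \<le> eig i" using eig[OF i(1)] by simp
    finally have "c * (?k * eig j) \<le> c * eig i" using c0 by (intro mult_left_mono) auto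
    then show ?thesis by (simp add: mult_ac)
  qed
  have bounded: "c * eig j \<le> B * \<kappa>" if j: "j \<in> J - X1 - X2" for j
  proof -
    have gj: "0 < g j" using g j by simp
    have "c * eig j \<le> c * (B * N / g j)" using eig[of j] j c0 by (intro mult_left_mono) auto
    also have "\<dots> = B * (c * N) / g j" by simp
    also have "\<dots> \<le> B * (\<kappa> * g j) / g j"
      using T(2) rest[OF j] B gj by (intro divide_right_mono mult_left_mono) auto
    also have "\<dots> = B * \<kappa>" using gj by simp
    finally show ?thesis .
  qed
  let ?D = "\<Sum>j\<in>J. log_gap (c * eig j)"
  have 1: "real 8 * (\<Sum>j\<in>X1. log_gap (?k * (c * eig j))) \<le> ?D"
    using \<phi> X k move x by (intro sum_log_gap_reindex[where \<phi> = \<phi>]) auto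
  have 2: "real 8 * (\<Sum>j\<in>X2. log_gap (?k * (c * eig j))) \<le> ?D"
    using \<psi> X k move x by (intro sum_log_gap_reindex[where \<phi> = \<psi>]) auto
  have 3: "(\<Sum>j\<in>J - X1 - X2. log_gap (?k * (c * eig j))) \<le> ?D / 4"
    using k x bounded by (intro sum_log_gap_small[where b = "B * \<kappa>"]) auto
  have pos: "0 \<le> log_gap (?k * (c * eig j))" if "j \<in> J" for j
    using x[OF that] k by (intro log_gap_nonneg) auto
  have fin: "finite X1" "finite X2" using X finJ finite_subset by blast+
  have "(\<Sum>j\<in>J. log_gap (?k * (c * eig j)))
      \<le> (\<Sum>j\<in>X1. log_gap (?k * (c * eig j))) + (\<Sum>j\<in>X2. log_gap (?k * (c * eig j)))
        + (\<Sum>j\<in>J - X1 - X2. log_gap (?k * (c * eig j)))"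
  proof -
    \<comment> \<open>The sets \<open>X1\<close> and \<open>X2\<close> may overlap; counting the
      overlap twice is harmless, the terms being nonnegative.\<close>
    have diff: "(J - X1) - (X2 - X1) = J - X1 - X2" by auto
    have "(\<Sum>j\<in>J. log_gap (?k * (c * eig j)))
        = (\<Sum>j\<in>X1. log_gap (?k * (c * eig j))) + (\<Sum>j\<in>X2 - X1. log_gap (?k * (c * eig j)))
          + (\<Sum>j\<in>J - X1 - X2. log_gap (?k * (c * eig j)))"
      using sum.subset_diff[of X1 J "\<lambda>j. log_gap (?k * (c * eig j))"]
        sum.subset_diff[of "X2 - X1" "J - X1" "\<lambda>j. log_gap (?k * (c * eig j))"] X
      unfolding diff by (simp add: Diff_mono)
    moreover have "(\<Sum>j\<in>X2 - X1. log_gap (?k * (c * eig j))) \<le> (\<Sum>j\<in>X2. log_gap (?k * (c * eig j)))"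
      using fin pos X by (intro sum_mono2) auto
    ultimately show ?thesis by simp
  qed
  \<comment> \<open>1/8 + 1/8 + 1/4 = 1/2: this is why an index is spread over 8 others.\<close>
  moreover have "s \<le> D / 2" if "s \<le> s1 + s2 + s3" "real 8 * s1 \<le> D" "real 8 * s2 \<le> D" "s3 \<le> D / 4"
    for s s1 s2 s3 D :: real
  proof -
    have "8 * s1 \<le> D" "8 * s2 \<le> D" "4 * s3 \<le> D" using that by auto
    then have "2 * s \<le> D" using that(1) by linarith
    then show ?thesis by simp
  qed
  ultimately have "(\<Sum>j\<in>J. log_gap (?k * (c * eig j))) \<le> ?D / 2" using 1 2 3 by blast
  then show "D2L E (?k * c) \<le> D2L E c / 2" by (simp add: D2L_eq mult.assoc)
  let ?p = "1 / (2 * m)"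
  \<comment> \<open>For i <= t, g (\<rho> i) <= \<kappa> i powr (2 m) <= \<kappa> c N, so c lambda
    >= A / \<kappa> there, and each such index contributes a fixed amount. The upper end of the
    range of c gives i^2 <= N, so that these indices exist.\<close>
  define t where "t = (c * real N) powr ?p"
  have t1: "1 \<le> t" using T(1) m by (simp add: t_def ge_one_powr_ge_zero)
  define K where "K = nat \<lfloor>t\<rfloor>"
  have K: "real K \<le> t" "t < real K + 1" using t1 by (auto simp: K_def of_nat_nat)
  have "\<rho> i \<in> J \<and> log_gap (A / \<kappa>) \<le> log_gap (c * eig (\<rho> i))" if i: "i \<in> {1..K}" for i
  proof -
    have it: "1 \<le> real i" "real i \<le> t" using i K by auto
    have "real i powr (2 * m) \<le> t powr (2 * m)" using it m by (intro powr_mono2) auto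
    also have "t powr (2 * m) = c * real N" using m T by (simp add: t_def powr_powr)
    finally have iT: "real i powr (2 * m) \<le> c * real N" .
    have "real i powr (2 * m) \<le> real N powr m" using iT T(2) by (rule order_trans)
    then have "(real i powr (2 * m)) powr (1 / m) \<le> (real N powr m) powr (1 / m)"
      using m by (intro powr_mono2) auto
    then have "real i powr 2 \<le> real N" using m N0 by (simp add: powr_powr)
    then have "(real i)\<^sup>2 \<le> real N" using it powr_realpow[of "real i" 2] by simp
    then have "i\<^sup>2 \<le> N" by (simp add: of_nat_power[symmetric] del: of_nat_power)
    then have \<rho>i: "\<rho> i \<in> J" "g (\<rho> i) \<le> \<kappa> * real i powr (2 * m)" using \<rho>(2)[of i] i by auto
    have "A / \<kappa> \<le> A * (c * N) / (\<kappa> * real i powr (2 * m))"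
      using iT A \<kappa> it by (simp add: pos_le_divide_eq mult_ac)
    also have "\<dots> \<le> A * (c * N) / g (\<rho> i)"
      using \<rho>i g[OF \<rho>i(1)] A \<kappa> it T(1) by (intro divide_left_mono) auto
    also have "\<dots> = c * (A * N / g (\<rho> i))" by simp
    also have "\<dots> \<le> c * eig (\<rho> i)" using eig[OF \<rho>i(1)] c0 by (intro mult_left_mono) auto
    finally show ?thesis using \<rho>i(1) A \<kappa> by (intro conjI log_gap_mono) auto
  qed
  note row = this
  have lg: "0 \<le> log_gap (A / \<kappa>)" using A \<kappa> by (intro log_gap_nonneg) auto
  have "log_gap (A / \<kappa>) / 2 * t \<le> real K * log_gap (A / \<kappa>)"
  proof -
    have "t / 2 \<le> real K"
    proof (cases "K = 0")
      case False
      then show ?thesis using K by simp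
    qed (use K t1 in auto)
    from mult_right_mono[OF this lg] show ?thesis by (simp add: mult.commute)
  qed
  also have "\<dots> = (\<Sum>i\<in>{1..K}. log_gap (A / \<kappa>))" by simp
  also have "\<dots> \<le> (\<Sum>i\<in>{1..K}. log_gap (c * eig (\<rho> i)))" using row by (intro sum_mono) auto
  also have "\<dots> = (\<Sum>j\<in>\<rho> ` {1..K}. log_gap (c * eig j))"
    by (subst sum.reindex) (auto intro: inj_on_subset[OF \<rho>(1)])
  also have "\<dots> \<le> D2L E c"
    unfolding D2L_eq using row x by (intro sum_mono2) (auto intro: log_gap_nonneg)
  finally show "log_gap (A / \<kappa>) / 2 * (c * real N) powr ?p \<le> D2L E c" by (simp add: t_def)
qed

lemma log_gap_pos: assumes "0 < x" shows "0 < log_gap x"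
proof -
  have "0 < (x / (1 + x))\<^sup>2" using assms by simp
  then show ?thesis using log_gap_ge_square[of x] assms by linarith
qed

text \<open>The numbers 8 i - r with r < 8 fill the block from 8 i - 7 to 8 i, and these blocks are
  disjoint; adding 7 before the division by 8 recovers i. The subtraction is not truncated, as i >=
  1.\<close>

lemma multiple_inj:
  fixes i i' r r' :: nat
  assumes "8 * i - r = 8 * i' - r'" "r < 8" "r' < 8" "1 \<le> i" "1 \<le> i'" shows "i = i' \<and> r = r'"
proof -
  have div: "(8 * i - r + 7) div 8 = i" if "r < 8" "1 \<le> i" for i r :: nat
  proof -
    have "8 * i - r + 7 = (7 - r) + 8 * i" using that by simp
    also have "((7 - r) + 8 * i) div 8 = i" by (subst div_mult_self2) auto
    finally show ?thesis .
  qed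
  have "i = i'" using div[of r i] div[of r' i'] assms by simp
  then show ?thesis using assms by simp
qed


text \<open>With g j = j powr m one family of multiples is enough: indices with 8 j <= n are spread,
  and for the others n < 8 j gives n powr m <= K g j with K = 8 powr m. The row \<rho> is the
  identity.\<close>

lemma coverage_polynomial:
  fixes E :: "nat \<Rightarrow> ('x, nat) design" and W :: "'x \<Rightarrow> 'w \<Rightarrow> real" and f :: "'x \<Rightarrow> real"
  assumes gp: "centered_gaussian_process \<Omega> W" and m: "1 \<le> m"
    and \<kappa>: "0 < \<kappa>" and lam: "0 < lam"
    and \<eta>: "0 < \<eta>2" "\<eta>2 < 1" and q: "0 < q1 \<eta>1" "q1 \<eta>1 < q2 \<eta>1" "q2 \<eta>1 < 1"
    and design: "single_index_design \<Omega> W E" and poly: "polynomial_eigenvalues m E"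
    and minimizer: "interior_minimizer m lam E f" and bias: "good_bias m E f"
  shows "\<exists>M0. \<forall>M\<ge>M0. (\<lambda>n. coverage m \<kappa> lam q1 q2 (\<eta>1, \<eta>2) \<Omega> W (E n) M f) \<longlonglongrightarrow> 1"
proof -
  have npts: "npts (E n) = n" and idx: "idx (E n) = {1..n}" and eb: "orthonormal_eigenbasis \<Omega> W (E n)" for n
    using design by (auto simp: single_index_design_def)
  obtain d d' where d: "0 < d" "d \<le> d'" and eigs: "\<And>n j. j \<in> {1..n} \<Longrightarrow>
      d * real n / real j powr m \<le> eigval (E n) j \<and> eigval (E n) j \<le> d' * real n / real j powr m"
    using poly unfolding polynomial_eigenvalues_def by blast
  define K where "K = (8 :: real) powr m"
  have K: "0 < K" "1 \<le> K" using m by (auto simp: K_def ge_one_powr_ge_zero)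
  have spec: "D2L (E n) (shrink_factor d d' K * c) \<le> D2L (E n) c / 2 \<and>
      log_gap (d / K) / 2 * (c * real (npts (E n))) powr (1 / (2 * m)) \<le> D2L (E n) c"
    if n: "3 \<le> n" and c: "c \<in> c_range m (E n)" for n c
  proof -
    interpret eigen_design \<Omega> W "E n" using gp eb by unfold_locales
    let ?X = "{j\<in>{1..n}. 8 * j \<le> n}"
    have scale: "real (8 * j - r) powr m \<le> K * real j powr m" for j r
    proof -
      have "real (8 * j - r) powr m \<le> (8 * real j) powr m" using m by (intro powr_mono2) auto
      then show ?thesis by (simp add: K_def powr_mult)
    qed
    have inj: "inj_on (\<lambda>(r, j). 8 * j - r) ({..<8} \<times> ?X)"
      by (intro inj_onI) (auto dest: multiple_inj)
    have rest: "real n powr m \<le> K * real j powr m" if "j \<in> {1..n} - ?X - {}" for j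
    proof -
      have "real n powr m \<le> (8 * real j) powr m" using m that by (intro powr_mono2) auto
      then show ?thesis by (simp add: K_def powr_mult)
    qed
    have row: "i \<in> {1..n} \<and> real i powr m \<le> K * real i powr (2 * m)" if i: "1 \<le> i" "i\<^sup>2 \<le> n" for i
    proof -
      have "i \<le> n" using le_square[of i] i(2) unfolding power2_eq_square by (rule order_trans)
      moreover have "1 * real i powr m \<le> K * real i powr (2 * m)"
        using i m K by (intro mult_mono powr_mono) auto
      ultimately show ?thesis using i by simp
    qed
    have pos: "0 < real j powr m" if "j \<in> {1..n}" for j using that by simp
    have X: "?X \<subseteq> {1..n}" "{} \<subseteq> {1..n}" by auto
    have map: "8 * j - r \<in> {1..n} \<and> real (8 * j - r) powr m \<le> K * real j powr m" if "r < 8" "j \<in> ?X" for r j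
      using that scale[of j r] by auto
    have empty: "inj_on (\<lambda>(r, j). j) ({..<8 :: nat} \<times> {})" by simp
    have empty': "j \<in> {1..n} \<and> real j powr m \<le> K * real j powr m" if "r < (8 :: nat)" "j \<in> {}" for r j :: nat
      using that by simp
    have \<rho>: "inj_on (\<lambda>i. i) {1 :: nat..}" by simp
    have d': "0 < d'" using d by simp
    note conditions = spectral_conditions[of d d' K m "\<lambda>j. real j powr m" ?X "{}" "\<lambda>r j. 8 * j - r" "\<lambda>r j. j" "\<lambda>i. i" c,
        unfolded npts idx, OF d(1) d' K(1) m n pos eigs X inj map empty empty' rest \<rho> row c]
    show ?thesis using conditions unfolding npts by blast
  qed
  have "0 < log_gap (d / K)" using d K by (intro log_gap_pos) auto
  show ?thesis
  proof (rule coverage_growth[where ?k0.0 = "shrink_factor d d' K" and \<delta> = "log_gap (d / K) / 2"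
        and p = "1 / (2 * m)" and ?q1.0 = q1 and ?q2.0 = q2 and ?\<eta>1.0 = \<eta>1 and ?\<eta>2.0 = \<eta>2])
    show "LIM n sequentially. npts (E n) :> at_top" unfolding npts by (rule filterlim_ident)
    show "0 < shrink_factor d d' K" "shrink_factor d d' K < 1"
      using shrink_factor[of d d' K] d K by auto
    show "0 < log_gap (d / K) / 2" "0 < 1 / (2 * m)"
      using \<open>0 < log_gap (d / K)\<close> m by auto
    show "\<forall>\<^sub>F n in sequentially. \<forall>c\<in>c_range m (E n).
        D2L (E n) (shrink_factor d d' K * c) \<le> D2L (E n) c / 2 \<and>
        log_gap (d / K) / 2 * (c * real (npts (E n))) powr (1 / (2 * m)) \<le> D2L (E n) c"
      using eventually_ge_at_top[of 3] by eventually_elim (use spec in blast)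
  qed (fact gp eb \<kappa> lam \<eta> q minimizer bias)+
qed

text \<open>Multiples are taken in the first coordinate on \<open>?X1\<close> and in the second on
  \<open>?X2\<close>; what remains is the corner n < 8 i, n < 8 j, where g is at least of order
  (n^2) powr m. The row \<rho> i = (i, 1) stays in the square because i^2 <= N = n^2.\<close>

lemma coverage_double:
  fixes E :: "nat \<Rightarrow> ('x, nat \<times> nat) design" and W :: "'x \<Rightarrow> 'w \<Rightarrow> real" and f :: "'x \<Rightarrow> real"
    and g :: "nat \<Rightarrow> nat \<Rightarrow> real"
  assumes gp: "centered_gaussian_process \<Omega> W" and m: "1 \<le> m"
    and \<kappa>: "0 < \<kappa>" and lam: "0 < lam"
    and \<eta>: "0 < \<eta>2" "\<eta>2 < 1" and q: "0 < q1 \<eta>1" "q1 \<eta>1 < q2 \<eta>1" "q2 \<eta>1 < 1"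
    and design: "double_index_design \<Omega> W E"
    and asymp: "unif_asymp (\<lambda>n. {1..n} \<times> {1..n}) (\<lambda>n. eigval (E n)) (\<lambda>n (i, j). (real n)\<^sup>2 / g i j)"
    and K: "0 < K" and g_pos: "\<And>i j. 1 \<le> i \<Longrightarrow> 1 \<le> j \<Longrightarrow> 0 < g i j"
    and g_scale: "\<And>i j r. g (8 * i - r) j \<le> K * g i j" "\<And>i j r. g i (8 * j - r) \<le> K * g i j"
    and g_rest: "\<And>n i j. n < 8 * i \<Longrightarrow> n < 8 * j \<Longrightarrow> (real n)\<^sup>2 powr m \<le> K * g i j"
    and g_row: "\<And>i. 1 \<le> i \<Longrightarrow> g i 1 \<le> K * real i powr (2 * m)"
    and minimizer: "interior_minimizer m lam E f" and bias: "good_bias m E f"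
  shows "\<exists>M0. \<forall>M\<ge>M0. (\<lambda>n. coverage m \<kappa> lam q1 q2 (\<eta>1, \<eta>2) \<Omega> W (E n) M f) \<longlonglongrightarrow> 1"
proof -
  have npts: "npts (E n) = n\<^sup>2" and idx: "idx (E n) = {1..n} \<times> {1..n}"
    and eb: "orthonormal_eigenbasis \<Omega> W (E n)" for n
    using design by (auto simp: double_index_design_def)
  obtain A B0 where A: "0 < A" and AB: "\<forall>\<^sub>F n in sequentially. \<forall>t\<in>{1..n} \<times> {1..n}.
      A \<le> eigval (E n) t / (case t of (i, j) \<Rightarrow> (real n)\<^sup>2 / g i j) \<and>
      eigval (E n) t / (case t of (i, j) \<Rightarrow> (real n)\<^sup>2 / g i j) \<le> B0"
    using asymp unfolding unif_asymp_def by blast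
  define B where "B = max B0 1"
  have B: "0 < B" "B0 \<le> B" by (auto simp: B_def)
  define gg where "gg t = g (fst t) (snd t)" for t
  have spec: "D2L (E n) (shrink_factor A B K * c) \<le> D2L (E n) c / 2 \<and>
      log_gap (A / K) / 2 * (c * real (npts (E n))) powr (1 / (2 * m)) \<le> D2L (E n) c"
    if n: "3 \<le> n" and c: "c \<in> c_range m (E n)" and ABn: "\<forall>t\<in>{1..n} \<times> {1..n}.
      A \<le> eigval (E n) t / (case t of (i, j) \<Rightarrow> (real n)\<^sup>2 / g i j) \<and>
      eigval (E n) t / (case t of (i, j) \<Rightarrow> (real n)\<^sup>2 / g i j) \<le> B0" for n c
  proof -
    interpret eigen_design \<Omega> W "E n" using gp eb by unfold_locales
    let ?I = "{1..n} \<times> {1..n}"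
    let ?X1 = "{t\<in>?I. 8 * fst t \<le> n}" and ?X2 = "{t\<in>?I. 8 * snd t \<le> n}"
    let ?\<phi> = "\<lambda>(r::nat) t. (8 * fst t - r, snd t)" and ?\<psi> = "\<lambda>(r::nat) t. (fst t, 8 * snd t - r)"
    have n2: "3 \<le> n\<^sup>2"
    proof -
      have "3 * 1 \<le> n * n" using n by (intro mult_mono) auto
      then show ?thesis by (simp add: power2_eq_square)
    qed
    have pos: "0 < gg t" if "t \<in> ?I" for t
      using that g_pos[of "fst t" "snd t"] by (auto simp: gg_def)
    have eigs: "A * real (n\<^sup>2) / gg t \<le> eig t \<and> eig t \<le> B * real (n\<^sup>2) / gg t" if t: "t \<in> ?I" for t
    proof -
      have h: "0 < (real n)\<^sup>2 / gg t" using pos[OF t] n by simp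
      have "A \<le> eig t / ((real n)\<^sup>2 / gg t)" "eig t / ((real n)\<^sup>2 / gg t) \<le> B0"
        using ABn t by (auto simp: gg_def case_prod_beta)
      then have "A * ((real n)\<^sup>2 / gg t) \<le> eig t" "eig t \<le> B0 * ((real n)\<^sup>2 / gg t)"
        by (simp_all only: pos_le_divide_eq[OF h] pos_divide_le_eq[OF h])
      moreover have "B0 * ((real n)\<^sup>2 / gg t) \<le> B * ((real n)\<^sup>2 / gg t)"
        using B h by (intro mult_right_mono) auto
      ultimately show ?thesis by simp
    qed
    have \<phi>: "inj_on (\<lambda>(r, t). ?\<phi> r t) ({..<8} \<times> ?X1)" "inj_on (\<lambda>(r, t). ?\<psi> r t) ({..<8} \<times> ?X2)"
      by (intro inj_onI; auto dest: multiple_inj)+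
    have map: "?\<phi> r t \<in> ?I \<and> gg (?\<phi> r t) \<le> K * gg t" if "r < 8" "t \<in> ?X1" for r t
      using that g_scale(1)[of "fst t" r "snd t"] by (auto simp: gg_def)
    have map': "?\<psi> r t \<in> ?I \<and> gg (?\<psi> r t) \<le> K * gg t" if "r < 8" "t \<in> ?X2" for r t
      using that g_scale(2)[of "fst t" "snd t" r] by (auto simp: gg_def)
    have rest: "real (n\<^sup>2) powr m \<le> K * gg t" if "t \<in> ?I - ?X1 - ?X2" for t
      using that g_rest[of n "fst t" "snd t"] by (auto simp: gg_def)
    have row: "(i, 1) \<in> ?I \<and> gg (i, 1) \<le> K * real i powr (2 * m)" if i: "1 \<le> i" "i\<^sup>2 \<le> n\<^sup>2" for i
      using i g_row[of i] n by (auto simp: gg_def power2_nat_le_eq_le)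
    show ?thesis
    proof
      have X: "?X1 \<subseteq> ?I" "?X2 \<subseteq> ?I" by auto
      have \<rho>: "inj_on (\<lambda>i. (i, 1 :: nat)) {1..}" by (auto simp: inj_on_def)
      note conditions = spectral_conditions[of A B K m gg ?X1 ?X2 ?\<phi> ?\<psi> "\<lambda>i. (i, 1)" c,
          unfolded npts idx, OF A B(1) K m n2 pos eigs X \<phi>(1) map \<phi>(2) map' rest \<rho> row c]
      show "D2L (E n) (shrink_factor A B K * c) \<le> D2L (E n) c / 2"
        by (rule conditions(1))
      show "log_gap (A / K) / 2 * (c * real (npts (E n))) powr (1 / (2 * m)) \<le> D2L (E n) c"
        unfolding npts by (rule conditions(2))
    qed
  qed
  have "0 < log_gap (A / K)" using A K by (intro log_gap_pos) auto
  show ?thesis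
  proof (rule coverage_growth[where ?k0.0 = "shrink_factor A B K" and \<delta> = "log_gap (A / K) / 2"
        and p = "1 / (2 * m)" and ?q1.0 = q1 and ?q2.0 = q2 and ?\<eta>1.0 = \<eta>1 and ?\<eta>2.0 = \<eta>2])
    show "LIM n sequentially. npts (E n) :> at_top"
    proof (rule filterlim_at_top_mono[OF filterlim_ident])
      show "\<forall>\<^sub>F n in sequentially. n \<le> npts (E n)"
        by (simp add: npts power2_eq_square)
    qed
    show "0 < shrink_factor A B K" "shrink_factor A B K < 1"
      using shrink_factor[of A B K] A B K by auto
    show "0 < log_gap (A / K) / 2" "0 < 1 / (2 * m)"
      using \<open>0 < log_gap (A / K)\<close> m by auto
    show "\<forall>\<^sub>F n in sequentially. \<forall>c\<in>c_range m (E n).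
        D2L (E n) (shrink_factor A B K * c) \<le> D2L (E n) c / 2 \<and>
        log_gap (A / K) / 2 * (c * real (npts (E n))) powr (1 / (2 * m)) \<le> D2L (E n) c"
      using eventually_ge_at_top[of 3] AB by eventually_elim (use spec in blast)
  qed (fact gp eb \<kappa> lam \<eta> q minimizer bias)+
qed

lemma coverage_product:
  fixes E :: "nat \<Rightarrow> ('x, nat \<times> nat) design" and W :: "'x \<Rightarrow> 'w \<Rightarrow> real" and f :: "'x \<Rightarrow> real"
  assumes gp: "centered_gaussian_process \<Omega> W" and m: "1 \<le> m"
    and \<kappa>: "0 < \<kappa>" and lam: "0 < lam"
    and \<eta>: "0 < \<eta>2" "\<eta>2 < 1" and q: "0 < q1 \<eta>1" "q1 \<eta>1 < q2 \<eta>1" "q2 \<eta>1 < 1"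
    and design: "double_index_design \<Omega> W E" and eigs: "product_eigenvalues m E"
    and minimizer: "interior_minimizer m lam E f" and bias: "good_bias m E f"
  shows "\<exists>M0. \<forall>M\<ge>M0. (\<lambda>n. coverage m \<kappa> lam q1 q2 (\<eta>1, \<eta>2) \<Omega> W (E n) M f) \<longlonglongrightarrow> 1"
\<comment> \<open>The corner dictates 64 = 8 * 8, as n^2 <= 64 i j there; moving a single coordinate
  costs only 8 powr m.\<close>
proof (rule coverage_double[where g = "\<lambda>i j. real i powr m * real j powr m" and K = "64 powr m"
      and ?q1.0 = q1 and ?q2.0 = q2 and ?\<eta>1.0 = \<eta>1 and ?\<eta>2.0 = \<eta>2])
  have scale: "real (8 * i - r) powr m \<le> 64 powr m * real i powr m" for i r :: nat
  proof -
    have "real (8 * i - r) powr m \<le> (64 * real i) powr m" using m by (intro powr_mono2) auto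
    then show ?thesis by (simp add: powr_mult)
  qed
  show "real (8 * i - r) powr m * real j powr m \<le> 64 powr m * (real i powr m * real j powr m)" for i j r :: nat
    using mult_right_mono[OF scale[of i r], of "real j powr m"] by (simp add: mult.assoc)
  show "real i powr m * real (8 * j - r) powr m \<le> 64 powr m * (real i powr m * real j powr m)" for i j r :: nat
    using mult_left_mono[OF scale[of j r], of "real i powr m"] by (simp add: mult_ac)
  show "(real n)\<^sup>2 powr m \<le> 64 powr m * (real i powr m * real j powr m)" if "n < 8 * i" "n < 8 * j" for n i j :: nat
  proof -
    have "real n * real n \<le> (8 * real i) * (8 * real j)" using that by (intro mult_mono) auto
    then have "(real n)\<^sup>2 powr m \<le> (64 * (real i * real j)) powr m"
      using m by (intro powr_mono2) (auto simp: power2_eq_square)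
    then show ?thesis by (simp add: powr_mult)
  qed
  show "real i powr m * real 1 powr m \<le> 64 powr m * real i powr (2 * m)" if "1 \<le> i" for i :: nat
  proof -
    have "1 * real i powr m \<le> 64 powr m * real i powr (2 * m)"
      using that m by (intro mult_mono powr_mono) (auto simp: ge_one_powr_ge_zero)
    then show ?thesis by simp
  qed
qed (use gp m \<kappa> lam \<eta> q design eigs minimizer bias in \<open>auto simp: product_eigenvalues_def\<close>)

lemma coverage_sobolev:
  fixes E :: "nat \<Rightarrow> ('x, nat \<times> nat) design" and W :: "'x \<Rightarrow> 'w \<Rightarrow> real" and f :: "'x \<Rightarrow> real"
  assumes gp: "centered_gaussian_process \<Omega> W" and m: "1 \<le> m"
    and \<kappa>: "0 < \<kappa>" and lam: "0 < lam"
    and \<eta>: "0 < \<eta>2" "\<eta>2 < 1" and q: "0 < q1 \<eta>1" "q1 \<eta>1 < q2 \<eta>1" "q2 \<eta>1 < 1"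
    and design: "double_index_design \<Omega> W E" and eigs: "sobolev_eigenvalues m E"
    and minimizer: "interior_minimizer m lam E f" and bias: "good_bias m E f"
  shows "\<exists>M0. \<forall>M\<ge>M0. (\<lambda>n. coverage m \<kappa> lam q1 q2 (\<eta>1, \<eta>2) \<Omega> W (E n) M f) \<longlonglongrightarrow> 1"
proof (rule coverage_double[where g = "\<lambda>i j. ((real i)\<^sup>2 + (real j)\<^sup>2) powr m" and K = "64 powr m"
      and ?q1.0 = q1 and ?q2.0 = q2 and ?\<eta>1.0 = \<eta>1 and ?\<eta>2.0 = \<eta>2])
  have powr_le: "x powr m \<le> 64 powr m * y powr m" if "0 \<le> x" "x \<le> 64 * y" "0 \<le> y" for x y :: real
  proof -
    have "x powr m \<le> (64 * y) powr m" using m that by (intro powr_mono2) auto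
    then show ?thesis using that by (simp add: powr_mult)
  qed
  have sq: "(real (8 * i - r))\<^sup>2 \<le> 64 * (real i)\<^sup>2" for i r :: nat
  proof -
    have "(real (8 * i - r))\<^sup>2 \<le> (8 * real i)\<^sup>2" by (intro power_mono) auto
    then show ?thesis by (simp add: power_mult_distrib)
  qed
  show "((real (8 * i - r))\<^sup>2 + (real j)\<^sup>2) powr m \<le> 64 powr m * ((real i)\<^sup>2 + (real j)\<^sup>2) powr m" for i j r :: nat
  proof (rule powr_le)
    show "(real (8 * i - r))\<^sup>2 + (real j)\<^sup>2 \<le> 64 * ((real i)\<^sup>2 + (real j)\<^sup>2)"
      using sq[of i r] zero_le_power2[of "real j"] unfolding distrib_left by linarith
  qed auto
  show "((real i)\<^sup>2 + (real (8 * j - r))\<^sup>2) powr m \<le> 64 powr m * ((real i)\<^sup>2 + (real j)\<^sup>2) powr m" for i j r :: nat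
  proof (rule powr_le)
    show "(real i)\<^sup>2 + (real (8 * j - r))\<^sup>2 \<le> 64 * ((real i)\<^sup>2 + (real j)\<^sup>2)"
      using sq[of j r] zero_le_power2[of "real i"] unfolding distrib_left by linarith
  qed auto
  show "(real n)\<^sup>2 powr m \<le> 64 powr m * ((real i)\<^sup>2 + (real j)\<^sup>2) powr m" if "n < 8 * i" "n < 8 * j" for n i j :: nat
  proof (rule powr_le)
    have "(real n)\<^sup>2 \<le> (8 * real i)\<^sup>2" using that by (intro power_mono) auto
    then have "(real n)\<^sup>2 \<le> 64 * (real i)\<^sup>2" by (simp add: power_mult_distrib)
    then show "(real n)\<^sup>2 \<le> 64 * ((real i)\<^sup>2 + (real j)\<^sup>2)"
      using zero_le_power2[of "real j"] unfolding distrib_left by linarith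
  qed auto
  \<comment> \<open>This case dictates the exponent 2 m of the row condition: (i^2 + 1) powr m is
    comparable with i powr (2 m), whereas the product condition has i powr m.\<close>
  show "((real i)\<^sup>2 + (real 1)\<^sup>2) powr m \<le> 64 powr m * real i powr (2 * m)" if i: "1 \<le> i" for i :: nat
  proof -
    have "1 \<le> (real i)\<^sup>2" using i by simp
    then have "((real i)\<^sup>2 + (real 1)\<^sup>2) powr m \<le> 64 powr m * (real i)\<^sup>2 powr m"
      by (intro powr_le) auto
    also have "(real i)\<^sup>2 powr m = real i powr (2 * m)"
      using i by (simp add: powr_powr flip: powr_numeral)
    finally show ?thesis .
  qed
  show "0 < ((real i)\<^sup>2 + (real j)\<^sup>2) powr m" if "1 \<le> i" "1 \<le> j" for i j :: nat
    using that by (simp add: sum_power2_eq_zero_iff)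
qed (use gp m \<kappa> lam \<eta> q design eigs minimizer bias in \<open>auto simp: sobolev_eigenvalues_def\<close>)

theorem theorem27:
  fixes \<Omega> :: "'w measure" and W :: "'x \<Rightarrow> 'w \<Rightarrow> real" and f :: "'x \<Rightarrow> real"
    and m \<kappa> lam \<eta>1 \<eta>2 :: real and q1 q2 :: "real \<Rightarrow> real"
  assumes "centered_gaussian_process \<Omega> W"
    and "m \<ge> 1" and "\<kappa> > 0" and "lam > 0"
    and "\<eta>1 \<in> {0<..<1}" and "\<eta>2 \<in> {0<..<1}"
    and "\<forall>h\<in>{0<..<1}. 0 < q1 h \<and> q1 h < q2 h \<and> q2 h < 1"
  shows
    "(\<forall>E :: nat \<Rightarrow> ('x, nat) design.
        single_index_design \<Omega> W E \<longrightarrow>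
        sup_tendsto_0_in_prob E (\<lambda>n. c_range m (E n))
          (\<lambda>n z c. (\<bar>R1L (E n) z c f\<bar> + \<bar>R2L (E n) z c\<bar>) / DL (E n) c f) \<longrightarrow>
        sup_tendsto_0_in_prob E (\<lambda>n. c_range m (E n))
          (\<lambda>n z c. (\<bar>R3 (E n) z c f\<bar> + \<bar>R4 (E n) z c\<bar>) / DL (E n) c f) \<longrightarrow>
        sup_tendsto_0_in_prob E (\<lambda>n. c_range m (E n))
          (\<lambda>n z c. N_stat (E n) z c / s2 (E n) c - 1) \<longrightarrow>
        good_variance m E \<longrightarrow>
        (\<forall>\<^sub>F n in sequentially. \<forall>c\<in>c_range m (E n). D2L (E n) c \<ge> ln (real n * c)) \<longrightarrow>
        interior_minimizer m lam E f \<longrightarrow>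
        unif_asymp (\<lambda>n. c_range m (E n)) (\<lambda>n. D2R (E n)) (\<lambda>n. D2L (E n)) \<longrightarrow>
        unif_asymp (\<lambda>n. c_range m (E n)) (\<lambda>n. D2L (E n)) (\<lambda>n. s2 (E n)) \<longrightarrow>
        good_bias m E f \<longrightarrow>
        (\<exists>M0. \<forall>M\<ge>M0. (\<lambda>n. coverage m \<kappa> lam q1 q2 (\<eta>1, \<eta>2) \<Omega> W (E n) M f) \<longlonglongrightarrow> 1))
   \<and> (\<forall>E :: nat \<Rightarrow> ('x, nat) design.
        single_index_design \<Omega> W E \<longrightarrow> polynomial_eigenvalues m E \<longrightarrow>
        interior_minimizer m lam E f \<longrightarrow> good_bias m E f \<longrightarrow>
        (\<exists>M0. \<forall>M\<ge>M0. (\<lambda>n. coverage m \<kappa> lam q1 q2 (\<eta>1, \<eta>2) \<Omega> W (E n) M f) \<longlonglongrightarrow> 1))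
   \<and> (\<forall>E :: nat \<Rightarrow> ('x, nat \<times> nat) design.
        double_index_design \<Omega> W E \<longrightarrow> product_eigenvalues m E \<or> sobolev_eigenvalues m E \<longrightarrow>
        interior_minimizer m lam E f \<longrightarrow> good_bias m E f \<longrightarrow>
        (\<exists>M0. \<forall>M\<ge>M0. (\<lambda>n. coverage m \<kappa> lam q1 q2 (\<eta>1, \<eta>2) \<Omega> W (E n) M f) \<longlonglongrightarrow> 1))"
proof (intro conjI allI impI)
  have q: "0 < q1 \<eta>1" "q1 \<eta>1 < q2 \<eta>1" "q2 \<eta>1 < 1" and \<eta>: "0 < \<eta>2" "\<eta>2 < 1"
    using assms(5-7) by auto
  {
    fix E :: "nat \<Rightarrow> ('x, nat) design"
    assume "single_index_design \<Omega> W E"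
      "sup_tendsto_0_in_prob E (\<lambda>n. c_range m (E n))
          (\<lambda>n z c. (\<bar>R1L (E n) z c f\<bar> + \<bar>R2L (E n) z c\<bar>) / DL (E n) c f)"
      "good_variance m E"
      "\<forall>\<^sub>F n in sequentially. \<forall>c\<in>c_range m (E n). D2L (E n) c \<ge> ln (real n * c)"
      "interior_minimizer m lam E f"
      "unif_asymp (\<lambda>n. c_range m (E n)) (\<lambda>n. D2L (E n)) (\<lambda>n. s2 (E n))"
      "good_bias m E f"
    then show "\<exists>M0. \<forall>M\<ge>M0. (\<lambda>n. coverage m \<kappa> lam q1 q2 (\<eta>1, \<eta>2) \<Omega> W (E n) M f) \<longlonglongrightarrow> 1"
      using coverage_good_variance[of \<Omega> W \<kappa> lam \<eta>2 q1 \<eta>1 q2 E m f] assms(1-4) q \<eta> by blast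
  next
    fix E :: "nat \<Rightarrow> ('x, nat) design"
    assume "single_index_design \<Omega> W E" "polynomial_eigenvalues m E"
      "interior_minimizer m lam E f" "good_bias m E f"
    then show "\<exists>M0. \<forall>M\<ge>M0. (\<lambda>n. coverage m \<kappa> lam q1 q2 (\<eta>1, \<eta>2) \<Omega> W (E n) M f) \<longlonglongrightarrow> 1"
      using coverage_polynomial[of \<Omega> W m \<kappa> lam \<eta>2 q1 \<eta>1 q2 E f] assms(1-4) q \<eta> by blast
  next
    fix E :: "nat \<Rightarrow> ('x, nat \<times> nat) design"
    assume "double_index_design \<Omega> W E" "product_eigenvalues m E \<or> sobolev_eigenvalues m E"
      "interior_minimizer m lam E f" "good_bias m E f"
    then show "\<exists>M0. \<forall>M\<ge>M0. (\<lambda>n. coverage m \<kappa> lam q1 q2 (\<eta>1, \<eta>2) \<Omega> W (E n) M f) \<longlonglongrightarrow> 1"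
      using coverage_product[of \<Omega> W m \<kappa> lam \<eta>2 q1 \<eta>1 q2 E f]
        coverage_sobolev[of \<Omega> W m \<kappa> lam \<eta>2 q1 \<eta>1 q2 E f] assms(1-4) q \<eta> by blast
  }
qed



end
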